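(* Let $p\ge 1$, $s=1/p$ and $f(u)=\frac{|u|^{p+1}}{p+1}$. There exists a compactly supported initial datum $u_0\in L^\infty(\mathbb{R})$ such that the corresponding entropy solution $u\in L^\infty(\mathbb{R}\times[0,\infty))$ of $$\partial_t u+\partial_x f(u)=0\quad (x\in\mathbb{R},\ t>0),\qquad u(x,0)=u_0(x)\quad (x\in\mathbb{R}),$$ satisfies, for all $t>0$ and all $\varepsilon>0$, $$TV^{s}u(\cdot,t)<+\infty=TV^{s+\varepsilon}u(\cdot,t).$$
   Context: For $\sigma>0$ and a function $v:\mathbb{R}\to\mathbb{R}$, the $TV^\sigma$ variation is $$TV^\sigma v=\sup\sum_{i=2}^n|v(x_i)-v(x_{i-1})|^{1/\sigma},$$ the supremum being over all $n\ge2$ and all $x_1<\dots<x_n$ in $\mathbb{R}$. For a function defined only almost everywhere, $TV^\sigma$ denotes the infimum over its representatives. "Entropy solution" means Kruzhkov entropy solution: $u$ is bounded, $u\in C([0,\infty);L^1_{loc}(\mathbb{R}))$, $u(\cdot,0)=u_0$, and for every $k\in\mathbb{R}$, $\partial_t|u-k|+\partial_x\big(\mathrm{sgn}(u-k)(f(u)-f(k))\big)\le 0$ in the sense of distributions on $\mathbb{R}\times(0,\infty)$. *)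

theory Defs
  imports "HOL-Analysis.Analysis"
begin

definition TV :: "real \<Rightarrow> (real \<Rightarrow> real) \<Rightarrow> ennreal" where
  "TV \<sigma> v =
     (SUP (n, x) \<in> {(n :: nat, x :: nat \<Rightarrow> real). 2 \<le> n \<and> strict_mono_on {1..n} x}.
        \<Sum>i = 2..n. ennreal (\<bar>v (x i) - v (x (i - 1))\<bar> powr (1 / \<sigma>)))"

definition TV_ae :: "real \<Rightarrow> (real \<Rightarrow> real) \<Rightarrow> ennreal" where
  "TV_ae \<sigma> v = (INF w \<in> {w. AE x in lebesgue. w x = v x}. TV \<sigma> w)"

(* Elements of L^\<infinity> and L^1_loc are handled through representatives. *)
definition L_infty :: "'a measure \<Rightarrow> ('a \<Rightarrow> real) \<Rightarrow> bool" where
  "L_infty M g \<longleftrightarrow> g \<in> borel_measurable M \<and> (\<exists>C. AE z in M. \<bar>g z\<bar> \<le> C)"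

definition L1_loc :: "(real \<Rightarrow> real) \<Rightarrow> bool" where
  "L1_loc v \<longleftrightarrow> (\<forall>K. compact K \<longrightarrow> set_integrable lebesgue K v)"

(* u \<in> C([0,\<infinity>); L^1_loc(\<real>)), where u x t is the value at the point x and time t. *)
definition continuous_L1_loc :: "(real \<Rightarrow> real \<Rightarrow> real) \<Rightarrow> bool" where
  "continuous_L1_loc u \<longleftrightarrow>
     (\<forall>t\<ge>0. L1_loc (\<lambda>x. u x t)) \<and>
     (\<forall>t\<^sub>0\<ge>0. \<forall>K. compact K \<longrightarrow>
        ((\<lambda>t. LINT x:K|lebesgue. \<bar>u x t - u x t\<^sub>0\<bar>) \<longlongrightarrow> 0) (at t\<^sub>0 within {0..}))"

definition tsupport :: "('a::topological_space \<Rightarrow> real) \<Rightarrow> 'a set" where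
  "tsupport g = closure {z. g z \<noteq> 0}"

fun C_k :: "nat \<Rightarrow> ('a::real_normed_vector \<Rightarrow> real) \<Rightarrow> bool" where
  "C_k 0 g \<longleftrightarrow> continuous_on UNIV g"
| "C_k (Suc n) g \<longleftrightarrow>
     (\<forall>z. g differentiable (at z)) \<and> (\<forall>v. C_k n (\<lambda>z. frechet_derivative g (at z) v))"

(* \<phi> \<in> C_c^\<infinity>(\<real> \<times> (0,\<infinity>)), extended by 0 to the plane. *)
definition test_function :: "(real \<times> real \<Rightarrow> real) \<Rightarrow> bool" where
  "test_function \<phi> \<longleftrightarrow>
     (\<forall>n. C_k n \<phi>) \<and> compact (tsupport \<phi>) \<and> tsupport \<phi> \<subseteq> UNIV \<times> {0<..}"

(* The entropy inequality
     \<partial>_t |u - k| + \<partial>_x (sgn (u - k) (f u - f k)) \<le> 0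
   in the sense of distributions; pairing with a nonnegative test function moves
   the derivatives onto it and reverses the sign. *)
definition entropy_inequality ::
    "(real \<Rightarrow> real) \<Rightarrow> (real \<Rightarrow> real \<Rightarrow> real) \<Rightarrow> real \<Rightarrow> bool" where
  "entropy_inequality f u k \<longleftrightarrow>
     (\<forall>\<phi>. test_function \<phi> \<and> (\<forall>z. 0 \<le> \<phi> z) \<longrightarrow>
        0 \<le> (LINT (x, t):(UNIV \<times> {0<..})|lebesgue.
               \<bar>u x t - k\<bar> * deriv (\<lambda>\<tau>. \<phi> (x, \<tau>)) t
               + sgn (u x t - k) * (f (u x t) - f k) * deriv (\<lambda>y. \<phi> (y, t)) x))"

definition entropy_solution ::
    "(real \<Rightarrow> real) \<Rightarrow> (real \<Rightarrow> real) \<Rightarrow> (real \<Rightarrow> real \<Rightarrow> real) \<Rightarrow> bool" where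
  "entropy_solution f u\<^sub>0 u \<longleftrightarrow>
     L_infty (lebesgue_on (UNIV \<times> {0..})) (\<lambda>(x, t). u x t) \<and>
     continuous_L1_loc u \<and>
     (AE x in lebesgue. u x 0 = u\<^sub>0 x) \<and>
     (\<forall>k. entropy_inequality f u k)"

end

theory Submission
  imports Defs "HOL-Real_Asymp.Real_Asymp"
begin

text \<open>
  Let \<open>C\<close> be the complement of the gaps \<open>(1 / ln (n + 3), 1 / ln (n + 2))\<close> and let \<open>a x\<close> be the signed
  distance of \<open>x\<close> to \<open>C\<close>. The function \<open>u x t = sgn (a x) (\<bar>a x\<bar> / (1 + t))\<^sup>s\<close> solves the equation with a
  stationary shock in the middle of each gap, and \<open>U x t = (1 + t) (\<bar>a x\<bar> / (1 + t))\<^sup>1\<^sup>+\<^sup>s / (1 + s)\<close>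
  is a potential: \<open>U\<^sub>x = u\<close> and \<open>U\<^sub>t = - f(u)\<close>. Since \<open>a\<close> is a difference of two bounded
  monotone functions, \<open>u\<close> has finite \<open>TV\<^sup>s\<close>; the gap lengths are summable, but none of their powers
  with exponent below 1 are, so \<open>TV\<close> is infinite for every exponent above \<open>s\<close>, at all times.

  An arbitrary entropy solution \<open>v\<close> with the same initial datum has a potential \<open>V\<close>. Young's inequality
  \<open>\<kappa> v - f v \<le> f\<^sup>* \<kappa>\<close> along straight lines gives \<open>V \<le> U\<close>. Conversely \<open>U\<close> is a supremum of functions
  \<open>M = k D - (1 + t) f k\<close> with \<open>D\<close> 1-Lipschitz. Where \<open>W = V - M\<close> is negative, the entropy
  \<open>E = max (\<bar>v\<bar> - k) 0\<close> tested with \<open>(min W 0)\<^sup>2\<close> yields \<open>E = 0\<close>, hence \<open>W\<^sub>t = f k - f v \<ge> 0\<close>, which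
  contradicts \<open>W \<ge> 0\<close> at time 0. So \<open>V = U\<close> and \<open>v = u\<close>.
\<close>

section \<open>Smooth bump functions\<close>

text \<open>The formula for \<open>u\<close> inverts the characteristic speed: f'(u) = sgn u |u|^p
  equals a x / (1 + t), so each half gap carries a piece of a rarefaction fan centred at time -1,
  and evenness of f makes the shock between the values c and -c stand still. The endpoints 1 / ln n
  give gaps of size about 1 / (n (ln n)^2), the borderline of summability. The claim concerns every
  entropy solution, so uniqueness for this datum has to be proved. An entropy solution is merely
  bounded and measurable, hence everything is first mollified. The upper bound is linear in v and f
  v and survives mollification exactly. The lower bound is not: it compares the products E f(v) and
  Q v, and a product of mollified functions is not a mollified product. The resulting defect is
  small only in the mean, which forces an integral estimate with a weight vanishing outside a
  backward cone. The entropies at k and -k are averaged because the tents inside M have slopes of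
  both signs, and evenness of f turns their mean into one entropy that vanishes for |v| \<le>
  k.\<close>

lemma C_k_const: "C_k n (\<lambda>z. c :: real)"
  by (induction n arbitrary: c) (auto simp: frechet_derivative_const)

lemma C_k_Suc_imp: "C_k (Suc n) g \<Longrightarrow> C_k n g"
proof (induction n arbitrary: g)
  case 0
  then show ?case
    by (auto intro!: differentiable_imp_continuous_on simp: differentiable_on_def differentiable_at_withinI)
next
  case (Suc n)
  then show ?case by (metis C_k.simps(2))
qed

lemma C_k_add:
  assumes "C_k n f" "C_k n g"
  shows "C_k n (\<lambda>z. f z + g z)"
  using assms
proof (induction n arbitrary: f g)
  case 0
  then show ?case by (auto intro: continuous_on_add)
next
  case (Suc n)
  have fd: "f differentiable (at z)" "g differentiable (at z)" for z using Suc.prems by auto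
  have "frechet_derivative (\<lambda>z. f z + g z) (at z) v
        = frechet_derivative f (at z) v + frechet_derivative g (at z) v" for z v
    by (rule fun_cong[OF frechet_derivative_at, symmetric, OF has_derivative_add[OF fd(1)[unfolded frechet_derivative_works] fd(2)[unfolded frechet_derivative_works]]])
  moreover have "(\<lambda>z. f z + g z) differentiable (at z)" for z
    using fd by (intro differentiable_add) auto
  ultimately show ?case using Suc by simp
qed

lemma C_k_mult:
  assumes "C_k n f" "C_k n g"
  shows "C_k n (\<lambda>z. f z * g z)"
  using assms
proof (induction n arbitrary: f g)
  case 0
  then show ?case by (auto intro: continuous_on_mult)
next
  case (Suc n)
  have fd: "f differentiable (at z)" "g differentiable (at z)" for z using Suc.prems by auto
  have "frechet_derivative (\<lambda>z. f z * g z) (at z) v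
        = f z * frechet_derivative g (at z) v + frechet_derivative f (at z) v * g z" for z v
    by (rule fun_cong[OF frechet_derivative_at, symmetric, OF has_derivative_mult[OF fd(1)[unfolded frechet_derivative_works] fd(2)[unfolded frechet_derivative_works]]])
  moreover have "(\<lambda>z. f z * g z) differentiable (at z)" for z
    using fd by (intro differentiable_mult) auto
  \<comment> \<open>The product rule keeps one factor undifferentiated, so both factors are also
    needed at the lower order.\<close>
  moreover have "C_k n f" "C_k n g" using Suc.prems C_k_Suc_imp by blast+
  ultimately show ?case using Suc by (auto intro!: C_k_add Suc.IH)
qed

text \<open>The powers of x in the denominator close the family under differentiation: each
  derivative is a linear combination of two later members. \<open>flat_exp 0\<close> is the usual
  smooth function that vanishes on the negative half-line.\<close>

definition flat_exp :: "nat \<Rightarrow> real \<Rightarrow> real" where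
  "flat_exp n x = (if 0 < x then exp (- 1 / x) / x ^ n else 0)"

lemma flat_exp_tendsto_0: "((\<lambda>x. exp (- 1 / x) / x ^ n) \<longlongrightarrow> 0) (at_right (0::real))"
proof -
  have "((\<lambda>x. x ^ n / exp x) \<longlongrightarrow> 0) (at_top :: real filter)"
    by (rule tendsto_power_div_exp_0)
  then have "((\<lambda>x. (inverse x) ^ n / exp (inverse x)) \<longlongrightarrow> 0) (at_right (0::real))"
    by (rule filterlim_compose[OF _ filterlim_inverse_at_top_right])
  then show ?thesis
    by (simp add: exp_minus divide_simps mult.commute)
qed

lemma flat_exp_has_derivative:
  "(flat_exp n has_real_derivative (- real n * flat_exp (n + 1) x + flat_exp (n + 2) x)) (at x)"
proof -
  consider "x > 0" | "x < 0" | "x = 0" by linarith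
  then show ?thesis
  proof cases
    case 1
    have "((\<lambda>x. exp (- 1 / x) / x ^ n) has_real_derivative
            (exp (- 1 / x) * (1 / x\<^sup>2) * x ^ n - exp (- 1 / x) * (real n * x ^ (n - 1))) / (x ^ n)\<^sup>2) (at x)"
      using 1 by (auto intro!: derivative_eq_intros simp: power2_eq_square divide_simps)
    moreover have "(exp (- 1 / x) * (1 / x\<^sup>2) * x ^ n - exp (- 1 / x) * (real n * x ^ (n - 1))) / (x ^ n)\<^sup>2
        = - real n * flat_exp (n + 1) x + flat_exp (n + 2) x"
      using 1 by (cases n) (auto simp: flat_exp_def field_simps power2_eq_square power_add)
    ultimately have "((\<lambda>x. exp (- 1 / x) / x ^ n) has_real_derivative
        (- real n * flat_exp (n + 1) x + flat_exp (n + 2) x)) (at x)" by simp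
    then show ?thesis
      by (rule has_field_derivative_transform_within_open[where S="{0<..}"]) (use 1 in \<open>auto simp: flat_exp_def\<close>)
  next
    case 2
    have "((\<lambda>x. 0) has_real_derivative 0) (at x)" by simp
    then have "(flat_exp n has_real_derivative 0) (at x)"
      by (rule has_field_derivative_transform_within_open[where S="{..<0}"]) (use 2 in \<open>auto simp: flat_exp_def\<close>)
    then show ?thesis using 2 by (simp add: flat_exp_def)
  next
    case 3
    \<comment> \<open>At the origin the claim is that the difference quotient tends to 0; from the
      right it is \<open>flat_exp (Suc n)\<close>.\<close>
    have "((\<lambda>h. flat_exp n h / h) \<longlongrightarrow> 0) (at 0)"
    proof (rule filterlim_split_at)
      show "((\<lambda>h. flat_exp n h / h) \<longlongrightarrow> 0) (at_left 0)"
        by (rule Lim_transform_eventually[OF tendsto_const])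
           (auto simp: eventually_at_left_field flat_exp_def intro!: exI[of _ "-1"])
      show "((\<lambda>h. flat_exp n h / h) \<longlongrightarrow> 0) (at_right 0)"
        by (rule Lim_transform_eventually[OF flat_exp_tendsto_0[of "Suc n"]])
           (auto simp: eventually_at_right_field flat_exp_def field_simps intro!: exI[of _ "1"])
    qed
    then show ?thesis using 3
      by (simp add: has_field_derivative_iff flat_exp_def)
  qed
qed

text \<open>The derivative \<open>l'\<close> is the same at every point, so \<open>l\<close> is
  affine and a directional derivative only multiplies by the constant \<open>l' v\<close>. The
  induction keeps \<open>m\<close> general because differentiation raises it.\<close>

lemma C_k_flat_exp:
  assumes "\<And>z. (l has_derivative l') (at z)"
  shows "C_k n (\<lambda>z. flat_exp m (l z))"
proof (induction n arbitrary: m)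
  case 0
  have "((\<lambda>z. flat_exp m (l z)) has_derivative (\<lambda>v. l' v * (- real m * flat_exp (m + 1) (l z) + flat_exp (m + 2) (l z)))) (at z)" for z
    by (rule has_derivative_compose[OF assms flat_exp_has_derivative[unfolded has_field_derivative_def], THEN has_derivative_eq_rhs])
       (auto simp: mult.commute)
  then show ?case by (metis C_k.simps(1) continuous_at_imp_continuous_on has_derivative_continuous)
next
  case (Suc n)
  have d: "((\<lambda>z. flat_exp m (l z)) has_derivative (\<lambda>v. l' v * (- real m * flat_exp (m + 1) (l z) + flat_exp (m + 2) (l z)))) (at z)" for z
    by (rule has_derivative_compose[OF assms flat_exp_has_derivative[unfolded has_field_derivative_def], THEN has_derivative_eq_rhs])
       (auto simp: mult.commute)
  have "frechet_derivative (\<lambda>z. flat_exp m (l z)) (at z) v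
     = l' v * (- real m * flat_exp (m + 1) (l z) + flat_exp (m + 2) (l z))" for z v
    by (intro fun_cong[OF frechet_derivative_at[OF d], symmetric])
  moreover have "C_k n (\<lambda>z. l' v * (- real m * flat_exp (m + 1) (l z) + flat_exp (m + 2) (l z)))" for v
    by (intro C_k_mult C_k_add C_k_const Suc.IH)
  moreover have "(\<lambda>z. flat_exp m (l z)) differentiable (at z)" for z
    using d differentiableI by blast
  ultimately show ?case by simp
qed

text \<open>The support lies in [e, 2 e], strictly to the right of 0. Translated in time by any
  \<tau> \<ge> 0 the product kernel stays inside t > 0, so it is an admissible test function even at
  \<tau> = 0; this gives control from the initial time onwards.\<close>

lemma exists_kernel:
  fixes e :: real
  assumes "e > 0"
  obtains j j1 :: "real \<Rightarrow> real" where
    "\<And>x. (j has_real_derivative j1 x) (at x)" "continuous_on UNIV j1" "\<And>x. 0 \<le> j x"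
    "\<And>x. x \<notin> {e..2 * e} \<Longrightarrow> j x = 0 \<and> j1 x = 0"
    "integral\<^sup>L lborel j = 1"
    "\<And>y \<tau>. 0 \<le> \<tau> \<Longrightarrow> test_function (\<lambda>(x, t). j (x - y) * j (t - \<tau>))"
proof -
  define b where "b x = flat_exp 0 (x - e) * flat_exp 0 (2 * e - x)" for x
  define b1 where "b1 x = flat_exp 2 (x - e) * flat_exp 0 (2 * e - x) - flat_exp 0 (x - e) * flat_exp 2 (2 * e - x)" for x
  have l1: "((\<lambda>x. flat_exp n (x - e)) has_real_derivative (- real n * flat_exp (n + 1) (x - e) + flat_exp (n + 2) (x - e))) (at x)" for n x
    by (rule DERIV_chain2[OF flat_exp_has_derivative, THEN DERIV_cong]) (auto intro!: derivative_eq_intros)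
  have l2: "((\<lambda>x. flat_exp n (2 * e - x)) has_real_derivative - (- real n * flat_exp (n + 1) (2 * e - x) + flat_exp (n + 2) (2 * e - x))) (at x)" for n x
    by (rule DERIV_chain2[OF flat_exp_has_derivative, THEN DERIV_cong]) (auto intro!: derivative_eq_intros)
  have db: "(b has_real_derivative b1 x) (at x)" for x
    unfolding b_def b1_def
    by (rule DERIV_mult[OF l1 l2, THEN DERIV_cong]) (simp add: numeral_2_eq_2)
  have fc: "continuous_on UNIV (flat_exp n)" for n
    by (rule DERIV_continuous_on[OF has_field_derivative_at_within[OF flat_exp_has_derivative]])
  have fc': "continuous_on UNIV (\<lambda>x. flat_exp n (g x))" if "continuous_on UNIV g" for n and g :: "real \<Rightarrow> real"
    using continuous_on_compose2[OF fc that] by simp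
  have cb1: "continuous_on UNIV b1"
    unfolding b1_def by (intro continuous_intros fc')
  have cb: "continuous_on UNIV b"
    unfolding b_def by (intro continuous_intros fc')
  have b0: "0 \<le> b x" for x by (auto simp: b_def flat_exp_def)
  have bz: "b x = 0 \<and> b1 x = 0" if "x \<notin> {e..2 * e}" for x
    using that by (auto simp: b_def b1_def flat_exp_def)
  define c where "c = integral\<^sup>L lborel b"
  have bint: "integrable lborel b"
  proof -
    have "set_integrable lborel {e..2 * e} b"
      by (intro borel_integrable_atLeastAtMost') (use cb continuous_on_subset in blast)
    moreover have "indicator {e..2 * e} x *\<^sub>R b x = b x" for x
      using bz[of x] by (auto simp: indicator_def)
    ultimately show ?thesis by (simp only: set_integrable_def)
  qed
  have "c > 0"
  proof -
    have "c \<noteq> 0"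
    proof
      assume "c = 0"
      then have "AE x in lborel. b x = 0"
        using integral_nonneg_eq_0_iff_AE[OF bint] b0 by (auto simp: c_def)
      then have "AE x \<in> {e<..<2*e} in lborel. False"
        by eventually_elim (auto simp: b_def flat_exp_def)
      then have "emeasure lborel {e<..<2*e} = 0"
        by (subst (asm) AE_iff_measurable[OF _ refl]) (auto simp: greaterThanLessThan_def greaterThan_def lessThan_def Int_def)
      then show False using assms by simp
    qed
    moreover have "c \<ge> 0" unfolding c_def by (intro Bochner_Integration.integral_nonneg) (auto simp: b0)
    ultimately show ?thesis by simp
  qed
  show ?thesis
  proof
    show "((\<lambda>x. b x / c) has_real_derivative b1 x / c) (at x)" for x by (intro DERIV_cdivide db)
    show "continuous_on UNIV (\<lambda>x. b1 x / c)" using \<open>c > 0\<close> by (intro continuous_intros cb1) auto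
    show "0 \<le> b x / c" for x using b0 \<open>c > 0\<close> by simp
    show "b x / c = 0 \<and> b1 x / c = 0" if "x \<notin> {e..2 * e}" for x using bz[OF that] by simp
    show "(LBINT x. b x / c) = 1" using \<open>c > 0\<close> by (simp add: c_def)
    show "test_function (\<lambda>(x, t). b (x - y) / c * (b (t - \<tau>) / c))" if "0 \<le> \<tau>" for y \<tau>
    proof -
      let ?\<phi> = "\<lambda>(x, t). b (x - y) / c * (b (t - \<tau>) / c)"
      \<comment> \<open>Written as a product of flat functions of affine maps, the kernel falls
        under \<open>C_k_mult\<close> and \<open>C_k_flat_exp\<close>.\<close>
      have eq: "?\<phi> = (\<lambda>z. (flat_exp 0 (fst z - y - e) * flat_exp 0 (2 * e - (fst z - y)) * (1 / c))
            * (flat_exp 0 (snd z - \<tau> - e) * flat_exp 0 (2 * e - (snd z - \<tau>)) * (1 / c)))"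
        by (auto simp: b_def)
      have "C_k n ?\<phi>" for n
        unfolding eq
        by (intro C_k_mult C_k_const;
            rule C_k_flat_exp[where l' = fst] C_k_flat_exp[where l' = snd]
              C_k_flat_exp[where l' = "\<lambda>v. - fst v"] C_k_flat_exp[where l' = "\<lambda>v. - snd v"];
            auto intro!: derivative_eq_intros)
      moreover have sub: "tsupport ?\<phi> \<subseteq> {y + e..y + 2 * e} \<times> {\<tau> + e..\<tau> + 2 * e}"
        unfolding tsupport_def
      proof (rule closure_minimal)
        show "closed ({y + e..y + 2 * e} \<times> {\<tau> + e..\<tau> + 2 * e})"
          by (intro closed_Times) auto
        show "{z. ?\<phi> z \<noteq> 0} \<subseteq> {y + e..y + 2 * e} \<times> {\<tau> + e..\<tau> + 2 * e}"
        proof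
          fix z assume z: "z \<in> {z. ?\<phi> z \<noteq> 0}"
          obtain x t where xt: "z = (x, t)" by (cases z)
          from z have "b (x - y) \<noteq> 0" "b (t - \<tau>) \<noteq> 0" by (auto simp: xt)
          then have "x - y \<in> {e..2*e}" "t - \<tau> \<in> {e..2*e}" using bz by blast+
          then show "z \<in> {y + e..y + 2 * e} \<times> {\<tau> + e..\<tau> + 2 * e}" by (auto simp: xt)
        qed
      qed
      moreover have "compact (tsupport ?\<phi>)"
      proof -
        have "compact ({y + e..y + 2 * e} \<times> {\<tau> + e..\<tau> + 2 * e})" by (intro compact_Times) auto
        then show ?thesis using sub
          by (metis closed_closure compact_Int_closed inf.absorb_iff2 tsupport_def)
      qed
      ultimately show ?thesis using that assms by (force simp: test_function_def)
    qed
  qed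
qed

section \<open>Mollification of bounded Borel functions\<close>

text \<open>Reduces to sequences, which suffices at a first countable point. The bound is assumed
  only near \<open>p0\<close>, so the sequence is started at the index \<open>N\<close> from which
  it holds.\<close>

lemma tendsto_integral_dominated:
  fixes s :: "'p::first_countable_topology \<Rightarrow> 'a \<Rightarrow> real"
  assumes "\<And>p. s p \<in> borel_measurable M" "f \<in> borel_measurable M" "integrable M w"
    and "eventually (\<lambda>p. \<forall>z. \<bar>s p z\<bar> \<le> w z) (at p0 within S)"
    and "\<And>z. ((\<lambda>p. s p z) \<longlongrightarrow> f z) (at p0 within S)"
  shows "((\<lambda>p. integral\<^sup>L M (s p)) \<longlongrightarrow> integral\<^sup>L M f) (at p0 within S)"
  unfolding tendsto_at_iff_sequentially comp_def
proof (intro allI impI)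
  fix X assume X: "\<forall>i. X i \<in> S - {p0}" "X \<longlonglongrightarrow> p0"
  then have lim: "filterlim X (at p0 within S) sequentially"
    by (auto simp: filterlim_at)
  from eventually_compose_filterlim[OF assms(4) lim]
  obtain N where N: "\<And>n z. n \<ge> N \<Longrightarrow> \<bar>s (X n) z\<bar> \<le> w z" by (auto simp: eventually_sequentially)
  have "(\<lambda>n. integral\<^sup>L M (s (X (n + N)))) \<longlonglongrightarrow> integral\<^sup>L M f"
  proof (rule integral_dominated_convergence[where w = w])
    show "AE z in M. (\<lambda>n. s (X (n + N)) z) \<longlonglongrightarrow> f z"
      using filterlim_compose[OF assms(5) lim] LIMSEQ_ignore_initial_segment by blast
  qed (use assms N in auto)
  then show "(\<lambda>n. integral\<^sup>L M (s (X n))) \<longlonglongrightarrow> integral\<^sup>L M f"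
    by (rule LIMSEQ_offset)
qed

text \<open>One predicate for a kernel and for its derivative, so that facts about
  \<open>conv\<close> cover both; smoothness is asked for separately where it is used.\<close>

definition bump_on :: "real \<Rightarrow> (real \<Rightarrow> real) \<Rightarrow> bool" where
  "bump_on e a \<longleftrightarrow> continuous_on UNIV a \<and> (\<forall>x. x \<notin> {e..2 * e} \<longrightarrow> a x = 0)"

text \<open>The kernel is evaluated at x - y rather than y - x: \<open>conv\<close> pairs
  \<open>g\<close> with a translated test function, and the average looks to the right and forward
  in time. Derivatives in y and \<tau> therefore fall on the kernel with a minus sign.\<close>

definition conv :: "(real \<Rightarrow> real) \<Rightarrow> (real \<Rightarrow> real) \<Rightarrow> (real \<times> real \<Rightarrow> real) \<Rightarrow> real \<Rightarrow> real \<Rightarrow> real" where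
  "conv a b g y \<tau> = (LBINT z. g z * (a (fst z - y) * b (snd z - \<tau>)))"

section \<open>Regularity of convolutions with compactly supported kernels\<close>

lemma bump_on_bounded:
  assumes "bump_on e a"
  obtains C where "0 \<le> C" "\<And>x. \<bar>a x\<bar> \<le> C"
proof -
  have "compact (a ` {e..2 * e})"
    using assms by (intro compact_continuous_image) (auto simp: bump_on_def intro: continuous_on_subset)
  then obtain C where C: "\<And>x. x \<in> {e..2 * e} \<Longrightarrow> \<bar>a x\<bar> \<le> C"
    using compact_imp_bounded[THEN bounded_iff[THEN iffD1]] by (metis image_eqI real_norm_def)
  have "\<bar>a x\<bar> \<le> max C 0" for x
    using C[of x] assms by (cases "x \<in> {e..2 * e}") (auto simp: bump_on_def)
  then show ?thesis using that[of "max C 0"] by simp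
qed

lemma kernel_measurable:
  assumes "bump_on e a" "bump_on e b"
  shows "(\<lambda>z::real\<times>real. a (fst z - y) * b (snd z - \<tau>)) \<in> borel_measurable borel"
proof -
  have "continuous_on UNIV a" "continuous_on UNIV b" using assms by (auto simp: bump_on_def)
  then have "continuous_on UNIV (\<lambda>z::real\<times>real. a (fst z - y))"
    "continuous_on UNIV (\<lambda>z::real\<times>real. b (snd z - \<tau>))"
    by (auto elim!: continuous_on_compose2 intro!: continuous_intros)
  then have "continuous_on UNIV (\<lambda>z::real\<times>real. a (fst z - y) * b (snd z - \<tau>))"
    by (rule continuous_on_mult)
  then show ?thesis by (rule borel_measurable_continuous_onI)
qed

lemma kernel_zero:
  assumes "bump_on e a" "bump_on e b" "z \<notin> {y + e..y + 2 * e} \<times> {\<tau> + e..\<tau> + 2 * e}"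
  shows "a (fst z - y) * b (snd z - \<tau>) = 0"
proof (cases z)
  case (Pair x t)
  then have "x - y \<notin> {e..2*e} \<or> t - \<tau> \<notin> {e..2*e}" using assms by auto
  then show ?thesis using assms Pair by (auto simp: bump_on_def)
qed

lemma integrable_indicator_box:
  "integrable lborel (\<lambda>z::real\<times>real. c * indicator ({a..b} \<times> {c'..d}) z :: real)"
proof -
  have "({a..b} \<times> {c'..d}) = cbox (a, c') (b, d)" by auto
  then show ?thesis by (auto intro!: integrable_mult_right integrable_real_indicator simp: emeasure_lborel_cbox_eq)
qed

lemma conv_integrable:
  fixes g :: "real \<times> real \<Rightarrow> real"
  assumes a: "bump_on e a" "bump_on e b" and g: "g \<in> borel_measurable borel" "\<And>z. \<bar>g z\<bar> \<le> M"
  shows "integrable lborel (\<lambda>z. g z * (a (fst z - y) * b (snd z - \<tau>)))"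
proof -
  obtain A where A: "0 \<le> A" "\<And>x. \<bar>a x\<bar> \<le> A" using bump_on_bounded[OF a(1)] by blast
  obtain B where B: "0 \<le> B" "\<And>x. \<bar>b x\<bar> \<le> B" using bump_on_bounded[OF a(2)] by blast
  have M: "0 \<le> M" using g(2)[of undefined] by simp
  show ?thesis
  proof (rule Bochner_Integration.integrable_bound[OF integrable_indicator_box[of "M * (A * B)" "y+e" "y+2*e" "\<tau>+e" "\<tau>+2*e"]])
    show "AE z in lborel. norm (g z * (a (fst z - y) * b (snd z - \<tau>)))
        \<le> norm (M * (A * B) * indicator ({y + e..y + 2 * e} \<times> {\<tau> + e..\<tau> + 2 * e}) z)"
    proof (rule AE_I2)
      fix z
      show "norm (g z * (a (fst z - y) * b (snd z - \<tau>)))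
        \<le> norm (M * (A * B) * indicator ({y + e..y + 2 * e} \<times> {\<tau> + e..\<tau> + 2 * e}) z)"
        using kernel_zero[OF a, of z y \<tau>] A B g M
        by (cases "z \<in> {y + e..y + 2 * e} \<times> {\<tau> + e..\<tau> + 2 * e}")
           (auto simp: abs_mult intro!: mult_mono)
    qed
  qed (use g kernel_measurable[OF a] in measurable)
qed

text \<open>Common form of two kinds of limit: \<open>\<kappa>\<close> is either a moving kernel,
  which gives continuity, or a difference quotient of the kernel, which gives the
  derivative.\<close>

lemma conv_tendsto:
  fixes g :: "real \<times> real \<Rightarrow> real" and p0 :: "'p::first_countable_topology"
  assumes g: "g \<in> borel_measurable borel" "\<And>z. \<bar>g z\<bar> \<le> M"
    and m: "\<And>p. \<kappa> p \<in> borel_measurable borel" "\<kappa>0 \<in> borel_measurable borel"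
    and bd: "eventually (\<lambda>p. \<forall>z. \<bar>\<kappa> p z\<bar> \<le> C * indicator ({a..b} \<times> {c..d}) z) (at p0 within S)"
    and lim: "\<And>z. ((\<lambda>p. \<kappa> p z) \<longlongrightarrow> \<kappa>0 z) (at p0 within S)"
  shows "((\<lambda>p. LBINT z. g z * \<kappa> p z) \<longlongrightarrow> (LBINT z. g z * \<kappa>0 z)) (at p0 within S)"
proof (rule tendsto_integral_dominated[OF _ _ integrable_indicator_box[of "M * C" a b c d]])
  show "eventually (\<lambda>p. \<forall>z. \<bar>g z * \<kappa> p z\<bar> \<le> M * C * indicator ({a..b} \<times> {c..d}) z) (at p0 within S)"
    using bd
  proof eventually_elim
    case (elim p)
    show ?case
    proof
      fix z
      have "\<bar>g z * \<kappa> p z\<bar> \<le> M * (C * indicator ({a..b} \<times> {c..d}) z)"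
        unfolding abs_mult
        using elim[rule_format, of z] g(2)[of z] by (intro mult_mono) (auto simp del: split_paired_All)
      then show "\<bar>g z * \<kappa> p z\<bar> \<le> M * C * indicator ({a..b} \<times> {c..d}) z" by (simp add: mult.assoc)
    qed
  qed
qed (use g m lim in \<open>auto intro!: tendsto_mult_left borel_measurable_times\<close>)

lemma conv_continuous:
  fixes g :: "real \<times> real \<Rightarrow> real"
  assumes a: "bump_on e a" "bump_on e b" and g: "g \<in> borel_measurable borel" "\<And>z. \<bar>g z\<bar> \<le> M"
  shows "continuous_on UNIV (\<lambda>(y, \<tau>). conv a b g y \<tau>)"
  unfolding continuous_on_def
proof
  fix p0 :: "real \<times> real"
  obtain A where A: "0 \<le> A" "\<And>x. \<bar>a x\<bar> \<le> A" using bump_on_bounded[OF a(1)] by blast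
  obtain B where B: "0 \<le> B" "\<And>x. \<bar>b x\<bar> \<le> B" using bump_on_bounded[OF a(2)] by blast
  obtain y0 t0 where p0: "p0 = (y0, t0)" by (cases p0)
  have ca: "isCont a x" "isCont b x" for x
    using a by (auto simp: bump_on_def continuous_on_eq_continuous_at)
  have "((\<lambda>p. LBINT z. g z * (a (fst z - fst p) * b (snd z - snd p)))
      \<longlongrightarrow> (LBINT z. g z * (a (fst z - fst p0) * b (snd z - snd p0)))) (at p0 within UNIV)"
  proof (rule conv_tendsto[OF g kernel_measurable[OF a] kernel_measurable[OF a]])
    have "eventually (\<lambda>p. dist p p0 < 1) (at p0 within UNIV)"
      by (auto simp: eventually_at intro: exI[of _ 1])
    then show "eventually (\<lambda>p. \<forall>z. \<bar>a (fst z - fst p) * b (snd z - snd p)\<bar> \<le> (A * B) *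
        indicator ({y0 + e - 1..y0 + 2 * e + 1} \<times> {t0 + e - 1..t0 + 2 * e + 1}) z) (at p0 within UNIV)"
    proof eventually_elim
      case (elim p)
      have "\<bar>fst p - y0\<bar> < 1" "\<bar>snd p - t0\<bar> < 1"
        using elim dist_fst_le[of p p0] dist_snd_le[of p p0] by (auto simp: p0 dist_real_def)
      then have sub: "{fst p + e..fst p + 2 * e} \<times> {snd p + e..snd p + 2 * e} \<subseteq>
          {y0 + e - 1..y0 + 2 * e + 1} \<times> {t0 + e - 1..t0 + 2 * e + 1}" by auto
      show ?case
      proof
        fix z
        show "\<bar>a (fst z - fst p) * b (snd z - snd p)\<bar> \<le> (A * B) *
            indicator ({y0 + e - 1..y0 + 2 * e + 1} \<times> {t0 + e - 1..t0 + 2 * e + 1}) z"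
        proof (cases "z \<in> {y0 + e - 1..y0 + 2 * e + 1} \<times> {t0 + e - 1..t0 + 2 * e + 1}")
          case True
          then show ?thesis using A B by (auto simp: abs_mult intro!: mult_mono)
        next
          case False
          then have "z \<notin> {fst p + e..fst p + 2 * e} \<times> {snd p + e..snd p + 2 * e}" using sub by blast
          from kernel_zero[OF a this] show ?thesis using A B by (simp only: abs_zero) simp
        qed
      qed
    qed
    show "((\<lambda>p. a (fst z - fst p) * b (snd z - snd p)) \<longlongrightarrow> a (fst z - fst p0) * b (snd z - snd p0)) (at p0 within UNIV)" for z
      by (intro tendsto_intros isCont_tendsto_compose[OF ca(1)] isCont_tendsto_compose[OF ca(2)])
  qed
  then show "((\<lambda>(y, \<tau>). conv a b g y \<tau>) \<longlongrightarrow> (case p0 of (y, \<tau>) \<Rightarrow> conv a b g y \<tau>)) (at p0 within UNIV)"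
    by (simp add: conv_def case_prod_beta')
qed

text \<open>Inside the enlarged interval the mean value bound applies; outside it |h| < 1 keeps both
  s and s - h off the support. The resulting dominating function does not depend on h.\<close>

lemma quotient_bound:
  fixes a a1 :: "real \<Rightarrow> real"
  assumes d: "\<And>x. (a has_real_derivative a1 x) (at x)" and C: "\<And>x. \<bar>a1 x\<bar> \<le> C"
    and supp: "\<And>x. x \<notin> {e..2 * e} \<Longrightarrow> a x = 0" and h: "h \<noteq> 0" "\<bar>h\<bar> < 1"
  shows "\<bar>(a (s - h) - a s) / h\<bar> \<le> C * indicator {e - 1..2 * e + 1} s"
proof (cases "s \<in> {e - 1..2 * e + 1}")
  case True
  have "\<bar>a (s - h) - a s\<bar> \<le> C * \<bar>(s - h) - s\<bar>"
    using field_differentiable_bound[of UNIV a a1 C "s - h" s] d C by (auto simp: has_field_derivative_at_within)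
  then show ?thesis using True h by (simp add: divide_simps)
next
  case False
  then have "s \<notin> {e..2*e}" "s - h \<notin> {e..2*e}" using h by (auto simp: abs_less_iff)
  then show ?thesis using False by (simp add: supp)
qed

lemma quotient_lim:
  fixes a a1 :: "real \<Rightarrow> real"
  assumes d: "\<And>x. (a has_real_derivative a1 x) (at x)"
  shows "((\<lambda>h. (a (s - h) - a s) / h) \<longlongrightarrow> - a1 s) (at 0)"
proof -
  have "((\<lambda>h. a (s - h)) has_real_derivative - a1 s) (at 0)"
    by (rule DERIV_chain2[of a "a1 s", THEN DERIV_cong]) (auto intro!: derivative_eq_intros simp: d)
  then show ?thesis by (simp add: has_field_derivative_iff)
qed

text \<open>All smoothness comes from the kernel; \<open>g\<close> is only bounded and measurable.
  The difference quotient is moved onto the kernel and dominated convergence finishes.\<close>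

lemma conv_has_derivative_fst:
  fixes g :: "real \<times> real \<Rightarrow> real"
  assumes a: "bump_on e a" "bump_on e a1" "bump_on e b" and g: "g \<in> borel_measurable borel" "\<And>z. \<bar>g z\<bar> \<le> M"
    and d: "\<And>x. (a has_real_derivative a1 x) (at x)"
  shows "((\<lambda>y. conv a b g y \<tau>) has_real_derivative - conv a1 b g y \<tau>) (at y)"
proof -
  obtain A where A: "0 \<le> A" "\<And>x. \<bar>a1 x\<bar> \<le> A" using bump_on_bounded[OF a(2)] by blast
  obtain B where B: "0 \<le> B" "\<And>x. \<bar>b x\<bar> \<le> B" using bump_on_bounded[OF a(3)] by blast
  have supp: "\<And>x. x \<notin> {e..2 * e} \<Longrightarrow> a x = 0" "\<And>x. x \<notin> {e..2 * e} \<Longrightarrow> b x = 0"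
    using a by (auto simp: bump_on_def)
  have "((\<lambda>h. LBINT z. g z * ((a (fst z - y - h) - a (fst z - y)) / h * b (snd z - \<tau>)))
      \<longlongrightarrow> (LBINT z. g z * (- a1 (fst z - y) * b (snd z - \<tau>)))) (at 0 within UNIV)"
  proof (rule conv_tendsto[OF g])
    have "(\<lambda>z::real\<times>real. (a (fst z - y - h) - a (fst z - y)) / h * b (snd z - \<tau>)) =
        (\<lambda>z::real\<times>real. (a (fst z - (y + h)) * b (snd z - \<tau>) - a (fst z - y) * b (snd z - \<tau>)) / h)" for h
      by (auto simp: field_simps)
    then show "(\<lambda>z::real\<times>real. (a (fst z - y - h) - a (fst z - y)) / h * b (snd z - \<tau>)) \<in> borel_measurable borel" for h
      using kernel_measurable[OF a(1,3)] by simp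
    show "(\<lambda>z::real\<times>real. - a1 (fst z - y) * b (snd z - \<tau>)) \<in> borel_measurable borel"
      using kernel_measurable[OF a(2,3)] by simp
    have "eventually (\<lambda>h::real. h \<noteq> 0 \<and> \<bar>h\<bar> < 1) (at 0 within UNIV)"
      by (auto simp: eventually_at intro: exI[of _ 1])
    then show "eventually (\<lambda>h. \<forall>z. \<bar>(a (fst z - y - h) - a (fst z - y)) / h * b (snd z - \<tau>)\<bar> \<le> (A * B) *
        indicator ({y + e - 1..y + 2 * e + 1} \<times> {\<tau> + e..\<tau> + 2 * e}) z) (at 0 within UNIV)"
    proof eventually_elim
      case (elim h)
      show ?case
      proof
        fix z :: "real \<times> real"
        have "\<bar>(a (fst z - y - h) - a (fst z - y)) / h\<bar> \<le> A * indicator {e - 1..2 * e + 1} (fst z - y)"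
          using quotient_bound[OF d A(2) supp(1)] elim by blast
        moreover have "\<bar>b (snd z - \<tau>)\<bar> \<le> B * indicator {e..2 * e} (snd z - \<tau>)"
          using B supp(2)[of "snd z - \<tau>"] by (cases "snd z - \<tau> \<in> {e..2 * e}") auto
        ultimately have "\<bar>(a (fst z - y - h) - a (fst z - y)) / h * b (snd z - \<tau>)\<bar>
            \<le> (A * indicator {e - 1..2 * e + 1} (fst z - y)) * (B * indicator {e..2 * e} (snd z - \<tau>))"
          unfolding abs_mult using A by (intro mult_mono) auto
        also have "\<dots> = (A * B) * indicator ({y + e - 1..y + 2 * e + 1} \<times> {\<tau> + e..\<tau> + 2 * e}) z"
          by (cases z) (auto simp: indicator_def)
        finally show "\<bar>(a (fst z - y - h) - a (fst z - y)) / h * b (snd z - \<tau>)\<bar> \<le> (A * B) *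
            indicator ({y + e - 1..y + 2 * e + 1} \<times> {\<tau> + e..\<tau> + 2 * e}) z" .
      qed
    qed
    show "((\<lambda>h. (a (fst z - y - h) - a (fst z - y)) / h * b (snd z - \<tau>)) \<longlongrightarrow> - a1 (fst z - y) * b (snd z - \<tau>)) (at 0 within UNIV)" for z
      by (intro tendsto_mult quotient_lim[OF d] tendsto_const)
  qed
  moreover have "(LBINT z. g z * ((a (fst z - y - h) - a (fst z - y)) / h * b (snd z - \<tau>)))
      = (conv a b g (y + h) \<tau> - conv a b g y \<tau>) / h" for h
  proof -
    have "(conv a b g (y + h) \<tau> - conv a b g y \<tau>) / h =
       (LBINT z. (g z * (a (fst z - (y + h)) * b (snd z - \<tau>)) - g z * (a (fst z - y) * b (snd z - \<tau>))) / h)"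
      unfolding conv_def using conv_integrable[OF a(1,3) g] by simp
    also have "\<dots> = (LBINT z. g z * ((a (fst z - y - h) - a (fst z - y)) / h * b (snd z - \<tau>)))"
      by (rule Bochner_Integration.integral_cong) (auto simp: field_simps)
    finally show ?thesis ..
  qed
  moreover have "(LBINT z. g z * (- a1 (fst z - y) * b (snd z - \<tau>))) = - conv a1 b g y \<tau>"
    by (simp add: conv_def)
  ultimately show ?thesis by (simp only: DERIV_def)
qed

lemma conv_has_derivative_snd:
  fixes g :: "real \<times> real \<Rightarrow> real"
  assumes a: "bump_on e a" "bump_on e a1" "bump_on e b" and g: "g \<in> borel_measurable borel" "\<And>z. \<bar>g z\<bar> \<le> M"
    and d: "\<And>x. (a has_real_derivative a1 x) (at x)"
  shows "((\<lambda>\<tau>. conv b a g y \<tau>) has_real_derivative - conv b a1 g y \<tau>) (at \<tau>)"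
proof -
  obtain A where A: "0 \<le> A" "\<And>x. \<bar>a1 x\<bar> \<le> A" using bump_on_bounded[OF a(2)] by blast
  obtain B where B: "0 \<le> B" "\<And>x. \<bar>b x\<bar> \<le> B" using bump_on_bounded[OF a(3)] by blast
  have supp: "\<And>x. x \<notin> {e..2 * e} \<Longrightarrow> a x = 0" "\<And>x. x \<notin> {e..2 * e} \<Longrightarrow> b x = 0"
    using a by (auto simp: bump_on_def)
  have "((\<lambda>h. LBINT z. g z * (b (fst z - y) * ((a (snd z - \<tau> - h) - a (snd z - \<tau>)) / h)))
      \<longlongrightarrow> (LBINT z. g z * (b (fst z - y) * - a1 (snd z - \<tau>)))) (at 0 within UNIV)"
  proof (rule conv_tendsto[OF g])
    have "(\<lambda>z::real\<times>real. b (fst z - y) * ((a (snd z - \<tau> - h) - a (snd z - \<tau>)) / h)) =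
        (\<lambda>z::real\<times>real. (b (fst z - y) * a (snd z - (\<tau> + h)) - b (fst z - y) * a (snd z - \<tau>)) / h)" for h
      by (auto simp: field_simps)
    then show "(\<lambda>z::real\<times>real. b (fst z - y) * ((a (snd z - \<tau> - h) - a (snd z - \<tau>)) / h)) \<in> borel_measurable borel" for h
      using kernel_measurable[OF a(3,1)] by simp
    show "(\<lambda>z::real\<times>real. b (fst z - y) * - a1 (snd z - \<tau>)) \<in> borel_measurable borel"
      using kernel_measurable[OF a(3,2)] by simp
    have "eventually (\<lambda>h::real. h \<noteq> 0 \<and> \<bar>h\<bar> < 1) (at 0 within UNIV)"
      by (auto simp: eventually_at intro: exI[of _ 1])
    then show "eventually (\<lambda>h. \<forall>z. \<bar>b (fst z - y) * ((a (snd z - \<tau> - h) - a (snd z - \<tau>)) / h)\<bar> \<le> (B * A) *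
        indicator ({y + e..y + 2 * e} \<times> {\<tau> + e - 1..\<tau> + 2 * e + 1}) z) (at 0 within UNIV)"
    proof eventually_elim
      case (elim h)
      show ?case
      proof
        fix z :: "real \<times> real"
        have "\<bar>(a (snd z - \<tau> - h) - a (snd z - \<tau>)) / h\<bar> \<le> A * indicator {e - 1..2 * e + 1} (snd z - \<tau>)"
          using quotient_bound[OF d A(2) supp(1)] elim by blast
        moreover have "\<bar>b (fst z - y)\<bar> \<le> B * indicator {e..2 * e} (fst z - y)"
          using B supp(2)[of "fst z - y"] by (cases "fst z - y \<in> {e..2 * e}") auto
        ultimately have "\<bar>b (fst z - y) * ((a (snd z - \<tau> - h) - a (snd z - \<tau>)) / h)\<bar>
            \<le> (B * indicator {e..2 * e} (fst z - y)) * (A * indicator {e - 1..2 * e + 1} (snd z - \<tau>))"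
          unfolding abs_mult using B by (intro mult_mono) auto
        also have "\<dots> = (B * A) * indicator ({y + e..y + 2 * e} \<times> {\<tau> + e - 1..\<tau> + 2 * e + 1}) z"
          by (cases z) (auto simp: indicator_def)
        finally show "\<bar>b (fst z - y) * ((a (snd z - \<tau> - h) - a (snd z - \<tau>)) / h)\<bar> \<le> (B * A) *
            indicator ({y + e..y + 2 * e} \<times> {\<tau> + e - 1..\<tau> + 2 * e + 1}) z" .
      qed
    qed
    show "((\<lambda>h. b (fst z - y) * ((a (snd z - \<tau> - h) - a (snd z - \<tau>)) / h)) \<longlongrightarrow> b (fst z - y) * - a1 (snd z - \<tau>)) (at 0 within UNIV)" for z
      by (intro tendsto_mult quotient_lim[OF d] tendsto_const)
  qed
  moreover have "(LBINT z. g z * (b (fst z - y) * ((a (snd z - \<tau> - h) - a (snd z - \<tau>)) / h)))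
      = (conv b a g y (\<tau> + h) - conv b a g y \<tau>) / h" for h
  proof -
    have "(conv b a g y (\<tau> + h) - conv b a g y \<tau>) / h =
       (LBINT z. (g z * (b (fst z - y) * a (snd z - (\<tau> + h))) - g z * (b (fst z - y) * a (snd z - \<tau>))) / h)"
      unfolding conv_def using conv_integrable[OF a(3,1) g] by simp
    also have "\<dots> = (LBINT z. g z * (b (fst z - y) * ((a (snd z - \<tau> - h) - a (snd z - \<tau>)) / h)))"
      by (rule Bochner_Integration.integral_cong) (auto simp: field_simps)
    finally show ?thesis ..
  qed
  moreover have "(LBINT z. g z * (b (fst z - y) * - a1 (snd z - \<tau>))) = - conv b a1 g y \<tau>"
    by (simp add: conv_def)
  ultimately show ?thesis by (simp only: DERIV_def)
qed

lemma conv_translate: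
  fixes g :: "real \<times> real \<Rightarrow> real"
  assumes a: "bump_on e a" "bump_on e b" and g: "g \<in> borel_measurable borel"
  shows "conv a b g y \<tau> = (LBINT z. g ((y, \<tau>) + z) * (a (fst z) * b (snd z)))"
proof -
  have "conv a b g y \<tau> = (\<integral>z. g z * (a (fst z - y) * b (snd z - \<tau>)) \<partial>distr lborel borel ((+) (y, \<tau>)))"
    by (simp add: conv_def lborel_distr_plus)
  also have "\<dots> = (LBINT z. g ((y, \<tau>) + z) * (a (fst z) * b (snd z)))"
    by (subst integral_distr) (use g kernel_measurable[OF a] in auto)
  finally show ?thesis .
qed

text \<open>Explicit coefficients let one rule serve for sums, differences and multiples; later uses
  supply factors 1 and -1 to match this shape.\<close>

lemma conv_affine:
  fixes g h :: "real \<times> real \<Rightarrow> real"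
  assumes a: "bump_on e a" "bump_on e b"
    and g: "g \<in> borel_measurable borel" "\<And>z. \<bar>g z\<bar> \<le> M"
    and h: "h \<in> borel_measurable borel" "\<And>z. \<bar>h z\<bar> \<le> M'"
  shows "conv a b (\<lambda>z. \<alpha> * g z + \<beta> * h z) y \<tau> = \<alpha> * conv a b g y \<tau> + \<beta> * conv a b h y \<tau>"
proof -
  have "conv a b (\<lambda>z. \<alpha> * g z + \<beta> * h z) y \<tau> =
     (LBINT z. \<alpha> * (g z * (a (fst z - y) * b (snd z - \<tau>))) + \<beta> * (h z * (a (fst z - y) * b (snd z - \<tau>))))"
    unfolding conv_def by (rule Bochner_Integration.integral_cong) (auto simp: algebra_simps)
  also have "\<dots> = \<alpha> * conv a b g y \<tau> + \<beta> * conv a b h y \<tau>"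
    unfolding conv_def
    by (subst Bochner_Integration.integral_add)
       (use conv_integrable[OF a g] conv_integrable[OF a h] in auto)
  finally show ?thesis .
qed

text \<open>The two integrals differ only on the symmetric difference of [a, b] and its translate,
  which is contained in two intervals of length \<xi>.\<close>

lemma set_integral_shift_le:
  fixes h :: "real \<Rightarrow> real"
  assumes h[measurable]: "h \<in> borel_measurable borel" and bd: "\<And>x. \<bar>h x\<bar> \<le> K" and "a \<le> b" "0 \<le> \<xi>"
  shows "\<bar>(LBINT y:{a..b}. h (y + \<xi>)) - (LBINT y:{a..b}. h y)\<bar> \<le> 2 * K * \<xi>"
proof -
  have K: "0 \<le> K" using bd[of 0] by simp
  have int: "integrable lborel (\<lambda>y. indicator {u..v} y *\<^sub>R h y)" for u v
  proof (rule Bochner_Integration.integrable_bound)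
    show "integrable lborel (\<lambda>y. K * indicat_real {u..v} y)"
      by (intro integrable_mult_right integrable_real_indicator) (auto simp: emeasure_lborel_Icc_eq)
    show "AE y in lborel. norm (indicat_real {u..v} y *\<^sub>R h y) \<le> norm (K * indicat_real {u..v} y)"
      by (intro AE_I2) (simp add: indicator_def order_trans[OF bd abs_ge_self])
  qed simp
  have "(LBINT y:{a..b}. h (y + \<xi>)) = (LBINT y. indicator {a + \<xi>..b + \<xi>} (\<xi> + y) *\<^sub>R h (\<xi> + y))"
    unfolding set_lebesgue_integral_def
    by (rule Bochner_Integration.integral_cong) (auto simp: indicator_def add.commute)
  also have "\<dots> = (\<integral>y. indicator {a + \<xi>..b + \<xi>} y *\<^sub>R h y \<partial>distr lborel borel ((+) \<xi>))"
    by (subst integral_distr) auto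
  also have "\<dots> = (LBINT y. indicator {a + \<xi>..b + \<xi>} y *\<^sub>R h y)" by (simp add: lborel_distr_plus)
  finally have eq: "(LBINT y:{a..b}. h (y + \<xi>)) - (LBINT y:{a..b}. h y)
     = (LBINT y. indicator {a + \<xi>..b + \<xi>} y *\<^sub>R h y - indicator {a..b} y *\<^sub>R h y)"
    unfolding set_lebesgue_integral_def using int by simp
  have "\<bar>(LBINT y:{a..b}. h (y + \<xi>)) - (LBINT y:{a..b}. h y)\<bar>
      \<le> (LBINT y. K * indicator {a..a + \<xi>} y + K * indicator {b..b + \<xi>} y)"
  proof -
    have diff_le: "norm (indicat_real {a + \<xi>..b + \<xi>} y *\<^sub>R h y - indicat_real {a..b} y *\<^sub>R h y) \<le> K" for y
      using bd[of y] K by (cases "y \<in> {a..b}"; cases "y \<in> {a + \<xi>..b + \<xi>}") (simp_all del: atLeastAtMost_iff)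
    have i1: "integrable lborel (\<lambda>y. indicat_real {a + \<xi>..b + \<xi>} y *\<^sub>R h y - indicat_real {a..b} y *\<^sub>R h y)"
      by (rule Bochner_Integration.integrable_diff[OF int int])
    have i: "integrable lborel (\<lambda>y. K * indicat_real {u..v} y)" for u v :: real
      by (intro integrable_mult_right integrable_real_indicator) (auto simp: emeasure_lborel_Icc_eq)
    have i2: "integrable lborel (\<lambda>y. K * indicat_real {a..a + \<xi>} y + K * indicat_real {b..b + \<xi>} y)"
      by (rule Bochner_Integration.integrable_add[OF i i])
    have bound: "norm (indicat_real {a + \<xi>..b + \<xi>} y *\<^sub>R h y - indicat_real {a..b} y *\<^sub>R h y)
         \<le> K * indicat_real {a..a + \<xi>} y + K * indicat_real {b..b + \<xi>} y" for y
      proof -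
        consider "y \<in> {a..b} \<longleftrightarrow> y \<in> {a + \<xi>..b + \<xi>}" | "y \<in> {a..a + \<xi>}" | "y \<in> {b..b + \<xi>}"
          using assms(3,4) by force
        then show ?thesis
        proof cases
          case 1
          then have "indicat_real {a + \<xi>..b + \<xi>} y = indicat_real {a..b} y" by (simp add: indicator_def)
          then show ?thesis using K by simp
        next
          case 2
          then have "K * indicat_real {a..a + \<xi>} y = K" by (simp add: indicator_def)
          moreover have "0 \<le> K * indicat_real {b..b + \<xi>} y" using K by simp
          ultimately show ?thesis using diff_le[of y] by linarith
        next
          case 3
          then have "K * indicat_real {b..b + \<xi>} y = K" by (simp add: indicator_def)
          moreover have "0 \<le> K * indicat_real {a..a + \<xi>} y" using K by simp
          ultimately show ?thesis using diff_le[of y] by linarith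
        qed
      qed
    define F where "F y = indicat_real {a + \<xi>..b + \<xi>} y *\<^sub>R h y - indicat_real {a..b} y *\<^sub>R h y" for y
    define G where "G y = K * indicat_real {a..a + \<xi>} y + K * indicat_real {b..b + \<xi>} y" for y
    have "norm (integral\<^sup>L lborel F) \<le> integral\<^sup>L lborel G"
      by (rule Bochner_Integration.integral_norm_bound_integral)
         (use i1 i2 bound in \<open>simp_all only: F_def[symmetric] G_def[symmetric] F_def[abs_def, symmetric] G_def[abs_def, symmetric]\<close>)
    then show ?thesis unfolding eq by (simp only: real_norm_def F_def[abs_def] G_def[abs_def])
  qed
  also have "\<dots> = 2 * K * \<xi>"
  proof -
    have i: "integrable lborel (\<lambda>y. K * indicat_real {u..v} y)" for u v :: real
      by (intro integrable_mult_right integrable_real_indicator) (auto simp: emeasure_lborel_Icc_eq)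
    show ?thesis
      using assms(4) by (simp add: Bochner_Integration.integral_add[OF i i])
  qed
  finally show ?thesis .
qed

section \<open>Averages against a normalised kernel\<close>

locale mollifier =
  fixes e :: real and j j1 :: "real \<Rightarrow> real"
  assumes e_pos: "0 < e"
    and j_deriv: "\<And>x. (j has_real_derivative j1 x) (at x)"
    and j1_cont: "continuous_on UNIV j1"
    and j_nonneg: "\<And>x. 0 \<le> j x"
    and j_supp: "\<And>x. x \<notin> {e..2 * e} \<Longrightarrow> j x = 0 \<and> j1 x = 0"
    and j_int: "integral\<^sup>L lborel j = 1"
begin

lemma bump_j: "bump_on e j" and bump_j1: "bump_on e j1"
  using j_supp j1_cont DERIV_continuous_on[of UNIV j j1] j_deriv
  by (auto simp: bump_on_def)

abbreviation moll :: "(real \<times> real \<Rightarrow> real) \<Rightarrow> real \<Rightarrow> real \<Rightarrow> real" where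
  "moll \<equiv> conv j j"

lemma moll_integrable:
  fixes g :: "real \<times> real \<Rightarrow> real"
  assumes g: "g \<in> borel_measurable borel" "\<And>z. \<bar>g z\<bar> \<le> M"
  shows "integrable lborel (\<lambda>z. g z * (j (fst z - y) * j (snd z - \<tau>)))"
  by (rule conv_integrable[OF bump_j bump_j g])

lemma moll_const: "moll (\<lambda>z. c) y \<tau> = c"
proof -
  have "conv j j (\<lambda>z. 1) 0 0 = 1"
  proof -
    have i: "integrable (lborel \<Otimes>\<^sub>M lborel) (\<lambda>z. j (fst z) * j (snd z))"
      using moll_integrable[of "\<lambda>z. 1" 1 0 0] by (simp add: lborel_prod)
    have "conv j j (\<lambda>z. 1) 0 0 = integral\<^sup>L (lborel \<Otimes>\<^sub>M lborel) (\<lambda>z. j (fst z) * j (snd z))"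
      by (simp add: conv_def lborel_prod)
    also have "\<dots> = (LBINT x. LBINT t. j x * j t)"
      using lborel_pair.integral_fst'[OF i] by simp
    also have "\<dots> = 1" by (simp add: j_int)
    finally show ?thesis .
  qed
  then show ?thesis
    using conv_translate[OF bump_j bump_j, of "\<lambda>z. c" y \<tau>] conv_translate[OF bump_j bump_j, of "\<lambda>z. 1" 0 0]
    by simp
qed

lemma moll_mono:
  fixes g g' :: "real \<times> real \<Rightarrow> real"
  assumes g: "g \<in> borel_measurable borel" "\<And>z. \<bar>g z\<bar> \<le> M"
    and g': "g' \<in> borel_measurable borel" "\<And>z. \<bar>g' z\<bar> \<le> M'"
    and le: "\<And>x t. e \<le> x - y \<Longrightarrow> x - y \<le> 2 * e \<Longrightarrow> e \<le> t - \<tau> \<Longrightarrow> t - \<tau> \<le> 2 * e \<Longrightarrow> g (x, t) \<le> g' (x, t)"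
  shows "moll g y \<tau> \<le> moll g' y \<tau>"
  unfolding conv_def
proof (rule integral_mono[OF moll_integrable[OF g] moll_integrable[OF g']])
  fix z :: "real \<times> real"
  obtain x t where z: "z = (x, t)" by (cases z)
  show "g z * (j (fst z - y) * j (snd z - \<tau>)) \<le> g' z * (j (fst z - y) * j (snd z - \<tau>))"
  proof (cases "x - y \<in> {e..2 * e} \<and> t - \<tau> \<in> {e..2 * e}")
    case True
    then show ?thesis 
      unfolding z by (intro mult_right_mono mult_nonneg_nonneg j_nonneg) (simp add: le)
  next
    case False
    then have "j (x - y) = 0 \<or> j (t - \<tau>) = 0" using j_supp by blast
    then show ?thesis by (auto simp: z)
  qed
qed

lemma moll_cmult: "moll (\<lambda>z. c * g z) y \<tau> = c * moll g y \<tau>"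
  unfolding conv_def by (simp add: mult.assoc)

lemma moll_abs_bound:
  fixes g :: "real \<times> real \<Rightarrow> real"
  assumes g: "g \<in> borel_measurable borel" "\<And>z. \<bar>g z\<bar> \<le> M"
  shows "\<bar>moll g y \<tau>\<bar> \<le> M"
proof -
  have "moll g y \<tau> \<le> moll (\<lambda>z. M) y \<tau>"
    by (rule moll_mono[OF g, where M' = "\<bar>M\<bar>"]) (use abs_le_D1[OF g(2)] in auto)
  moreover have "moll (\<lambda>z. - M) y \<tau> \<le> moll g y \<tau>"
    by (rule moll_mono[OF _ _ g, where M = "\<bar>M\<bar>"]) (use abs_le_D2[OF g(2)] in \<open>auto simp: minus_le_iff\<close>)
  ultimately show ?thesis by (simp add: moll_const abs_le_iff)
qed


lemma moll_continuous:
  fixes g :: "real \<times> real \<Rightarrow> real"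
  assumes g: "g \<in> borel_measurable borel" "\<And>z. \<bar>g z\<bar> \<le> M"
  shows "continuous_on UNIV (\<lambda>(y, \<tau>). moll g y \<tau>)"
  by (rule conv_continuous[OF bump_j bump_j g])

lemma kernel_nn_integral: "(\<integral>\<^sup>+z. ennreal (j (fst z) * j (snd z)) \<partial>lborel) = 1"
proof -
  have "integrable lborel (\<lambda>z. j (fst z) * j (snd z))"
    using moll_integrable[of "\<lambda>z. 1" 1 0 0] by simp
  then have "(\<integral>\<^sup>+z. ennreal (j (fst z) * j (snd z)) \<partial>lborel) = ennreal (LBINT z. j (fst z) * j (snd z))"
    by (intro nn_integral_eq_integral) (auto simp: j_nonneg)
  also have "(LBINT z. j (fst z) * j (snd z)) = 1"
    using moll_const[of 1 0 0] by (simp add: conv_def)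
  finally show ?thesis by simp
qed

text \<open>By Tonelli the left side is an average of integrals of \<open>g\<close> over translated
  boxes. Every shift in the support of the kernel moves the box of integration into the larger one,
  and the kernel has mass 1.\<close>

lemma integral_moll_le:
  fixes g :: "real \<times> real \<Rightarrow> real"
  assumes g[measurable]: "g \<in> borel_measurable borel" and bd: "\<And>z. \<bar>g z\<bar> \<le> M" and nn: "\<And>z. 0 \<le> g z"
    and B: "{a + e..b + 2 * e} \<times> {c + e..d + 2 * e} \<subseteq> {a'..b'} \<times> {c'..d'}"
  shows "integral {c..d} (\<lambda>\<tau>. integral {a..b} (\<lambda>y. moll g y \<tau>))
    \<le> (LBINT z : {a'..b'} \<times> {c'..d'}. g z)"
proof -
  let ?m = "\<lambda>p. moll g (fst p) (snd p)"
  let ?A = "{a..b} \<times> {c..d}" and ?B = "{a'..b'} \<times> {c'..d'}"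
  let ?J = "\<lambda>z. j (fst z) * j (snd z)"
  have A: "?A = cbox (a, c) (b, d)" and B': "?B = cbox (a', c') (b', d')" by auto
  have mA[measurable]: "?A \<in> sets borel" and mB[measurable]: "?B \<in> sets borel"
    unfolding A B' by simp_all
  have mJ[measurable]: "?J \<in> borel_measurable borel"
    using kernel_measurable[OF bump_j bump_j, of 0 0] by simp
  have cont: "continuous_on S (\<lambda>(y, \<tau>). moll g y \<tau>)" for S
    using moll_continuous[OF g bd] continuous_on_subset by blast
  have m0: "0 \<le> moll g y \<tau>" for y \<tau>
    unfolding conv_def by (intro Bochner_Integration.integral_nonneg) (auto simp: nn j_nonneg)
  have "integral {c..d} (\<lambda>\<tau>. integral {a..b} (\<lambda>y. moll g y \<tau>))
      = integral (cbox (c, a) (d, b)) (\<lambda>(\<tau>, y). moll g y \<tau>)"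
  proof -
    have "continuous_on UNIV (\<lambda>p. moll g (fst p) (snd p))"
      using cont[of UNIV] by (simp add: case_prod_beta')
    then have "continuous_on UNIV (\<lambda>q. moll g (fst (snd q, fst q)) (snd (snd q, fst q)))"
      by (rule continuous_on_compose2) (auto intro!: continuous_intros)
    then have "continuous_on (cbox (c, a) (d, b)) (\<lambda>(\<tau>, y). moll g y \<tau>)"
      by (auto simp: case_prod_beta' intro: continuous_on_subset)
    from integral_prod_continuous[OF this] show ?thesis by simp
  qed
  also have "\<dots> = integral ?A ?m"
    using integral_swap_2dim[OF cont, of a c b d] by (simp add: A case_prod_beta')
  also have "\<dots> = (LBINT p : ?A. ?m p)"
    using cont borel_integrable_compact[of ?A ?m]
    by (intro set_borel_integral_eq_integral(2)[symmetric]) (auto simp: A set_integrable_def case_prod_beta')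
  finally have eq: "integral {c..d} (\<lambda>\<tau>. integral {a..b} (\<lambda>y. moll g y \<tau>)) = (LBINT p : ?A. ?m p)" .
  have int_m: "integrable lborel (\<lambda>p. indicator ?A p *\<^sub>R ?m p)"
    using cont borel_integrable_compact[of ?A ?m] by (simp add: A case_prod_beta')
  have int_g: "integrable lborel (\<lambda>p. indicator ?B p *\<^sub>R g p)"
  proof (rule Bochner_Integration.integrable_bound[OF integrable_indicator_box[of M a' b' c' d']])
    show "AE z in lborel. norm (indicat_real ?B z *\<^sub>R g z) \<le> norm (M * indicat_real ?B z)"
      using bd by (intro AE_I2) (simp add: indicator_def order_trans[OF bd abs_ge_self])
  qed simp
  have mpt: "ennreal (?m p) = (\<integral>\<^sup>+z. ennreal (g (p + z) * ?J z) \<partial>lborel)" for p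
  proof -
    have 1: "?m p = (LBINT z. g (p + z) * ?J z)"
      using conv_translate[OF bump_j bump_j g, of "fst p" "snd p"] by simp
    have "integrable lborel (\<lambda>z. g (p + z) * ?J z)"
      using conv_integrable[OF bump_j bump_j, of "\<lambda>z. g (p + z)" M 0 0] bd by simp
    then show ?thesis unfolding 1
      by (intro nn_integral_eq_integral[symmetric]) (auto simp: nn j_nonneg)
  qed
  have "ennreal (LBINT p : ?A. ?m p) = (\<integral>\<^sup>+p. ennreal (indicator ?A p *\<^sub>R ?m p) \<partial>lborel)"
    unfolding set_lebesgue_integral_def
    by (rule nn_integral_eq_integral[symmetric, OF int_m]) (auto simp: m0)
  also have "\<dots> = (\<integral>\<^sup>+p. (\<integral>\<^sup>+z. indicator ?A p * ennreal (g (p + z)) * ennreal (?J z) \<partial>lborel) \<partial>lborel)"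
  proof (rule nn_integral_cong)
    fix p
    have "ennreal (indicator ?A p *\<^sub>R ?m p) = indicator ?A p * ennreal (?m p)"
      by (auto simp: indicator_def)
    also have "\<dots> = (\<integral>\<^sup>+z. indicator ?A p * ennreal (g (p + z) * ?J z) \<partial>lborel)"
      unfolding mpt by (rule nn_integral_cmult[symmetric]) simp
    also have "\<dots> = (\<integral>\<^sup>+z. indicator ?A p * ennreal (g (p + z)) * ennreal (?J z) \<partial>lborel)"
      by (simp add: ennreal_mult nn j_nonneg mult.assoc)
    finally show "ennreal (indicator ?A p *\<^sub>R ?m p) = \<dots>" .
  qed
  also have "\<dots> = (\<integral>\<^sup>+z. (\<integral>\<^sup>+p. indicator ?A p * ennreal (g (p + z)) * ennreal (?J z) \<partial>lborel) \<partial>lborel)"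
    by (rule lborel_pair.Fubini'[symmetric]) simp
  also have "\<dots> \<le> (\<integral>\<^sup>+z. (\<integral>\<^sup>+q. indicator ?B q * ennreal (g q) \<partial>lborel) * ennreal (?J z) \<partial>lborel)"
  proof (rule nn_integral_mono)
    fix z
    show "(\<integral>\<^sup>+p. indicator ?A p * ennreal (g (p + z)) * ennreal (?J z) \<partial>lborel)
       \<le> (\<integral>\<^sup>+q. indicator ?B q * ennreal (g q) \<partial>lborel) * ennreal (?J z)"
    proof (cases "fst z \<in> {e..2*e} \<and> snd z \<in> {e..2*e}")
      case True
      have "(\<integral>\<^sup>+p. indicator ?A p * ennreal (g (p + z)) * ennreal (?J z) \<partial>lborel)
         = (\<integral>\<^sup>+p. indicator ?A p * ennreal (g (p + z)) \<partial>lborel) * ennreal (?J z)"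
        by (rule nn_integral_multc) simp
      also have "(\<integral>\<^sup>+p. indicator ?A p * ennreal (g (p + z)) \<partial>lborel)
         \<le> (\<integral>\<^sup>+p. indicator ?B (z + p) * ennreal (g (z + p)) \<partial>lborel)"
      proof (rule nn_integral_mono)
        fix p :: "real \<times> real"
        have "p \<in> ?A \<Longrightarrow> z + p \<in> ?B"
        proof -
          assume "p \<in> ?A"
          then have "z + p \<in> {a + e..b + 2 * e} \<times> {c + e..d + 2 * e}"
            using True by (auto simp: mem_Times_iff intro!: add_mono)
          with B show ?thesis by (rule subsetD)
        qed
        then show "indicator ?A p * ennreal (g (p + z)) \<le> indicator ?B (z + p) * ennreal (g (z + p))"
          by (auto simp: indicator_def add.commute)
      qed
      also have "\<dots> = (\<integral>\<^sup>+q. indicator ?B q * ennreal (g q) \<partial>distr lborel borel ((+) z))"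
        by (rule nn_integral_distr[symmetric]) simp_all
      also have "\<dots> = (\<integral>\<^sup>+q. indicator ?B q * ennreal (g q) \<partial>lborel)"
        by (simp add: lborel_distr_plus)
      finally show ?thesis by (simp add: mult_right_mono)
    next
      case False
      then have J0: "?J z = 0" using j_supp by auto
      show ?thesis by (simp only: J0) simp
    qed
  qed
  also have "\<dots> = (\<integral>\<^sup>+q. indicator ?B q * ennreal (g q) \<partial>lborel)"
    by (subst nn_integral_cmult) (simp_all add: kernel_nn_integral)
  also have "\<dots> = (\<integral>\<^sup>+q. ennreal (indicator ?B q *\<^sub>R g q) \<partial>lborel)"
    by (rule nn_integral_cong) (auto simp: indicator_def)
  also have "\<dots> = ennreal (LBINT q : ?B. g q)"
    unfolding set_lebesgue_integral_def
    by (rule nn_integral_eq_integral[OF int_g]) (auto simp: nn)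
  finally have "ennreal (LBINT p : ?A. ?m p) \<le> ennreal (LBINT q : ?B. g q)" .
  moreover have "0 \<le> (LBINT q : ?B. g q)"
    unfolding set_lebesgue_integral_def by (intro Bochner_Integration.integral_nonneg) (auto simp: nn)
  ultimately show ?thesis unfolding eq by simp
qed

text \<open>The slice integral of the mollification is a weighted mean of slice integrals of
  \<open>w\<close> at times in [\<tau> + e, \<tau> + 2 e], with the interval shifted by at most 2 e.
  A shift by \<xi> costs 2 K \<xi>, whence the term 4 K e; since times are averaged, control at
  almost every time is enough.\<close>

lemma integral_moll_slice:
  fixes w :: "real \<times> real \<Rightarrow> real"
  assumes w[measurable]: "w \<in> borel_measurable borel" and bd: "\<And>z. \<bar>w z\<bar> \<le> K" and "a \<le> b"
    and ae: "AE t in lborel. \<tau> + e \<le> t \<and> t \<le> \<tau> + 2 * e \<longrightarrow> \<bar>(LBINT y:{a..b}. w (y, t)) - c\<bar> \<le> \<eta>"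
  shows "\<bar>integral {a..b} (\<lambda>y. moll w y \<tau>) - c\<bar> \<le> \<eta> + 4 * K * e"
proof -
  let ?J = "\<lambda>z. j (fst z) * j (snd z)"
  have K: "0 \<le> K" using bd[of undefined] by simp
  have mJ[measurable]: "?J \<in> borel_measurable borel"
    using kernel_measurable[OF bump_j bump_j, of 0 0] by simp
  obtain C where C: "0 \<le> C" "\<And>x. \<bar>j x\<bar> \<le> C" using bump_on_bounded[OF bump_j] by blast
  have Jint: "integrable lborel ?J" using moll_integrable[of "\<lambda>z. 1" 1 0 0] by simp
  have J1: "(LBINT z. ?J z) = 1" using moll_const[of 1 0 0] by (simp add: conv_def)
  have J0: "0 \<le> ?J z" for z by (simp add: j_nonneg)
  define I where "I z = (LBINT y:{a..b}. w ((y, \<tau>) + z))" for z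
  have cont: "continuous_on {a..b} (\<lambda>y. moll w y \<tau>)"
  proof -
    have "continuous_on UNIV (\<lambda>p. moll w (fst p) (snd p))"
      using moll_continuous[OF w bd] by (simp add: case_prod_beta')
    then have "continuous_on {a..b} (\<lambda>y. moll w (fst (y, \<tau>)) (snd (y, \<tau>)))"
      by (rule continuous_on_compose2) (auto intro!: continuous_intros)
    then show ?thesis by simp
  qed
  let ?f = "\<lambda>y z. indicator {a..b} y * (w ((y, \<tau>) + z) * ?J z)"
  have [measurable]: "case_prod ?f \<in> borel_measurable borel"
  proof -
    have c: "(\<lambda>q::real \<times> (real \<times> real). fst q) \<in> borel_measurable borel"
      "(\<lambda>q::real \<times> (real \<times> real). (fst q, \<tau>) + snd q) \<in> borel_measurable borel"
      "(\<lambda>q::real \<times> (real \<times> real). snd q) \<in> borel_measurable borel"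
      by (intro borel_measurable_continuous_onI continuous_intros)+
    have i: "(\<lambda>y. indicat_real {a..b} y) \<in> borel_measurable borel" by simp
    show ?thesis
      unfolding case_prod_beta'
      by (intro borel_measurable_times measurable_compose[OF c(1) i] measurable_compose[OF c(2) w]
            measurable_compose[OF c(3) mJ])
  qed
  have fint: "integrable (lborel \<Otimes>\<^sub>M lborel) (case_prod ?f)"
    unfolding lborel_prod
  proof (rule Bochner_Integration.integrable_bound)
    let ?c = "cbox (a, (e, e)) (b, (2 * e, 2 * e))"
    show "integrable lborel (\<lambda>q. K * (C * C) * indicat_real ?c q)"
      by (intro integrable_mult_right integrable_real_indicator) (auto simp: emeasure_lborel_cbox_eq)
    have "\<bar>?f (fst q) (snd q)\<bar> \<le> K * (C * C) * indicat_real ?c q" for q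
    proof (cases "q \<in> ?c")
      case True
      have "\<bar>w ((fst q, \<tau>) + snd q)\<bar> * (\<bar>j (fst (snd q))\<bar> * \<bar>j (snd (snd q))\<bar>) \<le> K * (C * C)"
        by (intro mult_mono bd C K mult_nonneg_nonneg abs_ge_zero)
      then show ?thesis using True C K by (simp add: abs_mult indicator_def)
    next
      case False
      then have "fst q \<notin> {a..b} \<or> fst (snd q) \<notin> {e..2*e} \<or> snd (snd q) \<notin> {e..2*e}"
        by (cases q) (auto simp: cbox_Pair_eq)
      then have "?f (fst q) (snd q) = 0" using j_supp by (auto simp: indicator_def)
      then show ?thesis using K C by (simp only: abs_zero) simp
    qed
    then show "AE q in lborel. norm (case_prod ?f q) \<le> norm (K * (C * C) * indicat_real ?c q)"
      using K C by (intro AE_I2) (simp add: case_prod_beta')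
  qed simp
  have "integral {a..b} (\<lambda>y. moll w y \<tau>) = (LBINT y:{a..b}. moll w y \<tau>)"
    using borel_integrable_compact[OF _ cont]
    by (intro set_borel_integral_eq_integral(2)[symmetric]) (auto simp: set_integrable_def)
  also have "\<dots> = (LBINT y. LBINT z. ?f y z)"
    unfolding set_lebesgue_integral_def
    by (rule Bochner_Integration.integral_cong) (simp_all add: conv_translate[OF bump_j bump_j w])
  also have "\<dots> = (LBINT z. LBINT y. ?f y z)"
    by (rule lborel_pair.Fubini_integral[symmetric, OF fint])
  also have "\<dots> = (LBINT z. I z * ?J z)"
  proof (rule Bochner_Integration.integral_cong[OF refl])
    fix z
    have "(LBINT y. ?f y z) = (LBINT y. (indicator {a..b} y *\<^sub>R w ((y, \<tau>) + z)) * ?J z)"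
      by (simp add: mult.assoc)
    also have "\<dots> = I z * ?J z" unfolding I_def set_lebesgue_integral_def by simp
    finally show "(LBINT y. ?f y z) = I z * ?J z" .
  qed
  finally have eq: "integral {a..b} (\<lambda>y. moll w y \<tau>) = (LBINT z. I z * ?J z)" .
  have IJ: "integrable lborel (\<lambda>z. I z * ?J z)"
  proof -
    have "integrable lborel (\<lambda>z. LBINT y. ?f y z)"
      using lborel_pair.integrable_snd[OF fint] .
    moreover have "(LBINT y. ?f y z) = I z * ?J z" for z
    proof -
      have "(LBINT y. ?f y z) = (LBINT y. (indicator {a..b} y *\<^sub>R w ((y, \<tau>) + z)) * ?J z)"
        by (simp add: mult.assoc)
      also have "\<dots> = I z * ?J z" unfolding I_def set_lebesgue_integral_def by simp
      finally show ?thesis .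
    qed
    ultimately show ?thesis by simp
  qed
  from AE_E[OF ae] obtain N where
    N: "{t \<in> space lborel. \<not> (\<tau> + e \<le> t \<and> t \<le> \<tau> + 2 * e \<longrightarrow> \<bar>(LBINT y:{a..b}. w (y, t)) - c\<bar> \<le> \<eta>)} \<subseteq> N"
    "emeasure lborel N = 0" "N \<in> sets lborel" by blast
  \<comment> \<open>The exceptional times form a null set of the line; the strip over it is null in
    the plane, where the average is taken.\<close>
  have "UNIV \<times> {t. t + \<tau> \<in> N} \<in> null_sets (lborel :: (real \<times> real) measure)"
  proof -
    have N'[measurable]: "N \<in> sets borel" using N(3) by simp
    have set: "{t. t + \<tau> \<in> N} \<in> sets borel" by measurable
    have "emeasure lborel {t. t + \<tau> \<in> N} = emeasure (distr lborel borel ((+) \<tau>)) N"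
      by (subst emeasure_distr) (auto simp: vimage_def add.commute)
    also have "\<dots> = 0" using N(2) by (simp add: lborel_distr_plus)
    finally have z: "emeasure lborel {t. t + \<tau> \<in> N} = 0" .
    have "emeasure (lborel \<Otimes>\<^sub>M lborel) ((UNIV :: real set) \<times> {t. t + \<tau> \<in> N}) = 0"
      using set z by (subst lborel.emeasure_pair_measure_Times) auto
    moreover have "(UNIV :: real set) \<times> {t. t + \<tau> \<in> N} \<in> sets (lborel \<Otimes>\<^sub>M lborel)"
      using set by (intro pair_measureI) auto
    ultimately show ?thesis by (subst lborel_prod[symmetric]) (rule null_setsI)
  qed
  then have aez: "AE z in lborel. z \<notin> (UNIV :: real set) \<times> {t. t + \<tau> \<in> N}"
    by (rule AE_not_in)
  have "integral {a..b} (\<lambda>y. moll w y \<tau>) - c = (LBINT z. I z * ?J z) - (LBINT z. c * ?J z)"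
    unfolding eq by (simp add: J1)
  also have "\<dots> = (LBINT z. (I z - c) * ?J z)"
    using IJ Jint by (subst Bochner_Integration.integral_diff[symmetric]) (auto simp: left_diff_distrib)
  finally have "\<bar>integral {a..b} (\<lambda>y. moll w y \<tau>) - c\<bar> = \<bar>LBINT z. (I z - c) * ?J z\<bar>" by simp
  also have "\<dots> \<le> (LBINT z. \<bar>(I z - c) * ?J z\<bar>)" by (rule integral_abs_bound)
  also have "\<dots> \<le> (LBINT z. (\<eta> + 4 * K * e) * ?J z)"
  proof (rule integral_mono_AE)
    have "integrable lborel (\<lambda>z. I z * ?J z - c * ?J z)" using IJ Jint by simp
    then show "integrable lborel (\<lambda>z. \<bar>(I z - c) * ?J z\<bar>)" by (simp add: left_diff_distrib)
    show "integrable lborel (\<lambda>z. (\<eta> + 4 * K * e) * ?J z)" using Jint by simp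
    show "AE z in lborel. \<bar>(I z - c) * ?J z\<bar> \<le> (\<eta> + 4 * K * e) * ?J z"
      using aez
    proof eventually_elim
      case (elim z)
      show ?case
      proof (cases "fst z \<in> {e..2*e} \<and> snd z \<in> {e..2*e}")
        case True
        define t where "t = \<tau> + snd z"
        have "t \<notin> N" using elim by (cases z) (auto simp: t_def add.commute)
        then have "\<tau> + e \<le> t \<and> t \<le> \<tau> + 2 * e \<longrightarrow> \<bar>(LBINT y:{a..b}. w (y, t)) - c\<bar> \<le> \<eta>"
          using N(1) by auto
        then have 1: "\<bar>(LBINT y:{a..b}. w (y, t)) - c\<bar> \<le> \<eta>" using True by (auto simp: t_def)
        have m: "(\<lambda>y. w (y, t)) \<in> borel_measurable borel"
        proof -
          have "(\<lambda>y::real. (y, t)) \<in> borel_measurable borel"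
            by (intro borel_measurable_continuous_onI continuous_intros)
          from measurable_compose[OF this w] show ?thesis .
        qed
        have "I z = (LBINT y:{a..b}. w (y + fst z, t))"
          unfolding I_def t_def by (cases z) simp
        then have "\<bar>I z - (LBINT y:{a..b}. w (y, t))\<bar> \<le> 2 * K * fst z"
          using set_integral_shift_le[OF m bd \<open>a \<le> b\<close>, of "fst z"] True e_pos by simp
        also have "\<dots> \<le> 2 * K * (2 * e)" using True K by (intro mult_left_mono) auto
        finally have "\<bar>I z - c\<bar> \<le> \<eta> + 4 * K * e" using 1 by simp
        then show ?thesis using J0[of z] by (simp add: abs_mult j_nonneg mult_right_mono)
      next
        case False
        then have Jz: "?J z = 0" using j_supp by auto
        show ?thesis by (simp only: Jz mult_zero_right abs_zero order_refl)
      qed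
    qed
  qed
  also have "\<dots> = \<eta> + 4 * K * e" by (simp add: J1)
  finally show ?thesis .
qed

end

section \<open>The Lyapunov estimate\<close>

text \<open>An exponent of at least 2 makes the power of the negative part differentiable across 0.
  This is why the Lyapunov functionals use its square and its cube.\<close>

lemma DERIV_min_0_power:
  "((\<lambda>x::real. (min x 0) ^ Suc (Suc n)) has_real_derivative real (Suc (Suc n)) * (min x 0) ^ Suc n) (at x)"
proof -
  consider "x > 0" | "x < 0" | "x = 0" by linarith
  then show ?thesis
  proof cases
    case 1
    have "((\<lambda>x::real. 0) has_real_derivative 0) (at x)" by simp
    then have "((\<lambda>x::real. (min x 0) ^ Suc (Suc n)) has_real_derivative 0) (at x)"
      by (rule has_field_derivative_transform_within_open[where S="{0<..}"]) (use 1 in auto)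
    then show ?thesis using 1 by simp
  next
    case 2
    have "((\<lambda>x::real. x ^ Suc (Suc n)) has_real_derivative real (Suc (Suc n)) * x ^ Suc n) (at x)"
      using DERIV_pow[of "Suc (Suc n)" x] by simp
    then have "((\<lambda>x::real. (min x 0) ^ Suc (Suc n)) has_real_derivative real (Suc (Suc n)) * x ^ Suc n) (at x)"
      by (rule has_field_derivative_transform_within_open[where S="{..<0}"]) (use 2 in auto)
    then show ?thesis using 2 by simp
  next
    case 3
    have "((\<lambda>h::real. (min h 0) ^ Suc (Suc n) / h) \<longlongrightarrow> 0) (at 0)"
    proof (rule Lim_null_comparison)
      show "((\<lambda>h::real. \<bar>h\<bar> ^ Suc n) \<longlongrightarrow> 0) (at 0)"
        by (rule tendsto_eq_intros | simp)+
      have "norm ((min h 0) ^ Suc (Suc n) / h) \<le> \<bar>h\<bar> ^ Suc n" for h :: real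
        by (cases "h < 0") (auto simp: min_def abs_mult power_abs)
      then show "eventually (\<lambda>h::real. norm ((min h 0) ^ Suc (Suc n) / h) \<le> \<bar>h\<bar> ^ Suc n) (at 0)" by simp
    qed
    then show ?thesis using 3 by (simp add: DERIV_def)
  qed
qed

lemma DERIV_min_0_square: "((\<lambda>x::real. (min x 0)\<^sup>2) has_real_derivative 2 * min x 0) (at x)"
  using DERIV_min_0_power[of 0 x] by (simp add: numeral_2_eq_2)

lemma DERIV_min_0_cube: "((\<lambda>x::real. (min x 0) ^ 3) has_real_derivative 3 * (min x 0)\<^sup>2) (at x)"
  using DERIV_min_0_power[of 1 x] by (simp add: numeral_2_eq_2 numeral_3_eq_3)

lemma continuous_on_slices:
  fixes X :: "real \<Rightarrow> real \<Rightarrow> real"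
  assumes "continuous_on (A \<times> B) (\<lambda>p. X (snd p) (fst p))"
  shows "\<tau> \<in> A \<Longrightarrow> continuous_on B (\<lambda>y. X y \<tau>)" "y \<in> B \<Longrightarrow> continuous_on A (\<lambda>\<tau>. X y \<tau>)"
proof -
  assume "\<tau> \<in> A"
  then have "continuous_on B (\<lambda>y. X (snd (\<tau>, y)) (fst (\<tau>, y)))"
    by (intro continuous_on_compose2[OF assms]) (auto intro!: continuous_intros)
  then show "continuous_on B (\<lambda>y. X y \<tau>)" by simp
next
  assume "y \<in> B"
  then have "continuous_on A (\<lambda>\<tau>. X (snd (\<tau>, y)) (fst (\<tau>, y)))"
    by (intro continuous_on_compose2[OF assms]) (auto intro!: continuous_intros)
  then show "continuous_on A (\<lambda>\<tau>. X y \<tau>)" by simp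
qed

lemma integral_param_DERIV:
  fixes X Xt :: "real \<Rightarrow> real \<Rightarrow> real"
  assumes c: "continuous_on ({0..T} \<times> {-R..R}) (\<lambda>p. X (snd p) (fst p))"
    and c': "continuous_on ({0..T} \<times> {-R..R}) (\<lambda>p. Xt (snd p) (fst p))"
    and d: "\<And>y \<tau>. y \<in> {-R..R} \<Longrightarrow> \<tau> \<in> {0..T} \<Longrightarrow> ((\<lambda>\<tau>. X y \<tau>) has_real_derivative Xt y \<tau>) (at \<tau> within {0..T})"
    and t: "\<tau> \<in> {0..T}"
  shows "((\<lambda>\<tau>. integral {-R..R} (\<lambda>y. X y \<tau>)) has_real_derivative integral {-R..R} (\<lambda>y. Xt y \<tau>)) (at \<tau> within {0..T})"
proof -
  have "((\<lambda>\<tau>. integral (cbox (-R) R) (\<lambda>y. X y \<tau>)) has_real_derivative integral (cbox (-R) R) (\<lambda>y. Xt y \<tau>)) (at \<tau> within {0..T})"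
  proof (rule leibniz_rule_field_derivative[where fx = "\<lambda>\<tau> y. Xt y \<tau>"])
    show "(\<lambda>y. X y \<sigma>) integrable_on cbox (- R) R" if "\<sigma> \<in> {0..T}" for \<sigma>
      using integrable_continuous_interval[OF continuous_on_slices(1)[OF c that]] by simp
    show "continuous_on ({0..T} \<times> cbox (- R) R) (\<lambda>(\<tau>, y). Xt y \<tau>)"
      using c' by (simp add: case_prod_beta')
  qed (use t d in auto)
  then show ?thesis by simp
qed

text \<open>
  The Lyapunov argument behind the lower bound. For \<open>W < 0\<close> the function \<open>W\<close> can only decrease in
  time where \<open>E > 0\<close>, and \<open>\<integral> E (min W 0)\<^sup>2 \<psi>\<close> is nonincreasing up to the defect \<open>\<delta>\<close>: the
  contributions of \<open>W\<^sub>t\<close> and \<open>W\<^sub>y\<close> to the derivative of \<open>(min W 0)\<^sup>2\<close> almost cancel.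
\<close>
lemma subsolution_estimate:
  fixes V w F E Q Et Qy \<delta> :: "real \<Rightarrow> real \<Rightarrow> real" and D D' :: "real \<Rightarrow> real"
    and k fk \<Lambda> R T M :: real
  defines "W \<equiv> \<lambda>y \<tau>. V y \<tau> - k * D y + (1 + \<tau>) * fk"
    and "\<psi> \<equiv> \<lambda>y \<tau>. (min (\<Lambda> * \<tau> + sqrt (1 + y\<^sup>2) - R) 0)\<^sup>2"
  assumes T: "0 \<le> T" and R: "0 \<le> R" and L: "0 \<le> \<Lambda>"
    and cV: "continuous_on ({0..T} \<times> {-R..R}) (\<lambda>p. V (snd p) (fst p))"
    and cw: "continuous_on ({0..T} \<times> {-R..R}) (\<lambda>p. w (snd p) (fst p))"
    and cF: "continuous_on ({0..T} \<times> {-R..R}) (\<lambda>p. F (snd p) (fst p))"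
    and cE: "continuous_on ({0..T} \<times> {-R..R}) (\<lambda>p. E (snd p) (fst p))"
    and cQ: "continuous_on ({0..T} \<times> {-R..R}) (\<lambda>p. Q (snd p) (fst p))"
    and cEt: "continuous_on ({0..T} \<times> {-R..R}) (\<lambda>p. Et (snd p) (fst p))"
    and cQy: "continuous_on ({0..T} \<times> {-R..R}) (\<lambda>p. Qy (snd p) (fst p))"
    and cd: "continuous_on ({0..T} \<times> {-R..R}) (\<lambda>p. \<delta> (snd p) (fst p))"
    and cD': "continuous_on UNIV D'"
    and dVy: "\<And>y \<tau>. y \<in> {-R..R} \<Longrightarrow> \<tau> \<in> {0..T} \<Longrightarrow> ((\<lambda>y. V y \<tau>) has_real_derivative w y \<tau>) (at y within {-R..R})"
    and dVt: "\<And>y \<tau>. y \<in> {-R..R} \<Longrightarrow> \<tau> \<in> {0..T} \<Longrightarrow> ((\<lambda>\<tau>. V y \<tau>) has_real_derivative - F y \<tau>) (at \<tau> within {0..T})"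
    and dEt: "\<And>y \<tau>. y \<in> {-R..R} \<Longrightarrow> \<tau> \<in> {0..T} \<Longrightarrow> ((\<lambda>\<tau>. E y \<tau>) has_real_derivative Et y \<tau>) (at \<tau> within {0..T})"
    and dQy: "\<And>y \<tau>. y \<in> {-R..R} \<Longrightarrow> \<tau> \<in> {0..T} \<Longrightarrow> ((\<lambda>y. Q y \<tau>) has_real_derivative Qy y \<tau>) (at y within {-R..R})"
    and dD: "\<And>y. (D has_real_derivative D' y) (at y)"
    and pde: "\<And>y \<tau>. y \<in> {-R..R} \<Longrightarrow> \<tau> \<in> {0..T} \<Longrightarrow> Et y \<tau> + Qy y \<tau> \<le> 0"
    and E0: "\<And>y \<tau>. 0 \<le> E y \<tau>" and QE: "\<And>y \<tau>. \<bar>Q y \<tau>\<bar> \<le> \<Lambda> * E y \<tau>"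
    and FE: "\<And>y \<tau>. F y \<tau> - fk \<le> \<Lambda> * E y \<tau>"
    and defect: "\<And>y \<tau>. y \<in> {-R..R} \<Longrightarrow> \<tau> \<in> {0..T} \<Longrightarrow> E y \<tau> * (F y \<tau> - fk) - Q y \<tau> * (w y \<tau> - k * D' y) \<le> \<delta> y \<tau>"
    and d0: "\<And>y \<tau>. 0 \<le> \<delta> y \<tau>"
    and M: "\<And>y \<tau>. y \<in> {-R..R} \<Longrightarrow> \<tau> \<in> {0..T} \<Longrightarrow> \<bar>W y \<tau>\<bar> \<le> M"
  shows "integral {-R..R} (\<lambda>y. - ((min (W y T) 0) ^ 3) * \<psi> y T)
    \<le> integral {-R..R} (\<lambda>y. - ((min (W y 0) 0) ^ 3) * \<psi> y 0)
      + 3 * \<Lambda> * T * (integral {-R..R} (\<lambda>y. E y 0 * (min (W y 0) 0)\<^sup>2 * \<psi> y 0)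
          + 2 * M * R\<^sup>2 * integral {0..T} (\<lambda>\<tau>. integral {-R..R} (\<lambda>y. \<delta> y \<tau>)))"
proof -
  let ?S = "{0..T} \<times> {-R..R}"
  let ?m = "\<lambda>x::real. min x 0"
  \<comment> \<open>The weight is the squared negative part of \<rho>, so it lives inside the
    backward cone |y| < R - \<Lambda> \<tau>. The root sqrt (1 + y^2) is a differentiable substitute
    for |y| with slope below 1.\<close>
  define \<rho> where "\<rho> y \<tau> = \<Lambda> * \<tau> + sqrt (1 + y\<^sup>2) - R" for y \<tau>
  have \<psi>: "\<psi> y \<tau> = (?m (\<rho> y \<tau>))\<^sup>2" for y \<tau> by (simp add: \<psi>_def \<rho>_def)
  have pos: "0 < 1 + y\<^sup>2" for y :: real by (simp add: add_pos_nonneg)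
  have cD: "continuous_on UNIV D"
    by (rule DERIV_continuous_on[OF has_field_derivative_at_within[OF dD]])
  have cDp: "continuous_on ?S (\<lambda>p. D (snd p))" "continuous_on ?S (\<lambda>p. D' (snd p))"
    by (rule continuous_on_compose2[OF cD] continuous_on_compose2[OF cD'], auto intro!: continuous_intros)+
  have cW: "continuous_on ?S (\<lambda>p. W (snd p) (fst p))"
    unfolding W_def by (intro continuous_intros cV cDp)
  have c\<rho>: "continuous_on ?S (\<lambda>p. \<rho> (snd p) (fst p))"
    unfolding \<rho>_def by (intro continuous_intros)
  note cc = cV cw cF cE cQ cEt cQy cd cDp cW c\<rho>
  have dWt: "((\<lambda>\<tau>. W y \<tau>) has_real_derivative - (F y \<tau> - fk)) (at \<tau> within {0..T})"
    if "y \<in> {-R..R}" "\<tau> \<in> {0..T}" for y \<tau>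
    unfolding W_def by (rule derivative_eq_intros dVt[OF that] refl | simp)+
  have dWy: "((\<lambda>y. W y \<tau>) has_real_derivative (w y \<tau> - k * D' y)) (at y within {-R..R})"
    if "y \<in> {-R..R}" "\<tau> \<in> {0..T}" for y \<tau>
    unfolding W_def by (rule derivative_eq_intros dVy[OF that] has_field_derivative_at_within[OF dD] refl | simp)+
  have d\<rho>t: "((\<lambda>\<tau>. \<rho> y \<tau>) has_real_derivative \<Lambda>) (at \<tau> within S)" for y \<tau> S
    unfolding \<rho>_def by (auto intro!: derivative_eq_intros)
  have d\<rho>y: "((\<lambda>y. \<rho> y \<tau>) has_real_derivative y / sqrt (1 + y\<^sup>2)) (at y within S)" for y \<tau> S
    unfolding \<rho>_def using pos[of y] by (auto intro!: derivative_eq_intros simp: field_simps)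
  have d\<psi>t: "((\<lambda>\<tau>. \<psi> y \<tau>) has_real_derivative 2 * ?m (\<rho> y \<tau>) * \<Lambda>) (at \<tau> within S)" for y \<tau> S
    unfolding \<psi> by (rule DERIV_chain'[OF d\<rho>t DERIV_min_0_square])
  have d\<psi>y: "((\<lambda>y. \<psi> y \<tau>) has_real_derivative 2 * ?m (\<rho> y \<tau>) * (y / sqrt (1 + y\<^sup>2))) (at y within S)" for y \<tau> S
    unfolding \<psi> by (rule DERIV_chain'[OF d\<rho>y DERIV_min_0_square])
  have c\<psi>: "continuous_on ?S (\<lambda>p. \<psi> (snd p) (fst p))"
    unfolding \<psi> by (intro continuous_intros c\<rho>)
  have \<psi>0: "0 \<le> \<psi> y \<tau>" for y \<tau> by (simp add: \<psi>)
  have \<psi>R: "\<psi> y \<tau> \<le> R\<^sup>2" if "0 \<le> \<tau>" for y \<tau>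
  proof -
    have "0 \<le> \<Lambda> * \<tau> + sqrt (1 + y\<^sup>2)" using L that by simp
    then have "\<bar>?m (\<rho> y \<tau>)\<bar> \<le> R" using R by (auto simp: \<rho>_def min_def)
    then show ?thesis unfolding \<psi> by (metis abs_le_square_iff abs_of_nonneg R)
  qed
  \<comment> \<open>Vanishing at the lateral boundary removes the flux terms when the y-derivative
    is integrated.\<close>
  have \<psi>bd: "\<psi> y \<tau> = 0" if "0 \<le> \<tau>" "\<bar>y\<bar> = R" for y \<tau>
  proof -
    have "R \<le> sqrt (1 + y\<^sup>2)" using that(2) by (metis abs_ge_zero power2_abs real_le_rsqrt less_add_one add.commute less_imp_le)
    moreover have "0 \<le> \<Lambda> * \<tau>" using L that by simp
    ultimately show ?thesis by (simp add: \<psi> \<rho>_def)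
  qed
  \<comment> \<open>\<open>G\<close> is the density of the functional with entropy weight and
    \<open>H\<close> its flux; \<open>B\<close> is the density of the cubic functional that finally
    detects negativity of \<open>W\<close>. The suffixes t and y mark derivatives.\<close>
  define G where "G y \<tau> = E y \<tau> * (?m (W y \<tau>))\<^sup>2 * \<psi> y \<tau>" for y \<tau>
  define Gt where "Gt y \<tau> = (Et y \<tau> * (?m (W y \<tau>))\<^sup>2 + 2 * ?m (W y \<tau>) * - (F y \<tau> - fk) * E y \<tau>) * \<psi> y \<tau>
      + 2 * ?m (\<rho> y \<tau>) * \<Lambda> * (E y \<tau> * (?m (W y \<tau>))\<^sup>2)" for y \<tau>
  define H where "H y \<tau> = Q y \<tau> * (?m (W y \<tau>))\<^sup>2 * \<psi> y \<tau>" for y \<tau>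
  define Hy where "Hy y \<tau> = (Qy y \<tau> * (?m (W y \<tau>))\<^sup>2 + 2 * ?m (W y \<tau>) * (w y \<tau> - k * D' y) * Q y \<tau>) * \<psi> y \<tau>
      + 2 * ?m (\<rho> y \<tau>) * (y / sqrt (1 + y\<^sup>2)) * (Q y \<tau> * (?m (W y \<tau>))\<^sup>2)" for y \<tau>
  define B where "B y \<tau> = - ((?m (W y \<tau>)) ^ 3) * \<psi> y \<tau>" for y \<tau>
  define Bt where "Bt y \<tau> = - (3 * (?m (W y \<tau>))\<^sup>2 * - (F y \<tau> - fk)) * \<psi> y \<tau>
      + 2 * ?m (\<rho> y \<tau>) * \<Lambda> * (- ((?m (W y \<tau>)) ^ 3))" for y \<tau>
  have cG: "continuous_on ?S (\<lambda>p. G (snd p) (fst p))" and cGt: "continuous_on ?S (\<lambda>p. Gt (snd p) (fst p))"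
    and cB: "continuous_on ?S (\<lambda>p. B (snd p) (fst p))" and cBt: "continuous_on ?S (\<lambda>p. Bt (snd p) (fst p))"
    unfolding G_def Gt_def B_def Bt_def by (intro continuous_intros cc c\<psi>)+
  have cHy: "continuous_on ?S (\<lambda>p. Hy (snd p) (fst p))"
    unfolding Hy_def using pos by (intro continuous_intros cc c\<psi>) (auto simp: less_imp_neq[symmetric])
  have dG: "((\<lambda>\<tau>. G y \<tau>) has_real_derivative Gt y \<tau>) (at \<tau> within {0..T})"
    if "y \<in> {-R..R}" "\<tau> \<in> {0..T}" for y \<tau>
    unfolding G_def Gt_def
    by (rule DERIV_mult[OF DERIV_mult[OF dEt[OF that] DERIV_chain'[OF dWt[OF that] DERIV_min_0_square]] d\<psi>t])
  have dH: "((\<lambda>y. H y \<tau>) has_real_derivative Hy y \<tau>) (at y within {-R..R})"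
    if "y \<in> {-R..R}" "\<tau> \<in> {0..T}" for y \<tau>
    unfolding H_def Hy_def
    by (rule DERIV_mult[OF DERIV_mult[OF dQy[OF that] DERIV_chain'[OF dWy[OF that] DERIV_min_0_square]] d\<psi>y])
  have dB: "((\<lambda>\<tau>. B y \<tau>) has_real_derivative Bt y \<tau>) (at \<tau> within {0..T})"
    if "y \<in> {-R..R}" "\<tau> \<in> {0..T}" for y \<tau>
    unfolding B_def Bt_def
    by (rule DERIV_mult[OF DERIV_minus[OF DERIV_chain'[OF dWt[OF that] DERIV_min_0_cube]] d\<psi>t])
  define I where "I \<tau> = integral {-R..R} (\<lambda>y. G y \<tau>)" for \<tau>
  define N where "N \<tau> = integral {-R..R} (\<lambda>y. B y \<tau>)" for \<tau>
  define g where "g \<tau> = integral {-R..R} (\<lambda>y. \<delta> y \<tau>)" for \<tau>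
  have ig: "(\<lambda>y. X y \<tau>) integrable_on {-R..R}"
    if "continuous_on ?S (\<lambda>p. X (snd p) (fst p))" "\<tau> \<in> {0..T}" for X :: "real \<Rightarrow> real \<Rightarrow> real" and \<tau>
    using continuous_on_slices(1)[OF that] by (rule integrable_continuous_interval)
  have dI: "(I has_real_derivative integral {-R..R} (\<lambda>y. Gt y \<tau>)) (at \<tau> within {0..T})"
    if "\<tau> \<in> {0..T}" for \<tau>
    unfolding I_def by (rule integral_param_DERIV[OF cG cGt dG that])
  have dN: "(N has_real_derivative integral {-R..R} (\<lambda>y. Bt y \<tau>)) (at \<tau> within {0..T})"
    if "\<tau> \<in> {0..T}" for \<tau>
    unfolding N_def by (rule integral_param_DERIV[OF cB cBt dB that])
  have M0: "0 \<le> M" using M[of 0 0] T R by simp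
  have cg: "continuous_on {0..T} g"
    unfolding g_def using integral_continuous_on_param[of "{0..T}" "-R" R "\<lambda>\<tau> y. \<delta> y \<tau>"] cd
    by (simp add: case_prod_beta')
  have g0: "0 \<le> g \<tau>" if "\<tau> \<in> {0..T}" for \<tau>
    unfolding g_def by (rule integral_nonneg[OF ig[OF cd that]]) (rule d0)
  have I'_le: "integral {-R..R} (\<lambda>y. Gt y \<tau>) \<le> 2 * M * R\<^sup>2 * g \<tau>" if t: "\<tau> \<in> {0..T}" for \<tau>
  proof -
    have "((\<lambda>y. Hy y \<tau>) has_integral (H R \<tau> - H (-R) \<tau>)) {-R..R}"
      by (rule fundamental_theorem_of_calculus)
         (use R dH[OF _ t] in \<open>auto simp: has_real_derivative_iff_has_vector_derivative\<close>)
    moreover have "H R \<tau> = 0" "H (-R) \<tau> = 0"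
      using \<psi>bd[of \<tau> R] \<psi>bd[of \<tau> "-R"] t R by (simp_all add: H_def)
    ultimately have H0: "integral {-R..R} (\<lambda>y. Hy y \<tau>) = 0" by (simp add: integral_unique)
    have "integral {-R..R} (\<lambda>y. Gt y \<tau>) = integral {-R..R} (\<lambda>y. Gt y \<tau> + Hy y \<tau>)"
      using Henstock_Kurzweil_Integration.integral_add[OF ig[OF cGt t] ig[OF cHy t]] H0 by simp
    also have "\<dots> \<le> integral {-R..R} (\<lambda>y. 2 * M * R\<^sup>2 * \<delta> y \<tau>)"
    proof (rule integral_le)
      show "(\<lambda>y. Gt y \<tau> + Hy y \<tau>) integrable_on {-R..R}"
        by (rule integrable_add[OF ig[OF cGt t] ig[OF cHy t]])
      show "(\<lambda>y. 2 * M * R\<^sup>2 * \<delta> y \<tau>) integrable_on {-R..R}"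
        using ig[OF cd t] by (intro integrable_on_mult_right)
      fix y assume y: "y \<in> {-R..R}"
      let ?W = "?m (W y \<tau>)" and ?r = "?m (\<rho> y \<tau>)" and ?s = "y / sqrt (1 + y\<^sup>2)"
      \<comment> \<open>Three groups: the entropy inequality for \<open>E\<close> and
        \<open>Q\<close>, the near cancellation bounded by the defect, and the cone weight, whose
        decay in time at rate \<Lambda> absorbs the flux through its slope.\<close>
      have split: "Gt y \<tau> + Hy y \<tau> = (Et y \<tau> + Qy y \<tau>) * (?W\<^sup>2 * \<psi> y \<tau>)
         + 2 * (- ?W) * \<psi> y \<tau> * (E y \<tau> * (F y \<tau> - fk) - Q y \<tau> * (w y \<tau> - k * D' y))
         + 2 * ?r * ?W\<^sup>2 * (\<Lambda> * E y \<tau> + Q y \<tau> * ?s)"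
        unfolding Gt_def Hy_def by algebra
      have 1: "(Et y \<tau> + Qy y \<tau>) * (?W\<^sup>2 * \<psi> y \<tau>) \<le> 0"
        by (rule mult_nonpos_nonneg) (use pde[OF y t] \<psi>0 in auto)
      have s1: "\<bar>?s\<bar> \<le> 1"
      proof -
        have "\<bar>y\<bar> \<le> sqrt (1 + y\<^sup>2)" by (rule real_le_rsqrt) simp
        then show ?thesis using pos[of y] by (simp add: divide_le_eq)
      qed
      have "\<bar>Q y \<tau> * ?s\<bar> \<le> \<Lambda> * E y \<tau> * 1"
        unfolding abs_mult by (rule mult_mono[OF QE s1]) (use L E0 in auto)
      then have "0 \<le> \<Lambda> * E y \<tau> + Q y \<tau> * ?s" by (simp only: abs_le_iff) linarith
      then have 2: "2 * ?r * ?W\<^sup>2 * (\<Lambda> * E y \<tau> + Q y \<tau> * ?s) \<le> 0"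
        by (intro mult_nonpos_nonneg[OF mult_nonpos_nonneg]) auto
      have "2 * (- ?W) * \<psi> y \<tau> * (E y \<tau> * (F y \<tau> - fk) - Q y \<tau> * (w y \<tau> - k * D' y))
          \<le> 2 * (- ?W) * \<psi> y \<tau> * \<delta> y \<tau>"
        using \<psi>0 by (intro mult_left_mono defect[OF y t] mult_nonneg_nonneg) auto
      also have "\<dots> \<le> 2 * M * R\<^sup>2 * \<delta> y \<tau>"
        using M[OF y t] t \<psi>0 M0 by (intro mult_right_mono d0 mult_mono \<psi>R) auto
      finally show "Gt y \<tau> + Hy y \<tau> \<le> 2 * M * R\<^sup>2 * \<delta> y \<tau>" using 1 2 unfolding split by linarith
    qed
    also have "\<dots> = 2 * M * R\<^sup>2 * g \<tau>" by (simp add: g_def)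
    finally show ?thesis .
  qed
  have gint: "g integrable_on {0..\<tau>}" if "\<tau> \<in> {0..T}" for \<tau>
    using that by (intro integrable_continuous_interval continuous_on_subset[OF cg]) auto
  have I_le: "I \<tau> \<le> I 0 + 2 * M * R\<^sup>2 * integral {0..T} g" if t: "\<tau> \<in> {0..T}" for \<tau>
  proof -
    have "((\<lambda>\<sigma>. integral {-R..R} (\<lambda>y. Gt y \<sigma>)) has_integral (I \<tau> - I 0)) {0..\<tau>}"
    proof (rule fundamental_theorem_of_calculus)
      fix \<sigma> assume "\<sigma> \<in> {0..\<tau>}"
      then have "(I has_real_derivative integral {-R..R} (\<lambda>y. Gt y \<sigma>)) (at \<sigma> within {0..\<tau>})"
        using t by (intro has_field_derivative_subset[OF dI]) auto
      then show "(I has_vector_derivative integral {-R..R} (\<lambda>y. Gt y \<sigma>)) (at \<sigma> within {0..\<tau>})"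
        by (simp add: has_real_derivative_iff_has_vector_derivative)
    qed (use t in auto)
    moreover have "((\<lambda>\<sigma>. 2 * M * R\<^sup>2 * g \<sigma>) has_integral (2 * M * R\<^sup>2 * integral {0..\<tau>} g)) {0..\<tau>}"
      using gint[OF t] by (intro has_integral_mult_right integrable_integral)
    ultimately have "I \<tau> - I 0 \<le> 2 * M * R\<^sup>2 * integral {0..\<tau>} g"
      by (rule has_integral_le) (use I'_le t in auto)
    moreover have "integral {0..\<tau>} g \<le> integral {0..T} g"
      by (rule integral_subset_le) (use t T gint g0 in auto)
    then have "2 * M * R\<^sup>2 * integral {0..\<tau>} g \<le> 2 * M * R\<^sup>2 * integral {0..T} g"
      using M0 by (intro mult_left_mono) auto
    ultimately show ?thesis by linarith
  qed
  define C where "C = I 0 + 2 * M * R\<^sup>2 * integral {0..T} g"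
  have N'_le: "integral {-R..R} (\<lambda>y. Bt y \<tau>) \<le> 3 * \<Lambda> * C" if t: "\<tau> \<in> {0..T}" for \<tau>
  proof -
    have "integral {-R..R} (\<lambda>y. Bt y \<tau>) \<le> integral {-R..R} (\<lambda>y. 3 * \<Lambda> * G y \<tau>)"
    proof (rule integral_le)
      show "(\<lambda>y. Bt y \<tau>) integrable_on {-R..R}" by (rule ig[OF cBt t])
      show "(\<lambda>y. 3 * \<Lambda> * G y \<tau>) integrable_on {-R..R}"
        using ig[OF cG t] by (intro integrable_on_mult_right)
      fix y assume y: "y \<in> {-R..R}"
      let ?W = "?m (W y \<tau>)" and ?r = "?m (\<rho> y \<tau>)"
      \<comment> \<open>\<open>W\<close> decreases in time at the rate F - fk, which is at most
        \<Lambda> E; hence the growth of the cubic functional is controlled by \<open>G\<close>. The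
        weight contributes a term of the right sign.\<close>
      have "Bt y \<tau> = 3 * (?W\<^sup>2 * \<psi> y \<tau>) * (F y \<tau> - fk) + 2 * (?r * ((- ?W) ^ 3 * \<Lambda>))"
        unfolding Bt_def by (simp add: algebra_simps power3_eq_cube)
      moreover have "?r * ((- ?W) ^ 3 * \<Lambda>) \<le> 0"
        using L by (intro mult_nonpos_nonneg mult_nonneg_nonneg zero_le_power) auto
      moreover have "3 * (?W\<^sup>2 * \<psi> y \<tau>) * (F y \<tau> - fk) \<le> 3 * (?W\<^sup>2 * \<psi> y \<tau>) * (\<Lambda> * E y \<tau>)"
        using \<psi>0 by (intro mult_left_mono FE mult_nonneg_nonneg) auto
      moreover have "3 * (?W\<^sup>2 * \<psi> y \<tau>) * (\<Lambda> * E y \<tau>) = 3 * \<Lambda> * G y \<tau>"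
        by (simp add: G_def)
      ultimately show "Bt y \<tau> \<le> 3 * \<Lambda> * G y \<tau>" by linarith
    qed
    also have "\<dots> = 3 * \<Lambda> * I \<tau>" by (simp add: I_def)
    also have "\<dots> \<le> 3 * \<Lambda> * C" unfolding C_def using L by (intro mult_left_mono I_le[OF t]) auto
    finally show ?thesis .
  qed
  have "((\<lambda>\<sigma>. integral {-R..R} (\<lambda>y. Bt y \<sigma>)) has_integral (N T - N 0)) {0..T}"
    by (rule fundamental_theorem_of_calculus)
       (use T dN in \<open>auto simp: has_real_derivative_iff_has_vector_derivative\<close>)
  moreover have "((\<lambda>\<sigma>. 3 * \<Lambda> * C) has_integral (T *\<^sub>R (3 * \<Lambda> * C))) {0..T}"
    using has_integral_const_real[of "3 * \<Lambda> * C" 0 T] T by simp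
  ultimately have "N T - N 0 \<le> T *\<^sub>R (3 * \<Lambda> * C)"
    by (rule has_integral_le) (use N'_le in auto)
  then show ?thesis
    unfolding N_def B_def C_def I_def G_def g_def[abs_def] by (simp add: algebra_simps)
qed

section \<open>Mollified entropy inequalities\<close>

text \<open>The assumption \<open>entropy\<close> is the Kruzhkov inequality tested with the
  translated kernel: by the sign rule for \<open>conv\<close> it says that the \<tau>-derivative of
  the mollified entropy plus the y-derivative of the mollified flux is at most 0.\<close>

locale approx_law = mollifier +
  fixes f :: "real \<Rightarrow> real" and w :: "real \<times> real \<Rightarrow> real" and K \<Lambda> :: real
  assumes w_meas [measurable]: "w \<in> borel_measurable borel"
    and w_bd: "\<And>z. \<bar>w z\<bar> \<le> K"
    and f_cont: "continuous_on UNIV f"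
    and f_even: "\<And>x. f (- x) = f x"
    and f_mono: "\<And>x y. 0 \<le> x \<Longrightarrow> x \<le> y \<Longrightarrow> f x \<le> f y"
    and f_lip: "\<And>x y. \<bar>x\<bar> \<le> K \<Longrightarrow> \<bar>y\<bar> \<le> K \<Longrightarrow> \<bar>f x - f y\<bar> \<le> \<Lambda> * \<bar>x - y\<bar>"
    and Lam: "0 \<le> \<Lambda>"
    and entropy: "\<And>k y \<tau>. 0 \<le> \<tau> \<Longrightarrow>
      0 \<le> conv j j1 (\<lambda>z. \<bar>w z - k\<bar>) y \<tau> + conv j1 j (\<lambda>z. sgn (w z - k) * (f (w z) - f k)) y \<tau>"
begin

lemma K_nonneg: "0 \<le> K"
  using w_bd[of undefined] by (meson abs_ge_zero order_trans)

lemma f_meas [measurable]: "f \<in> borel_measurable borel"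
  using f_cont by (rule borel_measurable_continuous_onI)

lemma f_abs: "f \<bar>x\<bar> = f x"
  by (simp add: abs_if f_even)

lemma f_bounded: "\<bar>x\<bar> \<le> M \<Longrightarrow> \<bar>f x\<bar> \<le> \<bar>f 0\<bar> + \<bar>f M\<bar>"
  using f_mono[of 0 "\<bar>x\<bar>"] f_mono[of "\<bar>x\<bar>" M] f_abs[of x] by auto

lemma comp_w_measurable: "G \<in> borel_measurable borel \<Longrightarrow> (\<lambda>z. G (w z)) \<in> borel_measurable borel"
  by (rule measurable_compose[OF w_meas])

text \<open>The mollification of a constant is that constant, so the differentiated kernel
  integrates to 0.\<close>

lemma conv_deriv_const: "conv j j1 (\<lambda>z. c) y \<tau> = 0" "conv j1 j (\<lambda>z. c) y \<tau> = 0"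
proof -
  have "((\<lambda>\<tau>. moll (\<lambda>z. c) y \<tau>) has_real_derivative - conv j j1 (\<lambda>z. c) y \<tau>) (at \<tau>)"
    by (rule conv_has_derivative_snd[OF bump_j bump_j1 bump_j _ _ j_deriv, where M = "\<bar>c\<bar>"]) auto
  moreover have "((\<lambda>\<tau>. moll (\<lambda>z. c) y \<tau>) has_real_derivative 0) (at \<tau>)" by (simp add: moll_const)
  ultimately show "conv j j1 (\<lambda>z. c) y \<tau> = 0" using DERIV_unique by fastforce
  have "((\<lambda>y. moll (\<lambda>z. c) y \<tau>) has_real_derivative - conv j1 j (\<lambda>z. c) y \<tau>) (at y)"
    by (rule conv_has_derivative_fst[OF bump_j bump_j1 bump_j _ _ j_deriv, where M = "\<bar>c\<bar>"]) auto
  moreover have "((\<lambda>y. moll (\<lambda>z. c) y \<tau>) has_real_derivative 0) (at y)" by (simp add: moll_const)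
  ultimately show "conv j1 j (\<lambda>z. c) y \<tau> = 0" using DERIV_unique by fastforce
qed

lemma fw_bd: "\<bar>f (w z)\<bar> \<le> \<bar>f 0\<bar> + \<bar>f K\<bar>"
  by (rule f_bounded[OF w_bd])

text \<open>For k beyond the range of \<open>w\<close> the entropy |w - k| is affine in
  \<open>w\<close>. The choices K + 1 and -(K + 1) give opposite inequalities, hence
  equality.\<close>

lemma conservation:
  assumes "0 \<le> \<tau>"
  shows "conv j j1 w y \<tau> + conv j1 j (\<lambda>z. f (w z)) y \<tau> = 0"
proof -
  define k where "k = K + 1"
  have s: "sgn (w z - k) = -1" "sgn (w z + k) = 1" "\<bar>w z - k\<bar> = k - w z" "\<bar>w z + k\<bar> = k + w z" for z
  proof -
    have "- K \<le> w z" "w z \<le> K" using w_bd[of z] by (simp_all add: abs_le_iff)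
    then show "sgn (w z - k) = -1" "sgn (w z + k) = 1" "\<bar>w z - k\<bar> = k - w z" "\<bar>w z + k\<bar> = k + w z"
      using K_nonneg by (auto simp: k_def)
  qed
  note aff = conv_affine[OF bump_j bump_j1 w_meas w_bd, of "\<lambda>z. k" "\<bar>k\<bar>"]
    conv_affine[OF bump_j1 bump_j comp_w_measurable[OF f_meas] fw_bd, of "\<lambda>z. f k" "\<bar>f k\<bar>"]
  have "0 \<le> conv j j1 (\<lambda>z. -1 * w z + 1 * k) y \<tau> + conv j1 j (\<lambda>z. -1 * f (w z) + 1 * f k) y \<tau>"
    using entropy[OF assms, of k y] s by simp
  moreover have "0 \<le> conv j j1 (\<lambda>z. 1 * w z + 1 * k) y \<tau> + conv j1 j (\<lambda>z. 1 * f (w z) + -1 * f k) y \<tau>"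
    using entropy[OF assms, of "- k" y] s by (simp add: f_even add.commute)
  ultimately show ?thesis
    unfolding aff[OF borel_measurable_const order_refl] by (simp add: conv_deriv_const)
qed

text \<open>The mean of the Kruzhkov entropies at k and -k, lowered by k so that it vanishes for |v|
  \<le> k; \<open>Q\<close> is the mean of the two fluxes, simplified by f (-k) = f k.\<close>

definition E :: "real \<Rightarrow> real \<Rightarrow> real" where
  "E k v = max (\<bar>v\<bar> - k) 0"

definition Q :: "real \<Rightarrow> real \<Rightarrow> real" where
  "Q k v = f (max v k) - f (min v (- k))"

lemma E_eq: "0 \<le> k \<Longrightarrow> E k v = (\<bar>v - k\<bar> + \<bar>v - (- k)\<bar>) / 2 - k"
  by (auto simp: E_def abs_if max_def)

lemma Q_eq: "0 \<le> k \<Longrightarrow>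
  Q k v = (sgn (v - k) * (f v - f k) + sgn (v - (- k)) * (f v - f (- k))) / 2"
  by (auto simp: Q_def sgn_if max_def min_def f_even simp flip: eq_neg_iff_add_eq_0)

lemma Q_cases: "0 \<le> k \<Longrightarrow> Q k v = (if k < v then f v - f k else if v < - k then - (f v - f k) else 0)"
  by (auto simp: Q_def max_def min_def f_even)

lemma E_lip: "\<bar>E k x - E k y\<bar> \<le> \<bar>x - y\<bar>"
  by (auto simp: E_def max_def abs_if)

lemma Q_lip:
  assumes "0 \<le> k" "k \<le> K" "\<bar>x\<bar> \<le> K" "\<bar>y\<bar> \<le> K"
  shows "\<bar>Q k x - Q k y\<bar> \<le> 2 * \<Lambda> * \<bar>x - y\<bar>"
proof -
  have "\<bar>f (max x k) - f (max y k)\<bar> \<le> \<Lambda> * \<bar>max x k - max y k\<bar>"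
    by (rule f_lip) (use assms in auto)
  also have "\<dots> \<le> \<Lambda> * \<bar>x - y\<bar>" by (rule mult_left_mono[OF _ Lam]) (auto simp: max_def)
  finally have 1: "\<bar>f (max x k) - f (max y k)\<bar> \<le> \<Lambda> * \<bar>x - y\<bar>" .
  have "\<bar>f (min x (- k)) - f (min y (- k))\<bar> \<le> \<Lambda> * \<bar>min x (- k) - min y (- k)\<bar>"
    by (rule f_lip) (use assms in auto)
  also have "\<dots> \<le> \<Lambda> * \<bar>x - y\<bar>" by (rule mult_left_mono[OF _ Lam]) (auto simp: min_def)
  finally show ?thesis using 1 unfolding Q_def by linarith
qed

text \<open>Evenness reduces both to the Lipschitz bound between |v| and k. The second bound is
  one-sided: for |v| \<le> k monotonicity makes f v - f k nonpositive, while \<open>E\<close>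
  vanishes there.\<close>

lemma Q_le_E:
  assumes "0 \<le> k" "k \<le> K" "\<bar>v\<bar> \<le> K"
  shows "\<bar>Q k v\<bar> \<le> \<Lambda> * E k v" "f v - f k \<le> \<Lambda> * E k v"
proof -
  have 1: "\<bar>f v - f k\<bar> \<le> \<Lambda> * E k v" if "k < \<bar>v\<bar>"
  proof -
    have "\<bar>f \<bar>v\<bar> - f k\<bar> \<le> \<Lambda> * \<bar>\<bar>v\<bar> - k\<bar>" by (rule f_lip) (use assms in auto)
    then show ?thesis using that by (simp add: f_abs E_def)
  qed
  have E0: "0 \<le> \<Lambda> * E k v" using Lam by (simp add: E_def)
  show "\<bar>Q k v\<bar> \<le> \<Lambda> * E k v" using 1 E0 assms by (auto simp: Q_cases abs_minus_commute)
  show "f v - f k \<le> \<Lambda> * E k v"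
  proof (cases "k < \<bar>v\<bar>")
    case True
    then show ?thesis using 1 by linarith
  next
    case False
    then have "f v \<le> f k" using f_mono[of "\<bar>v\<bar>" k] by (simp add: f_abs)
    then show ?thesis using E0 by linarith
  qed
qed

text \<open>For v > k the factor f v - f k is nonnegative and r \<le> k, so v - k may be replaced by
  the larger v - r; the case v < -k is the mirror image, and between them both sides vanish. Here r
  stands for the slope k D' of the comparison function.\<close>

lemma EQ_sign:
  assumes "0 \<le> k" "\<bar>r\<bar> \<le> k"
  shows "E k v * (f v - f k) \<le> Q k v * (v - r)"
proof -
  consider "k < v" | "v < - k" | "\<bar>v\<bar> \<le> k" by linarith
  then show ?thesis
  proof cases
    case 1
    then have "f k \<le> f v" using assms f_mono by auto
    then have "(f v - f k) * (v - k) \<le> (f v - f k) * (v - r)" using assms by (intro mult_left_mono) auto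
    then show ?thesis using 1 assms by (simp add: Q_cases E_def mult.commute)
  next
    case 2
    then have "f k \<le> f v" using assms f_mono[of k "\<bar>v\<bar>"] by (simp add: f_abs f_even)
    then have "(f v - f k) * (- v - k) \<le> (f v - f k) * (- v + r)" using assms by (intro mult_left_mono) auto
    then show ?thesis using 2 assms by (simp add: Q_cases E_def algebra_simps)
  next
    case 3
    then show ?thesis using assms by (simp add: Q_cases E_def)
  qed
qed

lemma E_range: "0 \<le> k \<Longrightarrow> \<bar>v\<bar> \<le> K \<Longrightarrow> 0 \<le> E k v \<and> E k v \<le> K"
  using K_nonneg by (auto simp: E_def)

lemma E_cont: "continuous_on UNIV (E k)"
  unfolding E_def by (intro continuous_intros)

lemma Q_cont: "continuous_on UNIV (Q k)"
  unfolding Q_def by (intro continuous_intros continuous_on_compose2[OF f_cont]) auto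

lemma Ew_meas: "(\<lambda>z. E k (w z)) \<in> borel_measurable borel"
  by (rule comp_w_measurable[OF borel_measurable_continuous_onI[OF E_cont]])

lemma Qw_meas: "(\<lambda>z. Q k (w z)) \<in> borel_measurable borel"
  by (rule comp_w_measurable[OF borel_measurable_continuous_onI[OF Q_cont]])

lemma Ew_bd: "0 \<le> k \<Longrightarrow> \<bar>E k (w z)\<bar> \<le> K"
  using E_range[OF _ w_bd] by auto

lemma Qw_bd: "0 \<le> k \<Longrightarrow> k \<le> K \<Longrightarrow> \<bar>Q k (w z)\<bar> \<le> \<Lambda> * K"
  using Q_le_E(1)[OF _ _ w_bd] mult_left_mono[OF conjunct2[OF E_range[OF _ w_bd]] Lam] by (meson order_trans)

text \<open>Average of the inequalities at k and -k; the constant subtracted in \<open>E\<close>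
  disappears under the differentiated kernel.\<close>

lemma symmetric_entropy:
  assumes "0 \<le> \<tau>" "0 \<le> k"
  shows "0 \<le> conv j j1 (\<lambda>z. E k (w z)) y \<tau> + conv j1 j (\<lambda>z. Q k (w z)) y \<tau>"
proof -
  let ?E = "\<lambda>k z. \<bar>w z - k\<bar>" and ?Q = "\<lambda>k z. sgn (w z - k) * (f (w z) - f k)"
  have Em: "?E k \<in> borel_measurable borel" for k by measurable
  have Qm: "?Q k \<in> borel_measurable borel" for k by measurable
  have Eb: "\<bar>?E k z\<bar> \<le> K + \<bar>k\<bar>" for k z using w_bd[of z] by simp
  have Qb: "\<bar>?Q k z\<bar> \<le> \<bar>f 0\<bar> + \<bar>f K\<bar> + \<bar>f k\<bar>" for k z
  proof -
    have "\<bar>?Q k z\<bar> \<le> \<bar>f (w z) - f k\<bar>" by (simp add: abs_mult abs_sgn_eq)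
    then show ?thesis using fw_bd[of z] by linarith
  qed
  have "conv j j1 (\<lambda>z. E k (w z)) y \<tau> = conv j j1 (\<lambda>z. (1/2) * (1 * ?E k z + 1 * ?E (- k) z) + (-1) * k) y \<tau>"
    using assms(2) by (simp add: E_eq)
  also have "\<dots> = (1/2) * conv j j1 (\<lambda>z. 1 * ?E k z + 1 * ?E (- k) z) y \<tau> + (-1) * conv j j1 (\<lambda>z. k) y \<tau>"
  proof (rule conv_affine[OF bump_j bump_j1])
    show "(\<lambda>z. 1 * ?E k z + 1 * ?E (- k) z) \<in> borel_measurable borel" using Em[of k] Em[of "- k"] by simp
    show "\<bar>1 * ?E k z + 1 * ?E (- k) z\<bar> \<le> 2 * (K + \<bar>k\<bar>)" for z using Eb[where k = k and z = z] Eb[where k = "- k" and z = z] by simp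
  qed auto
  also have "conv j j1 (\<lambda>z. 1 * ?E k z + 1 * ?E (- k) z) y \<tau> = 1 * conv j j1 (?E k) y \<tau> + 1 * conv j j1 (?E (- k)) y \<tau>"
    by (rule conv_affine[OF bump_j bump_j1 Em Eb Em Eb])
  finally have 1: "conv j j1 (\<lambda>z. E k (w z)) y \<tau> = (conv j j1 (?E k) y \<tau> + conv j j1 (?E (- k)) y \<tau>) / 2"
    by (simp add: conv_deriv_const)
  have "conv j1 j (\<lambda>z. Q k (w z)) y \<tau> = conv j1 j (\<lambda>z. (1/2) * ?Q k z + (1/2) * ?Q (- k) z) y \<tau>"
    using assms(2) by (simp add: Q_eq add_divide_distrib)
  also have "\<dots> = (1/2) * conv j1 j (?Q k) y \<tau> + (1/2) * conv j1 j (?Q (- k)) y \<tau>"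
    by (rule conv_affine[OF bump_j1 bump_j Qm Qb Qm Qb])
  finally show ?thesis using 1 entropy[OF assms(1), of k y] entropy[OF assms(1), of "- k" y] by simp
qed

text \<open>Mollification does not commute with products, so each factor of a product is compared
  with a value at one common point: \<open>G\<close> at the continuous approximant
  \<open>w'\<close>. The error is the oscillation of \<open>w'\<close> plus the mollified distance
  of \<open>w\<close> to \<open>w'\<close>, which is small in the mean.\<close>

lemma moll_close:
  assumes Gm: "(\<lambda>z. G (w z)) \<in> borel_measurable borel"
    and lip: "\<And>x y. \<bar>x\<bar> \<le> K \<Longrightarrow> \<bar>y\<bar> \<le> K \<Longrightarrow> \<bar>G x - G y\<bar> \<le> C * \<bar>x - y\<bar>" and C: "0 \<le> C"
    and w': "w' \<in> borel_measurable borel" "\<And>z. \<bar>w' z\<bar> \<le> K"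
    and osc: "\<And>x t. e \<le> x - y \<Longrightarrow> x - y \<le> 2 * e \<Longrightarrow> e \<le> t - \<tau> \<Longrightarrow> t - \<tau> \<le> 2 * e
      \<Longrightarrow> \<bar>w' (x, t) - w' (y, \<tau>)\<bar> \<le> \<eta>"
  shows "\<bar>moll (\<lambda>z. G (w z)) y \<tau> - G (w' (y, \<tau>))\<bar> \<le> C * (moll (\<lambda>z. \<bar>w z - w' z\<bar>) y \<tau> + \<eta>)"
proof -
  define G0 where "G0 = G (w' (y, \<tau>))"
  have "\<bar>G x\<bar> \<le> \<bar>G 0\<bar> + C * K" if "\<bar>x\<bar> \<le> K" for x
    using lip[OF that, of 0] mult_left_mono[OF that C] K_nonneg by simp
  then have Gb: "\<bar>G (w z)\<bar> \<le> \<bar>G 0\<bar> + C * K" for z using w_bd by blast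
  have dm: "(\<lambda>z. \<bar>w z - w' z\<bar>) \<in> borel_measurable borel" using w' by measurable
  have db: "\<bar>\<bar>w z - w' z\<bar>\<bar> \<le> 2 * K" for z using w_bd[of z] w'(2)[of z] by simp
  \<comment> \<open>The factor s turns one formula into the upper barrier (s = C) and the lower one
    (s = - C).\<close>
  let ?h = "\<lambda>s z. s * \<bar>w z - w' z\<bar> + 1 * (G0 + s * \<eta>)"
  have hm: "(\<lambda>z. ?h s z) \<in> borel_measurable borel" for s using dm by measurable
  have hb: "\<bar>?h s z\<bar> \<le> \<bar>s\<bar> * (2 * K) + \<bar>G0 + s * \<eta>\<bar>" for s z
  proof -
    have "\<bar>s * \<bar>w z - w' z\<bar>\<bar> \<le> \<bar>s\<bar> * (2 * K)"
      unfolding abs_mult using db by (intro mult_left_mono) auto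
    then show ?thesis using abs_triangle_ineq[of "s * \<bar>w z - w' z\<bar>" "G0 + s * \<eta>"] by simp
  qed
  have he: "moll (\<lambda>z. ?h s z) y \<tau> = s * moll (\<lambda>z. \<bar>w z - w' z\<bar>) y \<tau> + 1 * moll (\<lambda>z. G0 + s * \<eta>) y \<tau>" for s
    by (rule conv_affine[OF bump_j bump_j dm db borel_measurable_const order_refl])
  have pt: "\<bar>G (w (x, t)) - G0\<bar> \<le> C * (\<bar>w (x, t) - w' (x, t)\<bar> + \<eta>)"
    if "e \<le> x - y" "x - y \<le> 2 * e" "e \<le> t - \<tau>" "t - \<tau> \<le> 2 * e" for x t
  proof -
    have "\<bar>G (w (x, t)) - G0\<bar> \<le> C * \<bar>w (x, t) - w' (y, \<tau>)\<bar>"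
      unfolding G0_def by (rule lip[OF w_bd w'(2)])
    also have "\<dots> \<le> C * (\<bar>w (x, t) - w' (x, t)\<bar> + \<eta>)"
      using osc[OF that] by (intro mult_left_mono[OF _ C]) linarith
    finally show ?thesis .
  qed
  have "moll (\<lambda>z. G (w z)) y \<tau> \<le> moll (\<lambda>z. ?h C z) y \<tau>"
    by (rule moll_mono[OF Gm Gb hm hb]) (use pt in \<open>fastforce simp: abs_le_iff algebra_simps\<close>)
  moreover have "moll (\<lambda>z. ?h (- C) z) y \<tau> \<le> moll (\<lambda>z. G (w z)) y \<tau>"
    by (rule moll_mono[OF hm hb Gm Gb]) (use pt in \<open>fastforce simp: abs_le_iff algebra_simps\<close>)
  ultimately show ?thesis unfolding he moll_const G0_def[symmetric] by (simp add: abs_le_iff algebra_simps)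
qed

end

section \<open>Potentials of mollified entropy solutions\<close>

lemma integral_Icc_le:
  fixes F :: "real \<Rightarrow> real"
  assumes "0 \<le> R" "continuous_on {-R..R} F" "\<And>y. y \<in> {-R..R} \<Longrightarrow> F y \<le> c"
  shows "integral {-R..R} F \<le> 2 * R * c"
proof -
  have "integral {-R..R} F \<le> integral {-R..R} (\<lambda>y. c)"
    by (rule integral_le) (use assms in \<open>auto intro: integrable_continuous_interval\<close>)
  then show ?thesis using assms(1) by simp
qed

context approx_law
begin

text \<open>A primitive of the field with components \<open>moll w\<close> in y and minus the
  mollified flux in time, integrated along y at time 0 and then along time. The base point -R
  depends on the cutoff radius, so the potential starts at 0 at the left end of the region
  considered.\<close>

definition pot :: "real \<Rightarrow> real \<Rightarrow> real \<Rightarrow> real" where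
  "pot R y \<tau> = integral {-R..y} (\<lambda>z. moll w z 0) - integral {0..\<tau>} (\<lambda>\<sigma>. moll (\<lambda>z. f (w z)) y \<sigma>)"

lemma conv_cont:
  fixes g :: "real \<times> real \<Rightarrow> real"
  assumes "bump_on e a" "bump_on e b" and g: "g \<in> borel_measurable borel" "\<And>z. \<bar>g z\<bar> \<le> M"
  shows "continuous_on S (\<lambda>p. conv a b g (snd p) (fst p))"
proof -
  have "continuous_on UNIV (\<lambda>p. conv a b g (fst p) (snd p))"
    using conv_continuous[OF assms] by (simp add: case_prod_beta')
  then have "continuous_on S (\<lambda>p. conv a b g (fst (snd p, fst p)) (snd (snd p, fst p)))"
    by (rule continuous_on_compose2) (auto intro!: continuous_intros)
  then show ?thesis by simp
qed

abbreviation fw :: "real \<times> real \<Rightarrow> real" where "fw \<equiv> \<lambda>z. f (w z)"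

lemma fw_meas: "fw \<in> borel_measurable borel"
  by (rule comp_w_measurable[OF f_meas])

lemma fw_moll_bd: "\<bar>moll fw y \<tau>\<bar> \<le> \<bar>f 0\<bar> + \<bar>f K\<bar>"
  by (rule moll_abs_bound[OF fw_meas fw_bd])

lemma moll_w_bd: "\<bar>moll w y \<tau>\<bar> \<le> K"
  by (rule moll_abs_bound[OF w_meas w_bd])

lemmas moll_w_cont = conv_cont[OF bump_j bump_j w_meas w_bd]
lemmas moll_fw_cont = conv_cont[OF bump_j bump_j fw_meas fw_bd]

lemma pot_deriv_t:
  assumes "\<tau> \<in> {0..T}"
  shows "((\<lambda>\<tau>. pot R y \<tau>) has_real_derivative - moll fw y \<tau>) (at \<tau> within {0..T})"
proof -
  have "continuous_on {0..T} (\<lambda>\<sigma>. moll fw y \<sigma>)"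
    by (rule continuous_on_slices(2)[OF moll_fw_cont[of "{0..T} \<times> UNIV"]]) simp
  from integral_has_real_derivative[OF this assms] show ?thesis
    unfolding pot_def by (auto intro!: derivative_eq_intros)
qed

text \<open>Differentiating the time integral puts the y-derivative on the flux; conservation turns
  it into a time derivative of \<open>moll w\<close>, which integrates from its value at time 0 to
  that at \<tau>.\<close>

lemma pot_deriv_y:
  assumes y: "y \<in> {-R..R}" and \<tau>: "0 \<le> \<tau>"
  shows "((\<lambda>y. pot R y \<tau>) has_real_derivative moll w y \<tau>) (at y within {-R..R})"
proof -
  have c: "continuous_on {-R..R} (\<lambda>z. moll w z 0)"
    by (rule continuous_on_slices(1)[OF moll_w_cont[of "UNIV \<times> {-R..R}"]]) simp
  have 1: "((\<lambda>y. integral {-R..y} (\<lambda>z. moll w z 0)) has_real_derivative moll w y 0) (at y within {-R..R})"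
    by (rule integral_has_real_derivative[OF c y])
  have 2: "((\<lambda>y. integral (cbox 0 \<tau>) (\<lambda>\<sigma>. moll fw y \<sigma>)) has_real_derivative
      integral (cbox 0 \<tau>) (\<lambda>\<sigma>. - conv j1 j fw y \<sigma>)) (at y within {-R..R})"
  proof (rule leibniz_rule_field_derivative)
    show "((\<lambda>y. moll fw y \<sigma>) has_real_derivative - conv j1 j fw y \<sigma>) (at y within {-R..R})" for y \<sigma>
      by (rule has_field_derivative_at_within)
         (rule conv_has_derivative_fst[OF bump_j bump_j1 bump_j fw_meas fw_bd j_deriv])
    show "(\<lambda>\<sigma>. moll fw y \<sigma>) integrable_on cbox 0 \<tau>" for y
      using integrable_continuous_interval[OF continuous_on_slices(2)[OF moll_fw_cont[of "{0..\<tau>} \<times> UNIV"]]] by simp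
    have "continuous_on UNIV (\<lambda>(y, \<sigma>). conv j1 j fw y \<sigma>)"
      by (rule conv_continuous[OF bump_j1 bump_j fw_meas fw_bd])
    then show "continuous_on ({-R..R} \<times> cbox 0 \<tau>) (\<lambda>(y, \<sigma>). - conv j1 j fw y \<sigma>)"
      unfolding case_prod_beta' by (intro continuous_on_minus) (rule continuous_on_subset, auto)
  qed (use y in auto)
  have "((\<lambda>\<sigma>. - conv j j1 w y \<sigma>) has_integral (moll w y \<tau> - moll w y 0)) {0..\<tau>}"
    using \<tau> conv_has_derivative_snd[OF bump_j bump_j1 bump_j w_meas w_bd j_deriv]
    by (intro fundamental_theorem_of_calculus)
       (auto simp: has_real_derivative_iff_has_vector_derivative intro: has_vector_derivative_at_within)
  then have "((\<lambda>\<sigma>. conv j1 j fw y \<sigma>) has_integral (moll w y \<tau> - moll w y 0)) {0..\<tau>}"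
  proof (rule has_integral_eq[rotated])
    fix \<sigma> assume "\<sigma> \<in> {0..\<tau>}"
    then show "- conv j j1 w y \<sigma> = conv j1 j fw y \<sigma>" using conservation[of \<sigma> y] by simp
  qed
  then have "integral (cbox 0 \<tau>) (\<lambda>\<sigma>. - conv j1 j fw y \<sigma>) = - (moll w y \<tau> - moll w y 0)"
    by (simp add: integral_unique)
  then have "moll w y 0 - integral (cbox 0 \<tau>) (\<lambda>\<sigma>. - conv j1 j fw y \<sigma>) = moll w y \<tau>" by simp
  from DERIV_cong[OF DERIV_diff[OF 1 2] this] show ?thesis unfolding pot_def by simp
qed

lemma pot_lip_y:
  assumes "y \<in> {-R..R}" "y' \<in> {-R..R}" "0 \<le> \<tau>"
  shows "\<bar>pot R y \<tau> - pot R y' \<tau>\<bar> \<le> K * \<bar>y - y'\<bar>"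
  using field_differentiable_bound[of "{-R..R}" "\<lambda>y. pot R y \<tau>" "\<lambda>y. moll w y \<tau>" K y y']
    pot_deriv_y moll_w_bd assms by auto

lemma pot_lip_t:
  assumes "\<tau> \<in> {0..T}" "\<tau>' \<in> {0..T}"
  shows "\<bar>pot R y \<tau> - pot R y \<tau>'\<bar> \<le> (\<bar>f 0\<bar> + \<bar>f K\<bar>) * \<bar>\<tau> - \<tau>'\<bar>"
  using field_differentiable_bound[of "{0..T}" "\<lambda>\<tau>. pot R y \<tau>" "\<lambda>\<tau>. - moll fw y \<tau>" "\<bar>f 0\<bar> + \<bar>f K\<bar>" \<tau> \<tau>']
    pot_deriv_t fw_moll_bd assms by auto

lemma pot_cont: "continuous_on ({0..T} \<times> {-R..R}) (\<lambda>p. pot R (snd p) (fst p))"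
proof (rule lipschitz_on_continuous_on[of "K + (\<bar>f 0\<bar> + \<bar>f K\<bar>)"], rule lipschitz_onI)
  fix p q assume p: "p \<in> {0..T} \<times> {-R..R}" and q: "q \<in> {0..T} \<times> {-R..R}"
  obtain \<tau> y \<tau>' y' where pq: "p = (\<tau>, y)" "q = (\<tau>', y')" by (cases p; cases q)
  have "\<bar>pot R y \<tau> - pot R y' \<tau>\<bar> \<le> K * \<bar>y - y'\<bar>" by (rule pot_lip_y) (use p q pq in auto)
  also have "\<dots> \<le> K * dist p q"
    using dist_snd_le[of p q] K_nonneg by (intro mult_left_mono) (auto simp: pq dist_real_def)
  finally have 1: "\<bar>pot R y \<tau> - pot R y' \<tau>\<bar> \<le> K * dist p q" .
  have "\<bar>pot R y' \<tau> - pot R y' \<tau>'\<bar> \<le> (\<bar>f 0\<bar> + \<bar>f K\<bar>) * \<bar>\<tau> - \<tau>'\<bar>"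
    by (rule pot_lip_t) (use p q pq in auto)
  also have "\<dots> \<le> (\<bar>f 0\<bar> + \<bar>f K\<bar>) * dist p q"
    using dist_fst_le[of p q] by (intro mult_left_mono) (auto simp: pq dist_real_def)
  finally show "dist (pot R (snd p) (fst p)) (pot R (snd q) (fst q)) \<le> (K + (\<bar>f 0\<bar> + \<bar>f K\<bar>)) * dist p q"
    using 1 by (simp add: pq dist_real_def algebra_simps)
qed (use K_nonneg in auto)

text \<open>Along a line of speed \<kappa> the potential changes at the rate \<kappa> v - f v,
  averaged by the mollifier, and the bound c for this rate is preserved by averaging.\<close>

lemma pot_upper:
  assumes t: "0 \<le> t" and x: "x \<in> {-R..R}" "x - \<kappa> * t \<in> {-R..R}"
    and young: "\<And>v. \<bar>v\<bar> \<le> K \<Longrightarrow> \<kappa> * v - f v \<le> c"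
  shows "pot R x t \<le> pot R (x - \<kappa> * t) 0 + c * t"
proof -
  define h where "h \<sigma> = pot R (x - \<kappa> * (t - \<sigma>)) \<sigma>" for \<sigma>
  have path: "x - \<kappa> * (t - \<sigma>) \<in> {-R..R}" if "\<sigma> \<in> {0..t}" for \<sigma>
  proof (cases "0 \<le> \<kappa>")
    case True
    then have "\<kappa> * (t - \<sigma>) \<le> \<kappa> * t" "0 \<le> \<kappa> * (t - \<sigma>)" using that by (auto intro: mult_left_mono)
    then show ?thesis using x by auto
  next
    case False
    then have "\<kappa> * t \<le> \<kappa> * (t - \<sigma>)" "\<kappa> * (t - \<sigma>) \<le> 0"
      using that by (auto intro!: mult_left_mono_neg simp: mult_le_0_iff)
    then show ?thesis using x by auto
  qed
  have dh: "(h has_real_derivative (\<kappa> * moll w (x - \<kappa> * (t - \<sigma>)) \<sigma> - moll fw (x - \<kappa> * (t - \<sigma>)) \<sigma>)) (at \<sigma> within {0..t})"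
    if s: "\<sigma> \<in> {0..t}" for \<sigma>
  proof -
    let ?y = "x - \<kappa> * (t - \<sigma>)"
    \<comment> \<open>The chain rule along the line needs a joint derivative; it comes from the two
      partial ones because the time derivative is jointly continuous.\<close>
    have "((\<lambda>(y, \<tau>). pot R y \<tau>) has_derivative
        (\<lambda>(ty, tt). (*) (moll w ?y \<sigma>) ty + blinfun_mult_right (- moll fw ?y \<sigma>) tt)) (at (?y, \<sigma>) within {-R..R} \<times> {0..t})"
    proof (rule has_derivative_partialsI)
      show "((\<lambda>y. pot R y \<sigma>) has_derivative (*) (moll w ?y \<sigma>)) (at ?y within {-R..R})"
        using pot_deriv_y[OF path[OF s]] s by (simp add: has_field_derivative_def)
      show "((\<lambda>\<tau>. pot R y \<tau>) has_derivative blinfun_apply (blinfun_mult_right (- moll fw y \<tau>))) (at \<tau> within {0..t})"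
        if "\<tau> \<in> {0..t}" for y \<tau>
        using pot_deriv_t[OF that] by (simp add: has_field_derivative_def)
      have "continuous_on UNIV (\<lambda>(y, \<sigma>). moll fw y \<sigma>)"
        by (rule moll_continuous[OF fw_meas fw_bd])
      then have "continuous_on UNIV (\<lambda>(y, \<tau>). blinfun_mult_right (- moll fw y \<tau>))"
        unfolding case_prod_beta' by (intro continuous_intros bounded_linear.continuous_on[OF bounded_linear_blinfun_mult_right])
      then show "continuous (at (?y, \<sigma>) within {-R..R} \<times> {0..t}) (\<lambda>(y, \<tau>). blinfun_mult_right (- moll fw y \<tau>))"
        by (simp add: continuous_on_eq_continuous_at continuous_at_imp_continuous_at_within)
    qed (use s in auto)
    then have pd: "((\<lambda>(y, \<tau>). pot R y \<tau>) has_derivative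
        (\<lambda>(ty, tt). (*) (moll w ?y \<sigma>) ty + blinfun_mult_right (- moll fw ?y \<sigma>) tt))
        (at (x - \<kappa> * (t - \<sigma>), \<sigma>) within (\<lambda>\<sigma>. (x - \<kappa> * (t - \<sigma>), \<sigma>)) ` {0..t})"
      by (rule has_derivative_subset) (use path in auto)
    have "((\<lambda>\<sigma>. (x - \<kappa> * (t - \<sigma>), \<sigma>)) has_derivative (\<lambda>d. (\<kappa> * d, d))) (at \<sigma> within {0..t})"
      by (auto intro!: derivative_eq_intros)
    from has_derivative_in_compose[OF this pd]
    have "((\<lambda>\<sigma>. pot R (x - \<kappa> * (t - \<sigma>)) \<sigma>) has_derivative
        (\<lambda>d. moll w ?y \<sigma> * (\<kappa> * d) + - moll fw ?y \<sigma> * d)) (at \<sigma> within {0..t})"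
      by simp
    then show ?thesis unfolding h_def has_field_derivative_def
      by (rule has_derivative_eq_rhs) (auto simp: algebra_simps)
  qed
  have pt: "\<kappa> * moll w y \<sigma> - moll fw y \<sigma> \<le> c" for y \<sigma>
  proof -
    have m: "(\<lambda>z. \<kappa> * w z + (-1) * f (w z)) \<in> borel_measurable borel" using w_meas fw_meas by measurable
    have b: "\<bar>\<kappa> * w z + (-1) * f (w z)\<bar> \<le> \<bar>\<kappa>\<bar> * K + (\<bar>f 0\<bar> + \<bar>f K\<bar>)" for z
    proof -
      have "\<bar>\<kappa> * w z\<bar> \<le> \<bar>\<kappa>\<bar> * K" unfolding abs_mult by (intro mult_left_mono w_bd) simp
      then show ?thesis using fw_bd[of z] by linarith
    qed
    have "\<kappa> * moll w y \<sigma> + (-1) * moll fw y \<sigma> = moll (\<lambda>z. \<kappa> * w z + (-1) * f (w z)) y \<sigma>"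
      by (rule conv_affine[symmetric, OF bump_j bump_j w_meas w_bd fw_meas fw_bd])
    also have "\<dots> \<le> moll (\<lambda>z. c) y \<sigma>"
      by (rule moll_mono[OF m b borel_measurable_const order_refl]) (use young[OF w_bd] in auto)
    finally show ?thesis by (simp add: moll_const)
  qed
  have "((\<lambda>\<sigma>. \<kappa> * moll w (x - \<kappa> * (t - \<sigma>)) \<sigma> - moll fw (x - \<kappa> * (t - \<sigma>)) \<sigma>) has_integral (h t - h 0)) {0..t}"
    by (rule fundamental_theorem_of_calculus)
       (use t dh in \<open>auto simp: has_real_derivative_iff_has_vector_derivative\<close>)
  moreover have "((\<lambda>\<sigma>. c) has_integral (t *\<^sub>R c)) {0..t}"
    using has_integral_const_real[of c 0 t] t by simp
  ultimately have "h t - h 0 \<le> t *\<^sub>R c" by (rule has_integral_le) (rule pt)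
  then show ?thesis by (simp add: h_def mult.commute)
qed

text \<open>If the bound failed, the difference to the comparison function would be below -2 h at
  \<open>y0\<close> and, by Lipschitz continuity, below -h on an interval, so the cubic functional
  at time \<open>T\<close> would have a definite size. \<open>subsolution_estimate\<close> bounds it
  by the error \<theta> of the initial comparison and the error \<eta> of the approximation by
  \<open>w'\<close>, and \<open>small\<close> says that these are too small for that.\<close>

lemma pot_lower_quantitative:
  fixes D D' :: "real \<Rightarrow> real"
  assumes T: "0 \<le> T" and R: "0 \<le> R" and k: "0 \<le> k" "k \<le> K" and e1: "2 * e \<le> 1"
    and dD: "\<And>y. (D has_real_derivative D' y) (at y)" and cD': "continuous_on UNIV D'" and D'1: "\<And>y. \<bar>D' y\<bar> \<le> 1"
    and init: "\<And>y. y \<in> {-R..R} \<Longrightarrow> k * D y - f k - \<theta> \<le> pot R y 0" and \<theta>: "0 \<le> \<theta>"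
    and w': "w' \<in> borel_measurable borel" "\<And>z. \<bar>w' z\<bar> \<le> K" "continuous_on UNIV w'" and \<eta>: "0 \<le> \<eta>"
    and osc: "\<And>x t y \<tau>. y \<in> {-R..R} \<Longrightarrow> \<tau> \<in> {0..T} \<Longrightarrow> e \<le> x - y \<Longrightarrow> x - y \<le> 2 * e \<Longrightarrow> e \<le> t - \<tau> \<Longrightarrow> t - \<tau> \<le> 2 * e
      \<Longrightarrow> \<bar>w' (x, t) - w' (y, \<tau>)\<bar> \<le> \<eta>"
    and L1: "(LBINT z : {-R..R+1} \<times> {0..T+1}. \<bar>w z - w' z\<bar>) \<le> \<eta>"
    and M: "\<And>y. y \<in> {-R..R} \<Longrightarrow> 2 * R * K + T * (\<bar>f 0\<bar> + \<bar>f K\<bar>) + k * \<bar>D y\<bar> + (1 + T) * \<bar>f k\<bar> \<le> M"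
    and y0: "\<Lambda> * T + sqrt (1 + (\<bar>y0\<bar> + 1)\<^sup>2) + 1 \<le> R"
    and h: "0 < h" "h \<le> 1"
    and small: "2 * R * (\<theta> ^ 3 * R\<^sup>2) + 3 * \<Lambda> * T * (2 * R * (K * \<theta>\<^sup>2 * R\<^sup>2)
        + 2 * M * R\<^sup>2 * (8 * \<Lambda> * K * (\<eta> + 2 * R * T * \<eta>))) < 2 * (h / (2 * K + 1)) * h ^ 3"
  shows "k * D y0 - (1 + T) * f k - 2 * h \<le> pot R y0 T"
proof (rule ccontr)
  assume neg: "\<not> ?thesis"
  let ?S = "{0..T} \<times> {-R..R}"
  let ?W = "\<lambda>y \<tau>. pot R y \<tau> - k * D y + (1 + \<tau>) * f k"
  let ?\<psi> = "\<lambda>y \<tau>. (min (\<Lambda> * \<tau> + sqrt (1 + y\<^sup>2) - R) 0)\<^sup>2"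
  define \<Delta> where "\<Delta> = moll (\<lambda>z. \<bar>w z - w' z\<bar>)"
  \<comment> \<open>The factor 8 adds up 2 + 1 + 4 + 1 from the four error products in the defect
    estimate.\<close>
  define \<delta> where "\<delta> y \<tau> = 8 * \<Lambda> * K * (\<Delta> y \<tau> + \<eta>)" for y \<tau>
  have dm: "(\<lambda>z. \<bar>w z - w' z\<bar>) \<in> borel_measurable borel" using w' by measurable
  have db: "\<bar>\<bar>w z - w' z\<bar>\<bar> \<le> 2 * K" for z using w_bd[of z] w'(2)[of z] by simp
  have \<Delta>0: "0 \<le> \<Delta> y \<tau>" for y \<tau>
    unfolding \<Delta>_def using moll_mono[OF borel_measurable_const[of 0] _ dm db, of 0] by (simp add: moll_const)
  have c\<Delta>: "continuous_on S (\<lambda>p. \<Delta> (snd p) (fst p))" for S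
    unfolding \<Delta>_def by (rule conv_cont[OF bump_j bump_j dm db])
  have cD: "continuous_on UNIV D"
    by (rule DERIV_continuous_on[OF has_field_derivative_at_within[OF dD]])
  have "2 * R * K + T * (\<bar>f 0\<bar> + \<bar>f K\<bar>) + k * \<bar>D 0\<bar> + (1 + T) * \<bar>f k\<bar> \<le> M" using M[of 0] R by simp
  moreover have "0 \<le> 2 * R * K + T * (\<bar>f 0\<bar> + \<bar>f K\<bar>) + k * \<bar>D 0\<bar> + (1 + T) * \<bar>f k\<bar>"
    using R K_nonneg T k by simp
  ultimately have M0: "0 \<le> M" by linarith
  have cW0: "continuous_on {-R..R} (\<lambda>y. ?W y \<tau>)" if "\<tau> \<in> {0..T}" for \<tau>
    using continuous_on_slices(1)[OF pot_cont that] cD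
    by (intro continuous_intros) (auto intro: continuous_on_subset)
  have cm: "continuous_on {-R..R} (\<lambda>y. min (?W y \<tau>) 0)" if "\<tau> \<in> {0..T}" for \<tau>
    by (rule continuous_on_min[OF cW0[OF that] continuous_on_const])
  have r1: "\<bar>k * D' y\<bar> \<le> k" for y
    unfolding abs_mult using mult_left_mono[OF D'1[of y] k(1)] k by simp
  have est: "integral {-R..R} (\<lambda>y. - ((min (?W y T) 0) ^ 3) * ?\<psi> y T)
    \<le> integral {-R..R} (\<lambda>y. - ((min (?W y 0) 0) ^ 3) * ?\<psi> y 0)
      + 3 * \<Lambda> * T * (integral {-R..R} (\<lambda>y. moll (\<lambda>z. E k (w z)) y 0 * (min (?W y 0) 0)\<^sup>2 * ?\<psi> y 0)
          + 2 * M * R\<^sup>2 * integral {0..T} (\<lambda>\<tau>. integral {-R..R} (\<lambda>y. \<delta> y \<tau>)))"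
  proof (rule subsolution_estimate[OF T R Lam pot_cont moll_w_cont moll_fw_cont
        conv_cont[OF bump_j bump_j Ew_meas Ew_bd[OF k(1)]] conv_cont[OF bump_j bump_j Qw_meas Qw_bd[OF k]] _ _ _ cD'])
    show "continuous_on ?S (\<lambda>p. - conv j j1 (\<lambda>z. E k (w z)) (snd p) (fst p))"
      by (intro continuous_on_minus conv_cont[OF bump_j bump_j1 Ew_meas Ew_bd[OF k(1)]])
    show "continuous_on ?S (\<lambda>p. - conv j1 j (\<lambda>z. Q k (w z)) (snd p) (fst p))"
      by (intro continuous_on_minus conv_cont[OF bump_j1 bump_j Qw_meas Qw_bd[OF k]])
    show "continuous_on ?S (\<lambda>p. \<delta> (snd p) (fst p))"
      unfolding \<delta>_def by (intro continuous_intros c\<Delta>)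
    show "((\<lambda>y. pot R y \<tau>) has_real_derivative moll w y \<tau>) (at y within {-R..R})"
      if "y \<in> {-R..R}" "\<tau> \<in> {0..T}" for y \<tau>
      by (rule pot_deriv_y) (use that in auto)
    show "((\<lambda>\<tau>. pot R y \<tau>) has_real_derivative - moll fw y \<tau>) (at \<tau> within {0..T})"
      if "y \<in> {-R..R}" "\<tau> \<in> {0..T}" for y \<tau>
      by (rule pot_deriv_t[OF that(2)])
    show "((\<lambda>\<tau>. moll (\<lambda>z. E k (w z)) y \<tau>) has_real_derivative - conv j j1 (\<lambda>z. E k (w z)) y \<tau>) (at \<tau> within {0..T})" for y \<tau>
      by (rule has_field_derivative_at_within)
         (rule conv_has_derivative_snd[OF bump_j bump_j1 bump_j Ew_meas Ew_bd[OF k(1)] j_deriv])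
    show "((\<lambda>y. moll (\<lambda>z. Q k (w z)) y \<tau>) has_real_derivative - conv j1 j (\<lambda>z. Q k (w z)) y \<tau>) (at y within {-R..R})" for y \<tau>
      by (rule has_field_derivative_at_within)
         (rule conv_has_derivative_fst[OF bump_j bump_j1 bump_j Qw_meas Qw_bd[OF k] j_deriv])
    show "(D has_real_derivative D' y) (at y)" for y by (rule dD)
    show "- conv j j1 (\<lambda>z. E k (w z)) y \<tau> + - conv j1 j (\<lambda>z. Q k (w z)) y \<tau> \<le> 0"
      if "\<tau> \<in> {0..T}" for y \<tau>
      using symmetric_entropy[of \<tau> k y] that k by simp
    show E0: "0 \<le> moll (\<lambda>z. E k (w z)) y \<tau>" for y \<tau>
      using moll_mono[OF borel_measurable_const[of 0] _ Ew_meas Ew_bd[OF k(1)], of 0]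
        E_range[OF k(1) w_bd] by (simp add: moll_const)
    show "\<bar>moll (\<lambda>z. Q k (w z)) y \<tau>\<bar> \<le> \<Lambda> * moll (\<lambda>z. E k (w z)) y \<tau>" for y \<tau>
    proof -
      have LEm: "(\<lambda>z. s * E k (w z)) \<in> borel_measurable borel" for s
        using Ew_meas by (intro borel_measurable_times) auto
      have LEb: "\<bar>s * E k (w z)\<bar> \<le> \<bar>s\<bar> * K" for s z
        unfolding abs_mult by (intro mult_left_mono Ew_bd k) simp
      have "moll (\<lambda>z. Q k (w z)) y \<tau> \<le> moll (\<lambda>z. \<Lambda> * E k (w z)) y \<tau>"
        by (rule moll_mono[OF Qw_meas Qw_bd[OF k] LEm LEb]) (use Q_le_E(1)[OF k w_bd] in \<open>auto simp: abs_le_iff\<close>)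
      moreover have "moll (\<lambda>z. (- \<Lambda>) * E k (w z)) y \<tau> \<le> moll (\<lambda>z. Q k (w z)) y \<tau>"
      proof (rule moll_mono[OF LEm LEb Qw_meas Qw_bd[OF k]])
        fix x t show "- \<Lambda> * E k (w (x, t)) \<le> Q k (w (x, t))"
          using Q_le_E(1)[OF k w_bd[of "(x, t)"]] by (auto simp: abs_le_iff)
      qed
      ultimately show ?thesis unfolding moll_cmult by (simp add: abs_le_iff)
    qed
    show "moll fw y \<tau> - f k \<le> \<Lambda> * moll (\<lambda>z. E k (w z)) y \<tau>" for y \<tau>
    proof -
      have hm: "(\<lambda>z. \<Lambda> * E k (w z) + 1 * f k) \<in> borel_measurable borel"
        using Ew_meas by (intro borel_measurable_add borel_measurable_times) auto
      have hb: "\<bar>\<Lambda> * E k (w z) + 1 * f k\<bar> \<le> \<Lambda> * K + \<bar>f k\<bar>" for z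
      proof -
        have "\<bar>\<Lambda> * E k (w z)\<bar> \<le> \<Lambda> * K" unfolding abs_mult using Lam by (simp add: mult_left_mono Ew_bd k)
        then show ?thesis by linarith
      qed
      have "moll fw y \<tau> \<le> moll (\<lambda>z. \<Lambda> * E k (w z) + 1 * f k) y \<tau>"
        by (rule moll_mono[OF fw_meas fw_bd hm hb]) (use Q_le_E(2)[OF k w_bd] in \<open>auto simp: algebra_simps\<close>)
      also have "\<dots> = \<Lambda> * moll (\<lambda>z. E k (w z)) y \<tau> + 1 * moll (\<lambda>z. f k) y \<tau>"
        by (rule conv_affine[OF bump_j bump_j Ew_meas Ew_bd[OF k(1)] borel_measurable_const order_refl])
      finally show ?thesis by (simp add: moll_const)
    qed
    show "0 \<le> \<delta> y \<tau>" for y \<tau> using \<Delta>0 Lam K_nonneg \<eta> by (simp add: \<delta>_def)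
    show "moll (\<lambda>z. E k (w z)) y \<tau> * (moll fw y \<tau> - f k) - moll (\<lambda>z. Q k (w z)) y \<tau> * (moll w y \<tau> - k * D' y) \<le> \<delta> y \<tau>"
      if y: "y \<in> {-R..R}" and t: "\<tau> \<in> {0..T}" for y \<tau>
    proof -
      define v where "v = w' (y, \<tau>)"
      define d where "d = \<Delta> y \<tau> + \<eta>"
      define r where "r = k * D' y"
      have v: "\<bar>v\<bar> \<le> K" by (simp add: v_def w')
      have d0: "0 \<le> d" using \<Delta>0 \<eta> by (simp add: d_def)
      note mc = moll_close[OF _ _ _ w'(1,2) osc[OF y t], folded \<Delta>_def, folded v_def d_def]
      let ?E = "moll (\<lambda>z. E k (w z)) y \<tau>" and ?Q = "moll (\<lambda>z. Q k (w z)) y \<tau>"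
        and ?F = "moll fw y \<tau>" and ?w = "moll w y \<tau>"
      have cE: "\<bar>?E - E k v\<bar> \<le> 1 * d" by (rule mc[OF Ew_meas]) (use E_lip in auto)
      have cQ: "\<bar>?Q - Q k v\<bar> \<le> 2 * \<Lambda> * d" by (rule mc[OF Qw_meas]) (use Q_lip[OF k] Lam in auto)
      have cF: "\<bar>?F - f v\<bar> \<le> \<Lambda> * d" by (rule mc[OF fw_meas]) (use f_lip Lam in auto)
      have cw: "\<bar>?w - v\<bar> \<le> 1 * d" using mc[of "\<lambda>x. x" 1] w_meas by simp
      have bF: "\<bar>?F - f k\<bar> \<le> 2 * \<Lambda> * K"
      proof -
        have b: "\<bar>f (w z) - f k\<bar> \<le> 2 * \<Lambda> * K" for z
        proof -
          have "\<bar>f (w z) - f k\<bar> \<le> \<Lambda> * \<bar>w z - k\<bar>" by (rule f_lip) (use w_bd k in auto)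
          also have "\<dots> \<le> \<Lambda> * (2 * K)" using w_bd[of z] k by (intro mult_left_mono Lam) linarith
          finally show ?thesis by simp
        qed
        have "moll (\<lambda>z. 1 * f (w z) + (-1) * f k) y \<tau> = 1 * moll fw y \<tau> + (-1) * moll (\<lambda>z. f k) y \<tau>"
          by (rule conv_affine[OF bump_j bump_j fw_meas fw_bd borel_measurable_const order_refl])
        moreover have "\<bar>moll (\<lambda>z. 1 * f (w z) + (-1) * f k) y \<tau>\<bar> \<le> 2 * \<Lambda> * K"
          by (rule moll_abs_bound) (use b fw_meas in simp_all)
        ultimately show ?thesis by (simp add: moll_const)
      qed
      have bw: "\<bar>?w - r\<bar> \<le> 2 * K" using moll_w_bd[of y \<tau>] r1[of y] k by (simp add: r_def)
      have bE: "\<bar>E k v\<bar> \<le> K" using E_range[OF k(1) v] by simp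
      have bQ: "\<bar>Q k v\<bar> \<le> \<Lambda> * K"
        using Q_le_E(1)[OF k v] mult_left_mono[OF conjunct2[OF E_range[OF k(1) v]] Lam] by linarith
      have 1: "\<bar>(?E - E k v) * (?F - f k)\<bar> \<le> 1 * d * (2 * \<Lambda> * K)"
        unfolding abs_mult by (rule mult_mono[OF cE bF]) (use d0 in auto)
      have 2: "\<bar>E k v * (?F - f v)\<bar> \<le> K * (\<Lambda> * d)"
        unfolding abs_mult by (rule mult_mono[OF bE cF]) (use K_nonneg in auto)
      have 3: "\<bar>(?Q - Q k v) * (?w - r)\<bar> \<le> 2 * \<Lambda> * d * (2 * K)"
        unfolding abs_mult by (rule mult_mono[OF cQ bw]) (use Lam d0 in auto)
      have 4: "\<bar>Q k v * (?w - v)\<bar> \<le> \<Lambda> * K * (1 * d)"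
        unfolding abs_mult by (rule mult_mono[OF bQ cw]) (use Lam K_nonneg in auto)
      have 5: "E k v * (f v - f k) \<le> Q k v * (v - r)"
        by (rule EQ_sign[OF k(1)]) (use r1 in \<open>simp add: r_def\<close>)
      \<comment> \<open>Swap one mollified factor at a time for its value at \<open>v\<close>; what
        remains is the pointwise expression of \<open>EQ_sign\<close>.\<close>
      have "?E * (?F - f k) - ?Q * (?w - r) = (?E - E k v) * (?F - f k) + E k v * (?F - f v)
          - (?Q - Q k v) * (?w - r) - Q k v * (?w - v) + (E k v * (f v - f k) - Q k v * (v - r))"
        by algebra
      also have "\<dots> \<le> 1 * d * (2 * \<Lambda> * K) + K * (\<Lambda> * d) + 2 * \<Lambda> * d * (2 * K) + \<Lambda> * K * (1 * d)"
        using 1 2 3 4 5 by (auto simp only: abs_le_iff)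
      also have "\<dots> = 8 * \<Lambda> * K * d" by simp
      finally show ?thesis by (simp add: \<delta>_def d_def r_def)
    qed
    show "\<bar>?W y \<tau>\<bar> \<le> M" if y: "y \<in> {-R..R}" and t: "\<tau> \<in> {0..T}" for y \<tau>
    proof -
      have "\<bar>pot R y \<tau> - pot R (-R) \<tau>\<bar> \<le> K * \<bar>y - (-R)\<bar>" by (rule pot_lip_y) (use y t R in auto)
      also have "\<dots> \<le> K * (2 * R)" by (rule mult_left_mono) (use y K_nonneg in auto)
      finally have 1: "\<bar>pot R y \<tau> - pot R (-R) \<tau>\<bar> \<le> K * (2 * R)" .
      have "\<bar>pot R (-R) \<tau> - pot R (-R) 0\<bar> \<le> (\<bar>f 0\<bar> + \<bar>f K\<bar>) * \<bar>\<tau> - 0\<bar>"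
        by (rule pot_lip_t[of _ T]) (use t T in auto)
      also have "\<dots> \<le> (\<bar>f 0\<bar> + \<bar>f K\<bar>) * T" by (rule mult_left_mono) (use t in auto)
      finally have 2: "\<bar>pot R (-R) \<tau> - pot R (-R) 0\<bar> \<le> (\<bar>f 0\<bar> + \<bar>f K\<bar>) * T" .
      have 3: "pot R (-R) 0 = 0" by (simp add: pot_def)
      have 4: "\<bar>k * D y\<bar> = k * \<bar>D y\<bar>" using k by (simp add: abs_mult)
      have "\<bar>(1 + \<tau>) * f k\<bar> = (1 + \<tau>) * \<bar>f k\<bar>" using t by (simp add: abs_mult)
      also have "\<dots> \<le> (1 + T) * \<bar>f k\<bar>" by (rule mult_right_mono) (use t in auto)
      finally have 5: "\<bar>(1 + \<tau>) * f k\<bar> \<le> (1 + T) * \<bar>f k\<bar>" .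
      have 6: "K * (2 * R) = 2 * R * K" "(\<bar>f 0\<bar> + \<bar>f K\<bar>) * T = T * (\<bar>f 0\<bar> + \<bar>f K\<bar>)" by simp_all
      show ?thesis using 1 2 3 4 5 M[OF y] unfolding 6 by linarith
    qed
  qed
  have \<psi>R: "?\<psi> y 0 \<le> R\<^sup>2" for y
  proof -
    have "\<bar>min (\<Lambda> * 0 + sqrt (1 + y\<^sup>2) - R) 0\<bar> \<le> R" using R by (auto simp: min_def)
    then show ?thesis by (metis abs_le_square_iff abs_of_nonneg R)
  qed
  have W0: "- \<theta> \<le> min (?W y 0) 0" if "y \<in> {-R..R}" for y using init[OF that] \<theta> by simp
  have c\<psi>: "continuous_on {-R..R} (\<lambda>y. ?\<psi> y \<tau>)" for \<tau> by (intro continuous_intros)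
  have "integral {-R..R} (\<lambda>y. - ((min (?W y 0) 0) ^ 3) * ?\<psi> y 0) \<le> 2 * R * (\<theta> ^ 3 * R\<^sup>2)"
  proof (rule integral_Icc_le[OF R])
    show "continuous_on {-R..R} (\<lambda>y. - ((min (?W y 0) 0) ^ 3) * ?\<psi> y 0)"
      by (rule continuous_on_mult[OF continuous_on_minus[OF continuous_on_power[OF cm]] c\<psi>]) (use T in auto)
    fix y assume "y \<in> {-R..R}"
    have "- ((min (?W y 0) 0) ^ 3) = (- min (?W y 0) 0) ^ 3" by simp
    also have "\<dots> \<le> \<theta> ^ 3" using W0[OF \<open>y \<in> _\<close>] by (intro power_mono) auto
    finally show "- ((min (?W y 0) 0) ^ 3) * ?\<psi> y 0 \<le> \<theta> ^ 3 * R\<^sup>2"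
      using \<theta> by (intro mult_mono \<psi>R) auto
  qed
  moreover have "integral {-R..R} (\<lambda>y. moll (\<lambda>z. E k (w z)) y 0 * (min (?W y 0) 0)\<^sup>2 * ?\<psi> y 0) \<le> 2 * R * (K * \<theta>\<^sup>2 * R\<^sup>2)"
  proof (rule integral_Icc_le[OF R])
    have "continuous_on {-R..R} (\<lambda>y. moll (\<lambda>z. E k (w z)) y 0)"
      by (rule continuous_on_slices(1)[OF conv_cont[OF bump_j bump_j Ew_meas Ew_bd[OF k(1)], of "UNIV \<times> _"]]) simp
    then show "continuous_on {-R..R} (\<lambda>y. moll (\<lambda>z. E k (w z)) y 0 * (min (?W y 0) 0)\<^sup>2 * ?\<psi> y 0)"
      by (rule continuous_on_mult[OF continuous_on_mult[OF _ continuous_on_power[OF cm]] c\<psi>]) (use T in auto)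
    fix y assume y: "y \<in> {-R..R}"
    have "(- min (?W y 0) 0)\<^sup>2 \<le> \<theta>\<^sup>2" using W0[OF y] by (intro power_mono) auto
    moreover have "moll (\<lambda>z. E k (w z)) y 0 \<le> K"
      using moll_abs_bound[OF Ew_meas Ew_bd[OF k(1)], of y 0] by linarith
    ultimately show "moll (\<lambda>z. E k (w z)) y 0 * (min (?W y 0) 0)\<^sup>2 * ?\<psi> y 0 \<le> K * \<theta>\<^sup>2 * R\<^sup>2"
      using K_nonneg by (intro mult_mono \<psi>R) auto
  qed
  moreover have "integral {0..T} (\<lambda>\<tau>. integral {-R..R} (\<lambda>y. \<delta> y \<tau>)) \<le> 8 * \<Lambda> * K * (\<eta> + 2 * R * T * \<eta>)"
  proof -
    have i1: "(\<lambda>y. \<Delta> y \<tau>) integrable_on {-R..R}" for \<tau>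
      by (rule integrable_continuous_interval[OF continuous_on_slices(1)[OF c\<Delta>[of "UNIV \<times> {-R..R}"]]]) simp
    have i2: "(\<lambda>\<tau>. integral {-R..R} (\<lambda>y. \<Delta> y \<tau>)) integrable_on {0..T}"
      using integral_continuous_on_param[of "{0..T}" "-R" R "\<lambda>\<tau> y. \<Delta> y \<tau>"] c\<Delta>
      by (intro integrable_continuous_interval) (simp add: case_prod_beta')
    have "integral {-R..R} (\<lambda>y. \<delta> y \<tau>) = 8 * \<Lambda> * K * (integral {-R..R} (\<lambda>y. \<Delta> y \<tau>) + 2 * R * \<eta>)" for \<tau>
      unfolding \<delta>_def using R
      by (simp add: Henstock_Kurzweil_Integration.integral_add[OF i1[of \<tau>] integrable_const_ivl])
    then have "integral {0..T} (\<lambda>\<tau>. integral {-R..R} (\<lambda>y. \<delta> y \<tau>))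
        = 8 * \<Lambda> * K * (integral {0..T} (\<lambda>\<tau>. integral {-R..R} (\<lambda>y. \<Delta> y \<tau>)) + 2 * R * T * \<eta>)"
      using T by (simp add: Henstock_Kurzweil_Integration.integral_add[OF i2 integrable_const_ivl])
    moreover have "integral {0..T} (\<lambda>\<tau>. integral {-R..R} (\<lambda>y. \<Delta> y \<tau>)) \<le> \<eta>"
    proof -
      have "integral {0..T} (\<lambda>\<tau>. integral {-R..R} (\<lambda>y. \<Delta> y \<tau>)) \<le> (LBINT z : {-R..R+1} \<times> {0..T+1}. \<bar>w z - w' z\<bar>)"
        unfolding \<Delta>_def
        by (rule integral_moll_le[OF dm db]) (use e1 e_pos in auto)
      then show ?thesis using L1 by linarith
    qed
    ultimately show ?thesis using Lam K_nonneg by (auto intro!: mult_left_mono)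
  qed
  ultimately have up: "integral {-R..R} (\<lambda>y. - ((min (?W y T) 0) ^ 3) * ?\<psi> y T) < 2 * (h / (2 * K + 1)) * h ^ 3"
    using est small Lam T M0
    by (smt (verit) mult_left_mono mult_nonneg_nonneg zero_le_power2)
  \<comment> \<open>Both the potential and k D have Lipschitz constant K, so moving by r changes
    their difference by at most 2 K r \<le> h; the summand 1 in the denominator covers K = 0 and
    keeps r \<le> 1.\<close>
  define r where "r = h / (2 * K + 1)"
  have r: "0 < r" "r \<le> 1" "r * (2 * K) \<le> h"
    using h K_nonneg by (auto simp: r_def field_simps)
  have sq: "\<bar>y\<bar> \<le> sqrt (1 + y\<^sup>2)" for y :: real by (rule real_le_rsqrt) simp
  \<comment> \<open>\<open>y0\<close> lies deep enough in the cone, by one unit in y and one in the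
    cone function, for the weight to be at least 1 on the whole interval.\<close>
  have yr: "y \<in> {-R..R}" "1 \<le> ?\<psi> y T" if "y \<in> {y0 - r..y0 + r}" for y
  proof -
    have ay: "\<bar>y\<bar> \<le> \<bar>y0\<bar> + 1" using that r by auto
    have "\<bar>y\<bar>\<^sup>2 \<le> (\<bar>y0\<bar> + 1)\<^sup>2" by (rule power_mono[OF ay]) simp
    then have s: "sqrt (1 + y\<^sup>2) \<le> sqrt (1 + (\<bar>y0\<bar> + 1)\<^sup>2)" by simp
    have "0 \<le> \<Lambda> * T" using Lam T by simp
    then have "\<bar>y\<bar> \<le> R" using sq[of y] s y0 by linarith
    then show "y \<in> {-R..R}" by (simp add: abs_le_iff)
    have "\<Lambda> * T + sqrt (1 + y\<^sup>2) - R \<le> - 1" using s y0 by linarith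
    then have "1 \<le> \<bar>min (\<Lambda> * T + sqrt (1 + y\<^sup>2) - R) 0\<bar>" by linarith
    then show "1 \<le> ?\<psi> y T" by (metis one_le_power power2_abs)
  qed
  have Wneg: "h ^ 3 \<le> - ((min (?W y T) 0) ^ 3) * ?\<psi> y T" if y: "y \<in> {y0 - r..y0 + r}" for y
  proof -
    have y0in: "y0 \<in> {-R..R}" using yr(1)[of y0] r by auto
    have yd: "\<bar>y - y0\<bar> \<le> r" using y by auto
    have "\<bar>pot R y T - pot R y0 T\<bar> \<le> K * \<bar>y - y0\<bar>" by (rule pot_lip_y) (use yr(1)[OF y] y0in T in auto)
    also have "\<dots> \<le> K * r" by (rule mult_left_mono[OF yd K_nonneg])
    finally have 1: "\<bar>pot R y T - pot R y0 T\<bar> \<le> K * r" .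
    have "\<bar>D y - D y0\<bar> \<le> 1 * \<bar>y - y0\<bar>"
      using field_differentiable_bound[of UNIV D D' 1 y y0] dD D'1 by (auto simp: has_field_derivative_at_within)
    then have "\<bar>k * D y - k * D y0\<bar> \<le> K * r"
      unfolding right_diff_distrib[symmetric] abs_mult using yd k by (intro mult_mono) auto
    then have "?W y T \<le> ?W y0 T + 2 * (K * r)" using 1 by linarith
    also have "\<dots> \<le> - 2 * h + h" using neg r(3) by (simp add: mult.commute mult.left_commute)
    finally have Wh: "?W y T \<le> - h" by simp
    have "h ^ 3 \<le> (- min (?W y T) 0) ^ 3" using Wh h by (intro power_mono) auto
    also have "\<dots> = - ((min (?W y T) 0) ^ 3)" by simp
    finally have 2: "h ^ 3 \<le> - ((min (?W y T) 0) ^ 3)" .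
    have "h ^ 3 * 1 \<le> - ((min (?W y T) 0) ^ 3) * ?\<psi> y T"
      by (rule mult_mono[OF 2 yr(2)[OF y]]) (use 2 h zero_le_power[of h 3] in linarith)+
    then show ?thesis by simp
  qed
  have cB: "continuous_on {-R..R} (\<lambda>y. - ((min (?W y T) 0) ^ 3) * ?\<psi> y T)"
      by (rule continuous_on_mult[OF continuous_on_minus[OF continuous_on_power[OF cm]] c\<psi>]) (use T in auto)
  have "2 * r * h ^ 3 = integral {y0 - r..y0 + r} (\<lambda>y. h ^ 3)" using r by simp
  also have "\<dots> \<le> integral {y0 - r..y0 + r} (\<lambda>y. - ((min (?W y T) 0) ^ 3) * ?\<psi> y T)"
    using Wneg yr(1)
    by (intro integral_le integrable_continuous_interval continuous_on_subset[OF cB]) auto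
  also have "\<dots> \<le> integral {-R..R} (\<lambda>y. - ((min (?W y T) 0) ^ 3) * ?\<psi> y T)"
  proof (rule integral_subset_le)
    show "{y0 - r..y0 + r} \<subseteq> {-R..R}" using yr(1) by blast
    show "(\<lambda>y. - ((min (?W y T) 0) ^ 3) * ?\<psi> y T) integrable_on {y0 - r..y0 + r}"
      using yr(1) by (intro integrable_continuous_interval continuous_on_subset[OF cB]) auto
    show "(\<lambda>y. - ((min (?W y T) 0) ^ 3) * ?\<psi> y T) integrable_on {-R..R}"
      by (rule integrable_continuous_interval[OF cB])
    show "\<forall>y\<in>{-R..R}. 0 \<le> - ((min (?W y T) 0) ^ 3) * ?\<psi> y T"
    proof
      fix y
      have "0 \<le> (- min (?W y T) 0) ^ 3" by (intro zero_le_power) auto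
      then have "0 \<le> - ((min (?W y T) 0) ^ 3)" by simp
      then show "0 \<le> - ((min (?W y T) 0) ^ 3) * ?\<psi> y T" by (intro mult_nonneg_nonneg) auto
    qed
  qed
  finally show False using up by (simp add: r_def)
qed

end

section \<open>From entropy solutions to their potential\<close>

text \<open>Fubini for null sets, carried out on a Borel null set \<open>N\<close> because
  \<open>P\<close> itself may fail to be measurable.\<close>

lemma AE_lborel_swap:
  assumes "AE z in lborel. P (z :: real \<times> real)"
  shows "AE t in lborel. AE x in lborel. P (x, t)"
proof -
  from AE_E[OF assms] obtain N where N: "{z \<in> space lborel. \<not> P z} \<subseteq> N" "emeasure lborel N = 0" "N \<in> sets lborel"
    by blast
  have "AE z in lborel \<Otimes>\<^sub>M lborel. (fst z, snd z) \<notin> N"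
    using N unfolding lborel_prod by (intro AE_I[of _ _ N]) auto
  then have "AE x in lborel. AE t in lborel. (x, t) \<notin> N"
    using lborel_pair.AE_pair[of "\<lambda>z. z \<notin> N"] by simp
  moreover have "{z \<in> space (lborel \<Otimes>\<^sub>M lborel). (fst z, snd z) \<notin> N} = - N"
    by (auto simp: space_pair_measure)
  then have "{z \<in> space (lborel \<Otimes>\<^sub>M lborel). (fst z, snd z) \<notin> N} \<in> sets (lborel \<Otimes>\<^sub>M lborel)"
    unfolding lborel_prod using N(3) by (simp add: sets.compl_sets Compl_eq_Diff_UNIV)
  ultimately have "AE t in lborel. AE x in lborel. (x, t) \<notin> N"
    using lborel_pair.AE_commute[of "\<lambda>x t. (x, t) \<notin> N"] by blast
  then show ?thesis
    by eventually_elim (use N(1) in \<open>auto elim!: eventually_mono\<close>)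
qed

text \<open>Mollification is set up for a Borel function on the whole plane with a pointwise bound,
  while an entropy solution is Lebesgue measurable on the half-plane and bounded almost everywhere.
  Extend by 0, pass to a Borel version, clamp to [-K, K].\<close>

lemma entropy_solution_representative:
  assumes "entropy_solution f u\<^sub>0 v"
  obtains w K where "w \<in> borel_measurable borel" "\<And>z. \<bar>w z\<bar> \<le> K"
    "AE z in lborel. 0 \<le> snd z \<longrightarrow> v (fst z) (snd z) = w z"
    "(\<lambda>z. if 0 \<le> snd z then v (fst z) (snd z) else 0) \<in> borel_measurable lebesgue"
proof -
  let ?S = "(UNIV :: real set) \<times> {0::real..}"
  let ?v = "\<lambda>(x, t). v x t"
  have S: "?S \<in> sets lebesgue"
  proof -
    have "closed ?S" by (intro closed_Times) auto
    then show ?thesis by (intro sets_completionI_sets) (simp add: borel_closed)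
  qed
  from assms obtain C where v: "?v \<in> borel_measurable (lebesgue_on ?S)" and C: "AE z in lebesgue_on ?S. \<bar>?v z\<bar> \<le> C"
    by (auto simp: entropy_solution_def L_infty_def)
  have meas: "(\<lambda>z. if z \<in> ?S then ?v z else 0) \<in> borel_measurable lebesgue"
    using v S by (simp add: borel_measurable_if)
  from completion_ex_borel_measurable_real[OF this]
  obtain g where g: "g \<in> borel_measurable lborel" "AE z in lborel. (if z \<in> ?S then ?v z else 0) = g z" by auto
  define K where "K = max C 0"
  define w where "w z = max (- K) (min K (g z))" for z
  have "AE z in lebesgue. z \<in> ?S \<longrightarrow> \<bar>?v z\<bar> \<le> C"
    using C AE_restrict_space_iff[of ?S lebesgue] S by simp
  then have C': "AE z in lborel. z \<in> ?S \<longrightarrow> \<bar>?v z\<bar> \<le> C"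
    by (simp add: AE_completion_iff)
  show ?thesis
  proof
    have "(\<lambda>z. if 0 \<le> snd z then v (fst z) (snd z) else 0) = (\<lambda>z. if z \<in> ?S then ?v z else 0)"
      by (auto simp: fun_eq_iff)
    then show "(\<lambda>z. if 0 \<le> snd z then v (fst z) (snd z) else 0) \<in> borel_measurable lebesgue"
      using meas by simp
    show "w \<in> borel_measurable borel" using g unfolding w_def by simp
    show "\<bar>w z\<bar> \<le> K" for z by (auto simp: w_def K_def)
    show "AE z in lborel. 0 \<le> snd z \<longrightarrow> v (fst z) (snd z) = w z"
      using g(2) C'
    proof eventually_elim
      case (elim z)
      show ?case
      proof
        assume "0 \<le> snd z"
        then have "z \<in> ?S" by (cases z) auto
        with elim have "v (fst z) (snd z) = g z" "\<bar>v (fst z) (snd z)\<bar> \<le> C" by (auto simp: case_prod_beta')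
        then show "v (fst z) (snd z) = w z" by (auto simp: w_def K_def max_def min_def abs_if split: if_splits)
      qed
    qed
  qed
qed

text \<open>The kernel lives at times at least \<tau> + e > 0, so the integral over t > 0 in the
  entropy inequality equals one over the plane, and \<open>v\<close> may be replaced by
  \<open>w\<close>.\<close>

lemma representative_entropy:
  assumes v: "entropy_solution f u\<^sub>0 v" and f: "f \<in> borel_measurable borel"
    and w: "w \<in> borel_measurable borel" "\<And>z. \<bar>w z\<bar> \<le> K" and fb: "\<And>z. \<bar>f (w z)\<bar> \<le> C"
    and vw: "AE z in lborel. 0 \<le> snd z \<longrightarrow> v (fst z) (snd z) = w z"
    and vm: "(\<lambda>z. if 0 \<le> snd z then v (fst z) (snd z) else 0) \<in> borel_measurable lebesgue"
    and m: "mollifier e j j1"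
    and test: "test_function (\<lambda>(x, t). j (x - y) * j (t - \<tau>))" and \<tau>: "0 \<le> \<tau>"
  shows "0 \<le> conv j j1 (\<lambda>z. \<bar>w z - k\<bar>) y \<tau> + conv j1 j (\<lambda>z. sgn (w z - k) * (f (w z) - f k)) y \<tau>"
proof -
  interpret mollifier e j j1 by (rule m)
  let ?\<phi> = "\<lambda>(x, t). j (x - y) * j (t - \<tau>)"
  let ?E = "\<lambda>z. \<bar>w z - k\<bar>" and ?Q = "\<lambda>z. sgn (w z - k) * (f (w z) - f k)"
  let ?I = "\<lambda>z. ?E z * (j (fst z - y) * j1 (snd z - \<tau>)) + ?Q z * (j1 (fst z - y) * j (snd z - \<tau>))"
  have Em: "?E \<in> borel_measurable borel" using w by measurable
  have fwm: "(\<lambda>z. f (w z)) \<in> borel_measurable borel" by (rule measurable_compose[OF w(1) f])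
  have Qm: "?Q \<in> borel_measurable borel" using w fwm by measurable
  have Eb: "\<bar>?E z\<bar> \<le> K + \<bar>k\<bar>" for z using w(2)[of z] by simp
  have Qb: "\<bar>?Q z\<bar> \<le> C + \<bar>f k\<bar>" for z
  proof -
    have "\<bar>?Q z\<bar> \<le> \<bar>f (w z) - f k\<bar>" by (simp add: abs_mult abs_sgn_eq)
    then show ?thesis using fb[of z] by linarith
  qed
  have dt: "deriv (\<lambda>\<sigma>. ?\<phi> (x, \<sigma>)) t = j (x - y) * j1 (t - \<tau>)" for x t
  proof (rule DERIV_imp_deriv)
    have "((\<lambda>\<sigma>. j (\<sigma> - \<tau>)) has_real_derivative j1 (t - \<tau>)) (at t)"
      by (rule DERIV_chain2[OF j_deriv, THEN DERIV_cong]) (auto intro!: derivative_eq_intros)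
    from DERIV_cmult[OF this, of "j (x - y)"]
    show "((\<lambda>\<sigma>. ?\<phi> (x, \<sigma>)) has_real_derivative j (x - y) * j1 (t - \<tau>)) (at t)" by simp
  qed
  have dx: "deriv (\<lambda>x. ?\<phi> (x, t)) x = j1 (x - y) * j (t - \<tau>)" for x t
  proof (rule DERIV_imp_deriv)
    have "((\<lambda>x. j (x - y)) has_real_derivative j1 (x - y)) (at x)"
      by (rule DERIV_chain2[OF j_deriv, THEN DERIV_cong]) (auto intro!: derivative_eq_intros)
    from DERIV_cmult_right[OF this, of "j (t - \<tau>)"]
    show "((\<lambda>x. ?\<phi> (x, t)) has_real_derivative j1 (x - y) * j (t - \<tau>)) (at x)" by simp
  qed
  have "\<forall>\<phi>. test_function \<phi> \<and> (\<forall>z. 0 \<le> \<phi> z) \<longrightarrow>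
        0 \<le> (LINT (x, t):(UNIV \<times> {0<..})|lebesgue.
               \<bar>v x t - k\<bar> * deriv (\<lambda>\<tau>. \<phi> (x, \<tau>)) t
               + sgn (v x t - k) * (f (v x t) - f k) * deriv (\<lambda>y. \<phi> (y, t)) x)"
    using v by (simp add: entropy_solution_def entropy_inequality_def)
  moreover have "\<forall>z. 0 \<le> ?\<phi> z" using j_nonneg by auto
  ultimately have "0 \<le> (LINT (x, t):(UNIV \<times> {0<..})|lebesgue.
               \<bar>v x t - k\<bar> * deriv (\<lambda>\<sigma>. ?\<phi> (x, \<sigma>)) t
               + sgn (v x t - k) * (f (v x t) - f k) * deriv (\<lambda>x. ?\<phi> (x, t)) x)"
    using test by blast
  also have "\<dots> = (LINT z|lebesgue. ?I z)"
    unfolding set_lebesgue_integral_def dt dx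
  proof (rule integral_cong_AE)
    let ?u = "\<lambda>z. if 0 \<le> snd z then v (fst z) (snd z) else 0"
    have km: "(\<lambda>z. j (fst z - y) * j1 (snd z - \<tau>)) \<in> borel_measurable borel"
      "(\<lambda>z. j1 (fst z - y) * j (snd z - \<tau>)) \<in> borel_measurable borel"
      by (rule kernel_measurable[OF bump_j bump_j1], rule kernel_measurable[OF bump_j1 bump_j])
    then have km': "(\<lambda>z. j (fst z - y) * j1 (snd z - \<tau>)) \<in> borel_measurable lebesgue"
      "(\<lambda>z. j1 (fst z - y) * j (snd z - \<tau>)) \<in> borel_measurable lebesgue"
      by (auto intro: measurable_completion)
    have fu: "(\<lambda>z. f (?u z)) \<in> borel_measurable lebesgue" by (rule measurable_compose[OF vm f])
    have "UNIV \<times> {0::real<..} \<in> sets (lebesgue :: (real \<times> real) measure)"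
      by (intro sets_completionI_sets) (auto intro!: borel_open open_Times)
    then have "(\<lambda>z. indicator (UNIV \<times> {0<..}) z * (\<bar>?u z - k\<bar> * (j (fst z - y) * j1 (snd z - \<tau>))
        + sgn (?u z - k) * (f (?u z) - f k) * (j1 (fst z - y) * j (snd z - \<tau>)))) \<in> borel_measurable lebesgue"
      using vm fu km' by measurable
    also have "(\<lambda>z. indicator (UNIV \<times> {0<..}) z * (\<bar>?u z - k\<bar> * (j (fst z - y) * j1 (snd z - \<tau>))
        + sgn (?u z - k) * (f (?u z) - f k) * (j1 (fst z - y) * j (snd z - \<tau>)))) =
      (\<lambda>z. indicator (UNIV \<times> {0<..}) z *\<^sub>R (case z of (x, t) \<Rightarrow> \<bar>v x t - k\<bar> * (j (x - y) * j1 (t - \<tau>))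
        + sgn (v x t - k) * (f (v x t) - f k) * (j1 (x - y) * j (t - \<tau>))))"
      by (auto simp: fun_eq_iff indicator_def)
    finally show "(\<lambda>z. indicator (UNIV \<times> {0<..}) z *\<^sub>R (case z of (x, t) \<Rightarrow> \<bar>v x t - k\<bar> * (j (x - y) * j1 (t - \<tau>))
        + sgn (v x t - k) * (f (v x t) - f k) * (j1 (x - y) * j (t - \<tau>)))) \<in> borel_measurable lebesgue" .
    have "?I \<in> borel_measurable borel" using Em Qm km by measurable
    then show "?I \<in> borel_measurable lebesgue" by (auto intro: measurable_completion)
    have "AE z in lebesgue. 0 \<le> snd z \<longrightarrow> v (fst z) (snd z) = w z"
      using vw by (simp add: AE_completion_iff)
    then show "AE z in lebesgue. indicator (UNIV \<times> {0<..}) z *\<^sub>R (case z of (x, t) \<Rightarrow> \<bar>v x t - k\<bar> * (j (x - y) * j1 (t - \<tau>))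
        + sgn (v x t - k) * (f (v x t) - f k) * (j1 (x - y) * j (t - \<tau>))) = ?I z"
    proof eventually_elim
      case (elim z)
      obtain x t where z: "z = (x, t)" by (cases z)
      show ?case
      proof (cases "0 < t")
        case True
        then show ?thesis using elim by (simp add: z)
      next
        case False
        then have "j (t - \<tau>) = 0" "j1 (t - \<tau>) = 0" using j_supp[of "t - \<tau>"] \<tau> e_pos by auto
        then show ?thesis using False by (simp add: z)
      qed
    qed
  qed
  also have "\<dots> = (LBINT z. ?I z)"
  proof (rule integral_completion)
    show "?I \<in> borel_measurable lborel"
      using Em Qm kernel_measurable[OF bump_j bump_j1, of y \<tau>] kernel_measurable[OF bump_j1 bump_j, of y \<tau>] by measurable
  qed
  also have "\<dots> = conv j j1 ?E y \<tau> + conv j1 j ?Q y \<tau>"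
    unfolding conv_def
    by (rule Bochner_Integration.integral_add[OF conv_integrable[OF bump_j bump_j1 Em Eb] conv_integrable[OF bump_j1 bump_j Qm Qb]])
  finally show ?thesis .
qed

text \<open>Continuity in L1_loc controls the slices of \<open>v\<close> near \<tau>; those of
  \<open>w\<close> agree with them only for almost every time. One \<open>e0\<close> serves all
  subintervals of [-R, R], since the L1 distance over [-R, R] bounds each difference of
  integrals.\<close>

lemma representative_slices:
  fixes w :: "real \<times> real \<Rightarrow> real"
  assumes v: "entropy_solution f u\<^sub>0 v" and w: "w \<in> borel_measurable borel" "\<And>z. \<bar>w z\<bar> \<le> K"
    and vw: "AE z in lborel. 0 \<le> snd z \<longrightarrow> v (fst z) (snd z) = w z"
    and \<tau>: "0 \<le> \<tau>" and \<eta>: "0 < \<eta>"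
  obtains e0 where "0 < e0"
    "\<And>a b. -R \<le> a \<Longrightarrow> b \<le> R \<Longrightarrow> AE t in lborel. \<tau> < t \<and> t < \<tau> + e0 \<longrightarrow>
        \<bar>(LBINT y:{a..b}. w (y, t)) - (LINT y:{a..b}|lebesgue. v y \<tau>)\<bar> \<le> \<eta>"
proof -
  let ?K = "{-R..R}"
  have loc: "L1_loc (\<lambda>x. v x t)" if "0 \<le> t" for t
    using v that by (auto simp: entropy_solution_def continuous_L1_loc_def)
  have "((\<lambda>t. LINT x:?K|lebesgue. \<bar>v x t - v x \<tau>\<bar>) \<longlongrightarrow> 0) (at \<tau> within {0..})"
    using v \<tau> by (auto simp: entropy_solution_def continuous_L1_loc_def)
  from tendstoD[OF this \<eta>] obtain e0 where e0: "0 < e0"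
    "\<And>t. 0 \<le> t \<Longrightarrow> t \<noteq> \<tau> \<Longrightarrow> \<bar>t - \<tau>\<bar> < e0 \<Longrightarrow> \<bar>LINT x:?K|lebesgue. \<bar>v x t - v x \<tau>\<bar>\<bar> < \<eta>"
    by (auto simp: eventually_at dist_real_def)
  show ?thesis
  proof
    show "0 < e0" by fact
    fix a b assume ab: "-R \<le> a" "b \<le> R"
    show "AE t in lborel. \<tau> < t \<and> t < \<tau> + e0 \<longrightarrow>
        \<bar>(LBINT y:{a..b}. w (y, t)) - (LINT y:{a..b}|lebesgue. v y \<tau>)\<bar> \<le> \<eta>"
      using AE_lborel_swap[OF vw]
    proof eventually_elim
      case (elim t)
      show ?case
      proof
        assume t: "\<tau> < t \<and> t < \<tau> + e0"
        have i: "set_integrable lebesgue {a..b} (\<lambda>x. v x t)" "set_integrable lebesgue {a..b} (\<lambda>x. v x \<tau>)"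
          using loc[of t] loc[of \<tau>] t \<tau> by (auto simp: L1_loc_def)
        have iK: "set_integrable lebesgue ?K (\<lambda>x. \<bar>v x t - v x \<tau>\<bar>)"
          using loc[of t] loc[of \<tau>] t \<tau>
          by (intro set_integrable_abs set_integral_diff(1)) (auto simp: L1_loc_def)
        have m: "(\<lambda>y. w (y, t)) \<in> borel_measurable borel"
        proof -
          have "(\<lambda>y::real. (y, t)) \<in> borel_measurable borel"
            by (intro borel_measurable_continuous_onI continuous_intros)
          from measurable_compose[OF this w(1)] show ?thesis .
        qed
        have "(LBINT y:{a..b}. w (y, t)) = (LINT y:{a..b}|lebesgue. w (y, t))"
          unfolding set_lebesgue_integral_def using m by (intro integral_completion[symmetric]) simp
        also have "\<dots> = (LINT y:{a..b}|lebesgue. v y t)"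
          unfolding set_lebesgue_integral_def
        proof (rule integral_cong_AE)
          have "(\<lambda>y. indicator {a..b} y *\<^sub>R w (y, t)) \<in> borel_measurable borel" using m by simp
          then show "(\<lambda>y. indicator {a..b} y *\<^sub>R w (y, t)) \<in> borel_measurable lebesgue"
            by (auto intro: measurable_completion)
          show "(\<lambda>y. indicator {a..b} y *\<^sub>R v y t) \<in> borel_measurable lebesgue"
            using i(1) by (simp add: set_integrable_def)
          have "AE y in lebesgue. v y t = w (y, t)"
            using elim t \<tau> by (simp add: AE_completion_iff)
          then show "AE y in lebesgue. indicator {a..b} y *\<^sub>R w (y, t) = indicator {a..b} y *\<^sub>R v y t"
            by eventually_elim simp
        qed
        finally have "(LBINT y:{a..b}. w (y, t)) - (LINT y:{a..b}|lebesgue. v y \<tau>)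
            = (LINT y:{a..b}|lebesgue. v y t - v y \<tau>)"
          using i by (simp add: set_integral_diff)
        then have "\<bar>(LBINT y:{a..b}. w (y, t)) - (LINT y:{a..b}|lebesgue. v y \<tau>)\<bar>
            \<le> (LINT y:{a..b}|lebesgue. \<bar>v y t - v y \<tau>\<bar>)"
          using set_integral_norm_bound[OF set_integral_diff(1)[OF i]] by simp
        also have "\<dots> \<le> (LINT y:?K|lebesgue. \<bar>v y t - v y \<tau>\<bar>)"
        proof -
          have "set_integrable lebesgue {a..b} (\<lambda>y. \<bar>v y t - v y \<tau>\<bar>)"
            by (intro set_integrable_abs set_integral_diff(1) i)
          then show ?thesis
            using iK ab unfolding set_lebesgue_integral_def set_integrable_def
            by (intro integral_mono) (auto simp: indicator_def)
        qed
        also have "\<dots> \<le> \<eta>" using e0(2)[of t] t \<tau> by auto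
        finally show "\<bar>(LBINT y:{a..b}. w (y, t)) - (LINT y:{a..b}|lebesgue. v y \<tau>)\<bar> \<le> \<eta>" .
      qed
    qed
  qed
qed

text \<open>A measurable function is an almost everywhere limit of continuous ones. Clamping these
  to [-K, K] keeps continuity and supplies the dominating function on the box.\<close>

lemma L1_approx_continuous:
  fixes w :: "real \<times> real \<Rightarrow> real"
  assumes w: "w \<in> borel_measurable borel" "\<And>z. \<bar>w z\<bar> \<le> K" and \<eta>: "0 < \<eta>"
  obtains w' where "continuous_on UNIV w'" "\<And>z. \<bar>w' z\<bar> \<le> K"
    "(LBINT z : {a..b} \<times> {c..d}. \<bar>w z - w' z\<bar>) \<le> \<eta>"
proof -
  have K: "0 \<le> K" using w(2)[of undefined] by simp
  have "w \<in> borel_measurable lebesgue" using w(1) by (auto intro: measurable_completion)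
  then have "w measurable_on UNIV" by (rule lebesgue_measurable_imp_measurable_on) simp
  then obtain N g where N: "negligible N" and g: "\<And>n. continuous_on UNIV (g n)"
    and lim: "\<And>x. x \<notin> N \<Longrightarrow> (\<lambda>n. g n x) \<longlonglongrightarrow> w x"
    by (auto simp: measurable_on_def)
  define h where "h n z = max (- K) (min K (g n z))" for n :: nat and z
  have hc: "continuous_on UNIV (h n)" for n unfolding h_def by (intro continuous_intros g)
  have hb: "\<bar>h n z\<bar> \<le> K" for n z using K by (auto simp: h_def)
  let ?B = "{a..b} \<times> {c..d}"
  have B: "?B = cbox (a, c) (b, d)" by auto
  have "(\<lambda>n. LBINT z. indicator ?B z *\<^sub>R \<bar>w z - h n z\<bar>) \<longlonglongrightarrow> integral\<^sup>L lborel (\<lambda>z::real \<times> real. 0::real)"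
  proof (rule integral_dominated_convergence[where f = "\<lambda>z. 0" and s = "\<lambda>n z. indicator ?B z *\<^sub>R \<bar>w z - h n z\<bar>"
        and w = "\<lambda>z. 2 * K * indicat_real ?B z"])
    show "integrable lborel (\<lambda>z. 2 * K * indicat_real ?B z)" by (rule integrable_indicator_box)
    have hm: "h n \<in> borel_measurable borel" for n by (rule borel_measurable_continuous_onI[OF hc])
    have "?B \<in> sets borel" unfolding B by simp
    then show "(\<lambda>z. indicator ?B z *\<^sub>R \<bar>w z - h n z\<bar>) \<in> borel_measurable lborel" for n
      using hm w(1) by simp
    have "AE z in lebesgue. z \<notin> N" using N by (simp add: AE_not_in negligible_iff_null_sets)
    then have "AE z in lborel. z \<notin> N" by (simp add: AE_completion_iff)
    then show "AE z in lborel. (\<lambda>n. indicator ?B z *\<^sub>R \<bar>w z - h n z\<bar>) \<longlonglongrightarrow> 0"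
    proof eventually_elim
      case (elim z)
      have "(\<lambda>n. h n z) \<longlonglongrightarrow> max (- K) (min K (w z))"
        unfolding h_def by (intro tendsto_intros lim[OF elim])
      also have "max (- K) (min K (w z)) = w z" using w(2)[of z] by (auto simp: abs_le_iff)
      finally have "(\<lambda>n. indicator ?B z *\<^sub>R \<bar>w z - h n z\<bar>) \<longlonglongrightarrow> indicator ?B z *\<^sub>R \<bar>w z - w z\<bar>"
        by (intro tendsto_intros)
      then show ?case by simp
    qed
    show "AE z in lborel. norm (indicator ?B z *\<^sub>R \<bar>w z - h n z\<bar>) \<le> 2 * K * indicat_real ?B z" for n
    proof (rule AE_I2)
      fix z
      have "\<bar>w z - h n z\<bar> \<le> 2 * K" using w(2)[of z] hb[of n z] by linarith
      then show "norm (indicator ?B z *\<^sub>R \<bar>w z - h n z\<bar>) \<le> 2 * K * indicat_real ?B z"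
        by (cases "z \<in> ?B") (simp_all add: indicator_def)
    qed
  qed simp
  then have "(\<lambda>n. LBINT z:?B. \<bar>w z - h n z\<bar>) \<longlonglongrightarrow> 0"
    by (simp only: set_lebesgue_integral_def Bochner_Integration.integral_zero)
  from order_tendstoD(2)[OF this \<eta>] obtain n where "(LBINT z:?B. \<bar>w z - h n z\<bar>) < \<eta>"
    by (auto simp: eventually_sequentially)
  then show ?thesis by (rule that[OF hc hb less_imp_le])
qed


lemma continuous_uniform_osc:
  fixes w' :: "real \<times> real \<Rightarrow> real"
  assumes "continuous_on UNIV w'" "0 < \<eta>"
  obtains e1 where "0 < e1" "\<And>x t y \<tau>. y \<in> {-R..R} \<Longrightarrow> \<tau> \<in> {0..T} \<Longrightarrow> \<bar>x - y\<bar> \<le> e1 \<Longrightarrow> \<bar>t - \<tau>\<bar> \<le> e1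
      \<Longrightarrow> \<bar>w' (x, t) - w' (y, \<tau>)\<bar> \<le> \<eta>"
proof -
  let ?B = "cbox (- R - 1, -1) (R + 1, T + 1)"
  have "uniformly_continuous_on ?B w'"
    by (intro compact_uniformly_continuous continuous_on_subset[OF assms(1)]) auto
  then obtain d where d: "0 < d" "\<And>p q. p \<in> ?B \<Longrightarrow> q \<in> ?B \<Longrightarrow> dist p q < d \<Longrightarrow> dist (w' p) (w' q) < \<eta>"
    unfolding uniformly_continuous_on_def using assms(2) by blast
  \<comment> \<open>The bound 1 keeps the displaced point in the enlarged box; d / 4 in each
    coordinate keeps the distance below d.\<close>
  define e1 where "e1 = min 1 (d / 4)"
  show ?thesis
  proof
    show "0 < e1" using d by (simp add: e1_def)
    fix x t y \<tau> assume a: "y \<in> {-R..R}" "\<tau> \<in> {0..T}" "\<bar>x - y\<bar> \<le> e1" "\<bar>t - \<tau>\<bar> \<le> e1"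
    have "dist (x, t) (y, \<tau>) \<le> \<bar>x - y\<bar> + \<bar>t - \<tau>\<bar>"
      unfolding dist_Pair_Pair dist_real_def by (rule order_trans[OF sqrt_sum_squares_le_sum_abs]) simp
    also have "\<dots> \<le> d / 4 + d / 4" using a(3,4) by (intro add_mono) (auto simp: e1_def)
    also have "\<dots> < d" using d(1) by simp
    finally have "dist (x, t) (y, \<tau>) < d" .
    moreover have "(x, t) \<in> ?B" "(y, \<tau>) \<in> ?B" using a by (auto simp: e1_def abs_le_iff)
    ultimately have "dist (w' (x, t)) (w' (y, \<tau>)) < \<eta>" using d(2) by blast
    then show "\<bar>w' (x, t) - w' (y, \<tau>)\<bar> \<le> \<eta>" by (simp add: dist_real_def)
  qed
qed

text \<open>Stated for an abstract candidate \<open>U\<close> with initial potential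
  \<open>G\<close>. \<open>upper\<close> supplies, for each point, a line along which Young's bound
  stays below \<open>U\<close>; \<open>lower\<close> supplies a subsolution k D - (1 + t) f k that
  starts below \<open>G\<close> and ends within h of \<open>U\<close> at the point. Together they
  squeeze the potentials of the mollifications.\<close>

lemma entropy_solution_integral:
  fixes f G U :: "real \<Rightarrow> real"
  assumes v: "entropy_solution f u\<^sub>0 v" and u0m: "u\<^sub>0 \<in> borel_measurable lebesgue"
    and f_cont: "continuous_on UNIV f" and f_even: "\<And>x. f (- x) = f x"
    and f_mono: "\<And>x y. 0 \<le> x \<Longrightarrow> x \<le> y \<Longrightarrow> f x \<le> f y"
    and f_lip: "\<And>K. \<exists>\<Lambda>\<ge>0. \<forall>x y. \<bar>x\<bar> \<le> K \<longrightarrow> \<bar>y\<bar> \<le> K \<longrightarrow> \<bar>f x - f y\<bar> \<le> \<Lambda> * \<bar>x - y\<bar>"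
    and t: "0 \<le> t"
    and init: "\<And>a b. a \<le> b \<Longrightarrow> (LINT x:{a..b}|lebesgue. u\<^sub>0 x) = G b - G a" and G0: "\<And>y. y \<le> 0 \<Longrightarrow> G y = 0"
    and upper: "\<And>x. \<exists>\<kappa> c. (\<forall>v. \<kappa> * v - f v \<le> c) \<and> G (x - \<kappa> * t) + c * t \<le> U x"
    and lower: "\<And>x h. 0 < h \<Longrightarrow> \<exists>k D D'. 0 \<le> k \<and> k \<le> kmax \<and> (\<forall>y. (D has_real_derivative D' y) (at y))
        \<and> continuous_on UNIV D' \<and> (\<forall>y. \<bar>D' y\<bar> \<le> 1) \<and> (\<forall>y. k * D y - f k \<le> G y)
        \<and> U x - h \<le> k * D x - (1 + t) * f k"
    and ab: "a \<le> b"
  shows "(LINT x:{a..b}|lebesgue. v x t) = U b - U a"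
proof -
  obtain w K0 where w: "w \<in> borel_measurable borel" "\<And>z. \<bar>w z\<bar> \<le> K0"
    and vw: "AE z in lborel. 0 \<le> snd z \<longrightarrow> v (fst z) (snd z) = w z"
    and vm: "(\<lambda>z. if 0 \<le> snd z then v (fst z) (snd z) else 0) \<in> borel_measurable lebesgue"
    using entropy_solution_representative[OF v] by blast
  \<comment> \<open>One bound for \<open>w\<close> and for all parameters k, so that the Lipschitz
    constant of \<open>f\<close> on [-K, K] covers both.\<close>
  define K where "K = max K0 (max kmax 0)"
  have K: "0 \<le> K" "kmax \<le> K" "\<And>z. \<bar>w z\<bar> \<le> K" using order_trans[OF w(2) max.cobounded1] by (auto simp: K_def)
  obtain \<Lambda> where \<Lambda>: "0 \<le> \<Lambda>" "\<And>x y. \<bar>x\<bar> \<le> K \<Longrightarrow> \<bar>y\<bar> \<le> K \<Longrightarrow> \<bar>f x - f y\<bar> \<le> \<Lambda> * \<bar>x - y\<bar>"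
    using f_lip[of K] by blast
  have f_meas: "f \<in> borel_measurable borel" by (rule borel_measurable_continuous_onI[OF f_cont])
  have fw: "\<bar>f (w z)\<bar> \<le> \<bar>f 0\<bar> + \<bar>f K\<bar>" for z
  proof -
    have "f \<bar>w z\<bar> = f (w z)" by (simp add: abs_if f_even)
    then show ?thesis using f_mono[of 0 "\<bar>w z\<bar>"] f_mono[of "\<bar>w z\<bar>" K] K(3)[of z] by auto
  qed
  have ent: "0 \<le> conv j j1 (\<lambda>z. \<bar>w z - k\<bar>) y \<tau> + conv j1 j (\<lambda>z. sgn (w z - k) * (f (w z) - f k)) y \<tau>"
    if m: "mollifier e j j1" and test: "test_function (\<lambda>(x, t). j (x - y) * j (t - \<tau>))" and \<tau>: "0 \<le> \<tau>"
    for e j j1 k y \<tau>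
    using v f_meas w(1) K(3) fw vw vm m test \<tau> by (rule representative_entropy)
  have AL: "approx_law e j j1 f w K \<Lambda>"
    if m: "mollifier e j j1" and test: "\<And>y \<tau>. 0 \<le> \<tau> \<Longrightarrow> test_function (\<lambda>(x, t). j (x - y) * j (t - \<tau>))" for e j j1
  proof -
    have "approx_law_axioms j j1 f w K \<Lambda>"
    proof (rule approx_law_axioms.intro)
      show "w \<in> borel_measurable borel" by (rule w(1))
      show "\<bar>w z\<bar> \<le> K" for z by (rule K(3))
      show "continuous_on UNIV f" by (rule f_cont)
      show "f (- x) = f x" for x by (rule f_even)
      show "f x \<le> f y" if "0 \<le> x" "x \<le> y" for x y using that by (rule f_mono)
      show "\<bar>f x - f y\<bar> \<le> \<Lambda> * \<bar>x - y\<bar>" if "\<bar>x\<bar> \<le> K" "\<bar>y\<bar> \<le> K" for x y using that by (rule \<Lambda>(2))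
      show "0 \<le> \<Lambda>" by (rule \<Lambda>(1))
      show "0 \<le> conv j j1 (\<lambda>z. \<bar>w z - k\<bar>) y \<tau> + conv j1 j (\<lambda>z. sgn (w z - k) * (f (w z) - f k)) y \<tau>"
        if "0 \<le> \<tau>" for k y \<tau>
        using m test[OF that] that by (rule ent)
    qed
    with m show ?thesis by (rule approx_law.intro)
  qed
  have u0: "(LINT y:{a..b}|lebesgue. v y 0) = (LINT y:{a..b}|lebesgue. u\<^sub>0 y)" for a b
  proof -
    have ae: "AE x in lebesgue. v x 0 = u\<^sub>0 x" using v by (simp add: entropy_solution_def)
    have "set_integrable lebesgue {a..b} (\<lambda>x. v x 0)"
      using v by (auto simp: entropy_solution_def continuous_L1_loc_def L1_loc_def)
    then have m: "(\<lambda>x. indicator {a..b} x *\<^sub>R v x 0) \<in> borel_measurable lebesgue"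
      by (simp add: set_integrable_def)
    have ae': "AE x in lebesgue. indicator {a..b} x *\<^sub>R v x 0 = indicator {a..b} x *\<^sub>R u\<^sub>0 x"
      using ae by eventually_elim simp
    have "indicat_real {a..b} \<in> borel_measurable lebesgue" by (rule measurable_completion) simp
    then have "(\<lambda>x. indicator {a..b} x *\<^sub>R u\<^sub>0 x) \<in> borel_measurable lebesgue"
      unfolding real_scaleR_def by (rule borel_measurable_times[OF _ u0m])
    then show ?thesis
      unfolding set_lebesgue_integral_def by (intro integral_cong_AE m ae')
  qed
  have slice: "\<exists>e0>0. \<forall>e j j1. e < e0 \<longrightarrow> approx_law e j j1 f w K \<Lambda> \<longrightarrow>
      (\<forall>a b. -R \<le> a \<longrightarrow> a \<le> b \<longrightarrow> b \<le> R \<longrightarrow>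
        \<bar>integral {a..b} (\<lambda>y. conv j j w y \<tau>) - (LINT y:{a..b}|lebesgue. v y \<tau>)\<bar> \<le> \<eta>)"
    if \<tau>: "0 \<le> \<tau>" and \<eta>: "0 < \<eta>" for R \<tau> \<eta>
  proof -
    obtain e1 where e1: "0 < e1" "\<And>a b. -R \<le> a \<Longrightarrow> b \<le> R \<Longrightarrow> AE t in lborel. \<tau> < t \<and> t < \<tau> + e1 \<longrightarrow>
        \<bar>(LBINT y:{a..b}. w (y, t)) - (LINT y:{a..b}|lebesgue. v y \<tau>)\<bar> \<le> \<eta> / 2"
    proof -
      have "0 < \<eta> / 2" using \<eta> by simp
      from representative_slices[OF v w(1) K(3) vw \<tau> this, of R] show thesis using that by blast
    qed
    define e0 where "e0 = min (e1 / 2) (\<eta> / (8 * (K + 1)))"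
    have "0 < e0" using e1 \<eta> K by (simp add: e0_def)
    moreover have "\<bar>integral {a..b} (\<lambda>y. conv j j w y \<tau>) - (LINT y:{a..b}|lebesgue. v y \<tau>)\<bar> \<le> \<eta>"
      if e: "e < e0" and al: "approx_law e j j1 f w K \<Lambda>" and ab: "-R \<le> a" "a \<le> b" "b \<le> R" for e j j1 a b
    proof -
      interpret approx_law e j j1 f w K \<Lambda> by (rule al)
      have "AE t in lborel. \<tau> + e \<le> t \<and> t \<le> \<tau> + 2 * e \<longrightarrow>
          \<bar>(LBINT y:{a..b}. w (y, t)) - (LINT y:{a..b}|lebesgue. v y \<tau>)\<bar> \<le> \<eta> / 2"
        using e1(2)[OF ab(1,3)] by eventually_elim (use e e_pos in \<open>auto simp: e0_def\<close>)
      from integral_moll_slice[OF w(1) K(3) ab(2) this]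
      have "\<bar>integral {a..b} (\<lambda>y. conv j j w y \<tau>) - (LINT y:{a..b}|lebesgue. v y \<tau>)\<bar> \<le> \<eta> / 2 + 4 * K * e" .
      also have "4 * K * e \<le> \<eta> / 2"
      proof -
        have "8 * (K + 1) * e \<le> \<eta>" using e K by (simp add: e0_def pos_less_divide_eq mult.commute)
        moreover have "8 * K * e \<le> 8 * (K + 1) * e" using e_pos by simp
        ultimately show ?thesis by simp
      qed
      finally show ?thesis by simp
    qed
    ultimately show ?thesis by blast
  qed
  have init': "\<exists>e0>0. \<forall>e j j1. e < e0 \<longrightarrow> approx_law e j j1 f w K \<Lambda> \<longrightarrow>
      (\<forall>y\<in>{-R..R}. \<bar>approx_law.pot j f w R y 0 - G y\<bar> \<le> \<eta>)"
    if \<eta>: "0 < \<eta>" and R: "0 \<le> R" for R \<eta>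
  proof -
    from slice[OF order_refl \<eta>, of R] obtain e0 where e0: "0 < e0" "\<And>e j j1 a b. e < e0 \<Longrightarrow> approx_law e j j1 f w K \<Lambda> \<Longrightarrow>
      -R \<le> a \<Longrightarrow> a \<le> b \<Longrightarrow> b \<le> R \<Longrightarrow> \<bar>integral {a..b} (\<lambda>y. conv j j w y 0) - (LINT y:{a..b}|lebesgue. v y 0)\<bar> \<le> \<eta>"
      by blast
    have "\<bar>approx_law.pot j f w R y 0 - G y\<bar> \<le> \<eta>"
      if "e < e0" "approx_law e j j1 f w K \<Lambda>" "y \<in> {-R..R}" for e j j1 y
      using e0(2)[OF that(1,2), of "-R" y] that(3) R u0[of "-R" y] init[of "-R" y] G0[of "-R"]
      by (simp add: approx_law.pot_def[OF that(2)])
    then show ?thesis using e0(1) by blast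
  qed
  \<comment> \<open>The order of choices matters: R is fixed before h, so that both endpoints can
    later share one R; the error \<epsilon>, then the approximant \<open>w'\<close>, then the scale
    of mollification are chosen after both.\<close>
  have pot_lim: "\<exists>R0. \<forall>R\<ge>R0. \<forall>h>0. \<exists>e0>0. \<forall>e j j1. e < e0 \<longrightarrow> approx_law e j j1 f w K \<Lambda> \<longrightarrow>
      \<bar>approx_law.pot j f w R x t - U x\<bar> \<le> h" for x
  proof -
    obtain \<kappa> c where \<kappa>: "\<And>v. \<kappa> * v - f v \<le> c" "G (x - \<kappa> * t) + c * t \<le> U x" using upper[of x] by blast
    \<comment> \<open>Room for x, for the foot of the line through x, and for the cone of slope
      \<Lambda> with the margin required by the lower bound.\<close>
    define R0 where "R0 = \<bar>x\<bar> + \<bar>x - \<kappa> * t\<bar> + (\<Lambda> * t + sqrt (1 + (\<bar>x\<bar> + 1)\<^sup>2) + 1)"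
    have "\<exists>e0>0. \<forall>e j j1. e < e0 \<longrightarrow> approx_law e j j1 f w K \<Lambda> \<longrightarrow> \<bar>approx_law.pot j f w R x t - U x\<bar> \<le> h"
      if R0: "R0 \<le> R" and h: "0 < h" for R h
    proof -
      have "0 \<le> \<Lambda> * t" "0 \<le> sqrt (1 + (\<bar>x\<bar> + 1)\<^sup>2)" using \<Lambda> t by auto
      then have R: "0 \<le> R" "x \<in> {-R..R}" "x - \<kappa> * t \<in> {-R..R}" "\<Lambda> * t + sqrt (1 + (\<bar>x\<bar> + 1)\<^sup>2) + 1 \<le> R"
        using R0 unfolding R0_def atLeastAtMost_iff by linarith+
      \<comment> \<open>The lower bound loses 2 h' and the approximation of \<open>U\<close> one
        more h'; the lower bound also asks for h' \<le> 1.\<close>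
      define h' where "h' = min 1 (h / 4)"
      have h': "0 < h'" "h' \<le> 1" "3 * h' \<le> h" using h by (auto simp: h'_def)
      obtain k D D' where k: "0 \<le> k" "k \<le> kmax" and dD: "\<And>y. (D has_real_derivative D' y) (at y)"
        and D': "continuous_on UNIV D'" "\<And>y. \<bar>D' y\<bar> \<le> 1" and kD: "\<And>y. k * D y - f k \<le> G y"
        and Ux: "U x - h' \<le> k * D x - (1 + t) * f k"
        using lower[OF h'(1), of x] by blast
      have kK: "k \<le> K" using k K by simp
      have "continuous_on {-R..R} D"
        by (rule DERIV_continuous_on[OF has_field_derivative_at_within[OF dD]])
      then have "compact (D ` {-R..R})" by (intro compact_continuous_image) auto
      then obtain MD where MD: "\<And>y. y \<in> {-R..R} \<Longrightarrow> \<bar>D y\<bar> \<le> MD"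
        using compact_imp_bounded[THEN bounded_iff[THEN iffD1]] by (metis image_eqI real_norm_def)
      define M where "M = 2 * R * K + t * (\<bar>f 0\<bar> + \<bar>f K\<bar>) + k * MD + (1 + t) * \<bar>f k\<bar>"
      have M: "2 * R * K + t * (\<bar>f 0\<bar> + \<bar>f K\<bar>) + k * \<bar>D y\<bar> + (1 + t) * \<bar>f k\<bar> \<le> M" if "y \<in> {-R..R}" for y
        unfolding M_def using mult_left_mono[OF MD[OF that] k(1)] by simp
      \<comment> \<open>Every error term carries a factor \<epsilon>, while R, M and K are already
        fixed, so \<epsilon> can be chosen to meet the smallness condition.\<close>
      have "((\<lambda>\<epsilon>. 2 * R * (\<epsilon> ^ 3 * R\<^sup>2) + 3 * \<Lambda> * t * (2 * R * (K * \<epsilon>\<^sup>2 * R\<^sup>2)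
        + 2 * M * R\<^sup>2 * (8 * \<Lambda> * K * (\<epsilon> + 2 * R * t * \<epsilon>)))) \<longlongrightarrow> 0) (at_right 0)"
        by (auto intro!: tendsto_eq_intros)
      moreover have "0 < 2 * (h' / (2 * K + 1)) * h' ^ 3" using h' K by simp
      ultimately have "eventually (\<lambda>\<epsilon>. 2 * R * (\<epsilon> ^ 3 * R\<^sup>2) + 3 * \<Lambda> * t * (2 * R * (K * \<epsilon>\<^sup>2 * R\<^sup>2)
        + 2 * M * R\<^sup>2 * (8 * \<Lambda> * K * (\<epsilon> + 2 * R * t * \<epsilon>))) < 2 * (h' / (2 * K + 1)) * h' ^ 3) (at_right 0)"
        by (rule order_tendstoD(2))
      moreover have "eventually (\<lambda>\<epsilon>::real. \<epsilon> > 0) (at_right 0)" by (simp add: eventually_at_right_less)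
      ultimately have "eventually (\<lambda>\<epsilon>. 0 < \<epsilon> \<and> 2 * R * (\<epsilon> ^ 3 * R\<^sup>2) + 3 * \<Lambda> * t * (2 * R * (K * \<epsilon>\<^sup>2 * R\<^sup>2)
        + 2 * M * R\<^sup>2 * (8 * \<Lambda> * K * (\<epsilon> + 2 * R * t * \<epsilon>))) < 2 * (h' / (2 * K + 1)) * h' ^ 3) (at_right 0)"
        by eventually_elim simp
      then obtain \<epsilon> where \<epsilon>: "0 < \<epsilon>" and small: "2 * R * (\<epsilon> ^ 3 * R\<^sup>2) + 3 * \<Lambda> * t * (2 * R * (K * \<epsilon>\<^sup>2 * R\<^sup>2)
        + 2 * M * R\<^sup>2 * (8 * \<Lambda> * K * (\<epsilon> + 2 * R * t * \<epsilon>))) < 2 * (h' / (2 * K + 1)) * h' ^ 3"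
        using eventually_happens'[OF trivial_limit_at_right_real] by blast
      obtain w' where w': "continuous_on UNIV w'" "\<And>z. \<bar>w' z\<bar> \<le> K"
        "(LBINT z : {-R..R+1} \<times> {0..t+1}. \<bar>w z - w' z\<bar>) \<le> \<epsilon>"
        using L1_approx_continuous[OF w(1) K(3) \<epsilon>, of "-R" "R + 1" 0 "t + 1"] by blast
      obtain e1 where e1: "0 < e1" "\<And>x s y \<tau>. y \<in> {-R..R} \<Longrightarrow> \<tau> \<in> {0..t} \<Longrightarrow> \<bar>x - y\<bar> \<le> e1 \<Longrightarrow> \<bar>s - \<tau>\<bar> \<le> e1
          \<Longrightarrow> \<bar>w' (x, s) - w' (y, \<tau>)\<bar> \<le> \<epsilon>"
        using continuous_uniform_osc[OF w'(1) \<epsilon>, of R t] by blast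
      obtain e2 where e2: "0 < e2" "\<And>e j j1 y. e < e2 \<Longrightarrow> approx_law e j j1 f w K \<Lambda> \<Longrightarrow> y \<in> {-R..R} \<Longrightarrow>
          \<bar>approx_law.pot j f w R y 0 - G y\<bar> \<le> min \<epsilon> h'"
      proof -
        have "0 < min \<epsilon> h'" using \<epsilon> h' by simp
        from init'[OF this R(1)] show thesis using that by blast
      qed
      define e0 where "e0 = min e2 (min (e1 / 2) (1 / 2))"
      have "0 < e0" using e1 e2 by (simp add: e0_def)
      moreover have "\<bar>approx_law.pot j f w R x t - U x\<bar> \<le> h"
        if e: "e < e0" and al: "approx_law e j j1 f w K \<Lambda>" for e j j1
      proof -
        interpret approx_law e j j1 f w K \<Lambda> by (rule al)
        have p0: "\<bar>pot R y 0 - G y\<bar> \<le> \<epsilon>" "\<bar>pot R y 0 - G y\<bar> \<le> h'" if "y \<in> {-R..R}" for y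
          using e2(2)[OF _ al that] e by (auto simp: e0_def)
        have "pot R x t \<le> pot R (x - \<kappa> * t) 0 + c * t"
          by (rule pot_upper[OF t R(2,3) \<kappa>(1)])
        then have up: "pot R x t \<le> U x + h'" using p0(2)[OF R(3)] \<kappa>(2) by linarith
        have "k * D x - (1 + t) * f k - 2 * h' \<le> pot R x t"
        proof (rule pot_lower_quantitative[OF t R(1) k(1) kK _ dD D' _ _ _ w'(2) w'(1) _ _ w'(3) M R(4) h'(1,2) small])
          show "2 * e \<le> 1" using e by (simp add: e0_def)
          show "k * D y - f k - \<epsilon> \<le> pot R y 0" if "y \<in> {-R..R}" for y using p0(1)[OF that] kD[of y] by linarith
          show "w' \<in> borel_measurable borel" by (rule borel_measurable_continuous_onI[OF w'(1)])
          show "\<bar>w' (x, s) - w' (y, \<tau>)\<bar> \<le> \<epsilon>"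
            if "y \<in> {-R..R}" "\<tau> \<in> {0..t}" "e \<le> x - y" "x - y \<le> 2 * e" "e \<le> s - \<tau>" "s - \<tau> \<le> 2 * e" for x s y \<tau>
            by (rule e1(2)) (use that e e_pos in \<open>auto simp: e0_def\<close>)
        qed (use \<epsilon> in auto)
        then show ?thesis using up Ux h'(3) by (simp add: abs_le_iff)
      qed
      ultimately show ?thesis by blast
    qed
    then show ?thesis by blast
  qed
  obtain Ra where Ra: "\<And>R h. Ra \<le> R \<Longrightarrow> 0 < h \<Longrightarrow> \<exists>e0>0. \<forall>e j j1. e < e0 \<longrightarrow> approx_law e j j1 f w K \<Lambda> \<longrightarrow>
      \<bar>approx_law.pot j f w R a t - U a\<bar> \<le> h" using pot_lim[of a] by blast
  obtain Rb where Rb: "\<And>R h. Rb \<le> R \<Longrightarrow> 0 < h \<Longrightarrow> \<exists>e0>0. \<forall>e j j1. e < e0 \<longrightarrow> approx_law e j j1 f w K \<Lambda> \<longrightarrow>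
      \<bar>approx_law.pot j f w R b t - U b\<bar> \<le> h" using pot_lim[of b] by blast
  define R where "R = max (max Ra Rb) (max \<bar>a\<bar> \<bar>b\<bar>)"
  have R: "Ra \<le> R" "Rb \<le> R" "a \<in> {-R..R}" "b \<in> {-R..R}" by (auto simp: R_def)
  have close: "\<bar>(LINT x:{a..b}|lebesgue. v x t) - (U b - U a)\<bar> \<le> 0 + h" if h: "0 < h" for h
  proof -
    have h3: "0 < h / 3" using h by simp
    obtain ea where ea: "0 < ea" "\<And>e j j1. e < ea \<Longrightarrow> approx_law e j j1 f w K \<Lambda> \<Longrightarrow> \<bar>approx_law.pot j f w R a t - U a\<bar> \<le> h / 3"
      using Ra[OF R(1) h3] by blast
    obtain eb where eb: "0 < eb" "\<And>e j j1. e < eb \<Longrightarrow> approx_law e j j1 f w K \<Lambda> \<Longrightarrow> \<bar>approx_law.pot j f w R b t - U b\<bar> \<le> h / 3"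
      using Rb[OF R(2) h3] by blast
    obtain ec where ec: "0 < ec" "\<And>e j j1 a b. e < ec \<Longrightarrow> approx_law e j j1 f w K \<Lambda> \<Longrightarrow> -R \<le> a \<Longrightarrow> a \<le> b \<Longrightarrow> b \<le> R \<Longrightarrow>
        \<bar>integral {a..b} (\<lambda>y. conv j j w y t) - (LINT y:{a..b}|lebesgue. v y t)\<bar> \<le> h / 3"
      using slice[OF t h3, of R] by blast
    define e where "e = min ea (min eb ec) / 2"
    have e: "0 < e" "e < ea" "e < eb" "e < ec" using ea(1) eb(1) ec(1) by (auto simp: e_def)
    obtain j j1 where jj: "\<And>x. (j has_real_derivative j1 x) (at x)" "continuous_on UNIV j1" "\<And>x. 0 \<le> j x"
      "\<And>x. x \<notin> {e..2 * e} \<Longrightarrow> j x = 0 \<and> j1 x = 0" "integral\<^sup>L lborel j = 1"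
      "\<And>y \<tau>. 0 \<le> \<tau> \<Longrightarrow> test_function (\<lambda>(x, t). j (x - y) * j (t - \<tau>))"
      using exists_kernel[OF e(1)] by blast
    have "mollifier e j j1" by unfold_locales (use e(1) jj in auto)
    then have al: "approx_law e j j1 f w K \<Lambda>" using jj(6) by (rule AL)
    interpret approx_law e j j1 f w K \<Lambda> by (rule al)
    have "((\<lambda>y. moll w y t) has_integral (pot R b t - pot R a t)) {a..b}"
    proof (rule fundamental_theorem_of_calculus[OF ab])
      fix y assume "y \<in> {a..b}"
      then have "((\<lambda>y. pot R y t) has_real_derivative moll w y t) (at y within {a..b})"
        using R by (intro has_field_derivative_subset[OF pot_deriv_y[OF _ t]]) auto
      then show "((\<lambda>y. pot R y t) has_vector_derivative moll w y t) (at y within {a..b})"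
        by (simp add: has_real_derivative_iff_has_vector_derivative)
    qed
    then have ih: "integral {a..b} (\<lambda>y. moll w y t) = pot R b t - pot R a t" by (rule integral_unique)
    have "-R \<le> a" "b \<le> R" using R by auto
    from ec(2)[OF e(4) al this(1) ab this(2)] show ?thesis
      using ea(2)[OF e(2) al] eb(2)[OF e(3) al] unfolding ih by linarith
  qed
  then have "\<bar>(LINT x:{a..b}|lebesgue. v x t) - (U b - U a)\<bar> \<le> 0" by (rule field_le_epsilon)
  then show ?thesis by simp
qed

section \<open>The explicit solution\<close>

text \<open>The shift by 2 keeps the logarithm positive from n = 0 on. The sequence decreases to 0,
  so gaps are numbered from right to left and accumulate only at 0.\<close>

definition node :: "nat \<Rightarrow> real" where
  "node n = 1 / ln (real n + 2)"

definition mid :: "nat \<Rightarrow> real" where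
  "mid n = (node n + node (Suc n)) / 2"

definition half :: "nat \<Rightarrow> real" where
  "half n = (node n - node (Suc n)) / 2"

section \<open>Gaps, signed distance and projection\<close>

lemma node_pos: "0 < node n"
  by (simp add: node_def)

lemma node_Suc_less: "node (Suc n) < node n"
  by (auto simp: node_def intro!: divide_strict_left_mono mult_pos_pos)

lemma node_antimono: "m \<le> n \<Longrightarrow> node n \<le> node m"
  using lift_Suc_antimono_le[of node m n] node_Suc_less by (simp add: less_imp_le)

lemma node_tendsto: "node \<longlonglongrightarrow> 0"
  unfolding node_def by real_asymp

lemma half_pos: "0 < half n"
  using node_Suc_less[of n] by (simp add: half_def)

lemma mid_bounds: "node (Suc n) < mid n" "mid n < node n"
  using node_Suc_less[of n] by (simp_all add: mid_def)

lemma mid_half: "mid n - half n = node (Suc n)" "mid n + half n = node n"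
  by (simp_all add: mid_def half_def field_simps)

text \<open>
  The signed distance to the complement of the gaps \<open>(node (n+1), node n)\<close>; it is positive on the
  left half of each gap and negative on the right half.
\<close>
definition sdist :: "real \<Rightarrow> real" where
  "sdist x = (if x \<le> 0 \<or> node 0 \<le> x then 0 else
     let n = LEAST n. node (Suc n) < x in if x \<le> mid n then x - node (Suc n) else x - node n)"

lemma node_below: "0 < x \<Longrightarrow> \<exists>n. node n < x"
  using order_tendstoD(2)[OF node_tendsto] by (auto simp: eventually_sequentially)

lemma gap_exists:
  assumes "0 < x" "x < node 0"
  obtains n where "node (Suc n) < x" "x \<le> node n" "n = (LEAST n. node (Suc n) < x)"
proof -
  define n where "n = (LEAST n. node (Suc n) < x)"
  obtain m where m: "node m < x" using node_below[OF assms(1)] by blast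
  then have "node (Suc m) < x" using node_Suc_less[of m] by linarith
  then have 1: "node (Suc n) < x" unfolding n_def by (rule LeastI)
  have "x \<le> node n"
  proof (cases n)
    case 0
    then show ?thesis using assms by simp
  next
    case (Suc k)
    then have "\<not> node (Suc k) < x" using not_less_Least[of k "\<lambda>n. node (Suc n) < x"] by (simp add: n_def)
    then show ?thesis using Suc by simp
  qed
  with 1 show ?thesis using that n_def by blast
qed

lemma gap_unique:
  assumes "node (Suc n) < x" "x \<le> node n" "node (Suc m) < x" "x \<le> node m"
  shows "n = m"
proof (rule ccontr)
  assume "n \<noteq> m"
  then consider "Suc n \<le> m" | "Suc m \<le> n" by linarith
  then show False using node_antimono[of "Suc n" m] node_antimono[of "Suc m" n] assms by cases linarith+
qed

lemma sdist_outside: "x \<le> 0 \<or> node 0 \<le> x \<Longrightarrow> sdist x = 0"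
  by (simp add: sdist_def)

lemma sdist_gap:
  assumes "node (Suc n) < x" "x \<le> node n"
  shows "sdist x = (if x \<le> mid n then x - node (Suc n) else x - node n)"
proof (cases "node 0 \<le> x")
  case True
  \<comment> \<open>At x = node 0 the definition takes its outer branch; the gap formula agrees
    there because its right half vanishes at the node.\<close>
  then have "x = node n" "node n = node 0" using assms node_antimono[of 0 n] by auto
  then have "x = node 0" by simp
  moreover have "n = 0" using node_antimono[of 1 n] node_Suc_less[of 0] \<open>node n = node 0\<close> by (cases n) auto
  ultimately show ?thesis using mid_bounds[of 0] by (simp add: sdist_def)
next
  case False
  have x: "0 < x" using assms(1) node_pos[of "Suc n"] by linarith
  from gap_exists[OF x] False obtain m where m: "node (Suc m) < x" "x \<le> node m" "m = (LEAST n. node (Suc n) < x)"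
    by (metis not_le)
  then have "n = m" using gap_unique[OF assms] by blast
  then show ?thesis using m(3) x False by (simp add: sdist_def Let_def)
qed

lemma sdist_left: "node (Suc n) \<le> x \<Longrightarrow> x \<le> mid n \<Longrightarrow> sdist x = x - node (Suc n)"
proof (cases "x = node (Suc n)")
  case True
  \<comment> \<open>In the half-open convention of \<open>sdist_gap\<close> a node is the right end
    of the gap with the next index.\<close>
  show ?thesis using sdist_gap[of "Suc n" x] True node_Suc_less[of "Suc n"] mid_bounds[of "Suc n"] by simp
next
  assume "node (Suc n) \<le> x" "x \<le> mid n" "x \<noteq> node (Suc n)"
  then show ?thesis using sdist_gap[of n x] mid_bounds[of n] by simp
qed

lemma sdist_right: "mid n < x \<Longrightarrow> x \<le> node n \<Longrightarrow> sdist x = x - node n"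
  using sdist_gap[of n x] mid_bounds[of n] by simp

lemma abs_sdist_gap:
  assumes "node (Suc n) \<le> x" "x \<le> node n"
  shows "\<bar>sdist x\<bar> = half n - \<bar>x - mid n\<bar>"
proof (cases "x \<le> mid n")
  case True
  then show ?thesis using sdist_left[of n x] assms mid_half[of n] by simp
next
  case False
  then show ?thesis using sdist_right[of n x] assms mid_half[of n] by simp
qed

lemma gap_cases:
  obtains "x \<le> 0" | "node 0 \<le> x" | n where "node (Suc n) < x" "x \<le> node n"
  using gap_exists[of x] by (metis not_le)

text \<open>Outside its gap the tent is nonpositive. So the distance dominates every tent and equals
  one of them inside a gap, which yields the Lipschitz bound and the comparison functions of the
  lower estimate.\<close>

lemma tent_le_sdist: "half n - \<bar>y - mid n\<bar> \<le> \<bar>sdist y\<bar>"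
proof (cases "node (Suc n) \<le> y \<and> y \<le> node n")
  case True
  then show ?thesis using abs_sdist_gap[of n y] by simp
next
  case False
  then have "half n \<le> \<bar>y - mid n\<bar>" using mid_half[of n] half_pos[of n] by auto
  then show ?thesis by (smt (verit) abs_ge_zero)
qed

lemma abs_sdist_lip: "\<bar>\<bar>sdist x\<bar> - \<bar>sdist y\<bar>\<bar> \<le> \<bar>x - y\<bar>"
proof -
  have *: "\<bar>sdist x\<bar> \<le> \<bar>sdist y\<bar> + \<bar>x - y\<bar>" for x y
  proof (cases x rule: gap_cases)
    case (3 n)
    then have "\<bar>sdist x\<bar> = half n - \<bar>x - mid n\<bar>" by (simp add: abs_sdist_gap)
    then show ?thesis using tent_le_sdist[of n y] by linarith
  qed (auto simp: sdist_outside)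
  show ?thesis using *[of x y] *[of y x] by linarith
qed

text \<open>A nearest point of the complement of the gaps, taken to the left at midpoints. Writing
  \<open>sdist\<close> as the identity minus a monotone map gives measurability and, later, the
  bound on the variation.\<close>

definition proj :: "real \<Rightarrow> real" where
  "proj x = x - sdist x"

lemma proj_gap:
  assumes "node (Suc n) < x" "x \<le> node n"
  shows "proj x = node (Suc n) \<or> proj x = node n" "proj x = (if x \<le> mid n then node (Suc n) else node n)"
  using sdist_gap[OF assms] by (auto simp: proj_def)

lemma sdist_node: "sdist (node n) = 0"
  using sdist_gap[of n "node n"] node_Suc_less[of n] mid_bounds[of n] by simp

lemma sdist_proj: "sdist (proj x) = 0"
proof (cases x rule: gap_cases)
  case (3 n)
  then show ?thesis using proj_gap(1)[of n x] sdist_node by auto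
qed (auto simp: proj_def sdist_outside)

text \<open>Each gap is sent to its two endpoints in order and everything else is fixed; for points
  of different gaps an intervening node separates the images.\<close>

lemma proj_mono: "mono proj"
proof (rule monoI)
  fix x y :: real assume xy: "x \<le> y"
  have up: "proj x \<le> node 0" if "x \<le> node 0" for x
  proof (cases x rule: gap_cases)
    case (3 n)
    then show ?thesis using proj_gap(1)[of n x] node_antimono[of 0 n] node_antimono[of 0 "Suc n"] by auto
  qed (use that node_pos[of 0] in \<open>auto simp: proj_def sdist_outside\<close>)
  have low: "0 \<le> proj y" if "0 \<le> y" for y
  proof (cases y rule: gap_cases)
    case (3 n)
    then show ?thesis using proj_gap(1)[of n y] node_pos[of n] node_pos[of "Suc n"] by auto
  qed (use that in \<open>auto simp: proj_def sdist_outside\<close>)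
  show "proj x \<le> proj y"
  proof (cases y rule: gap_cases)
    case 1
    then show ?thesis using xy by (simp add: proj_def sdist_outside)
  next
    case 2
    then have y: "proj y = y" by (simp add: proj_def sdist_outside)
    show ?thesis
    proof (cases "node 0 \<le> x")
      case True
      then show ?thesis using y xy by (simp add: proj_def sdist_outside)
    next
      case False
      then show ?thesis using up[of x] y 2 by simp
    qed
  next
    case (3 n)
    note n = this
    have y0: "node (Suc n) \<le> proj y" using proj_gap(1)[OF n] node_Suc_less[of n] by auto
    show ?thesis
    proof (cases x rule: gap_cases)
      case 1
      then show ?thesis using low[of y] n(1) node_pos[of "Suc n"] by (simp add: proj_def sdist_outside)
    next
      case 2
      then have "x = node n" "x = y" using n xy node_antimono[of 0 n] by auto
      then show ?thesis by simp
    next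
      case (3 m)
      show ?thesis
      proof (cases "m = n")
        case True
        then show ?thesis using proj_gap(2)[OF n] proj_gap(2)[OF 3] xy node_Suc_less[of n] by auto
      next
        case False
        have "Suc n \<le> m"
        proof (rule ccontr)
          assume "\<not> Suc n \<le> m"
          then have "Suc m \<le> n" using False by simp
          then have "node n \<le> node (Suc m)" by (rule node_antimono)
          then show False using 3 n xy by linarith
        qed
        then have "node m \<le> node (Suc n)" by (rule node_antimono)
        then show ?thesis using proj_gap(1)[OF 3] node_Suc_less[of m] y0 by auto
      qed
    qed
  qed
qed

lemma sdist_measurable [measurable]: "sdist \<in> borel_measurable borel"
proof -
  have "proj \<in> borel_measurable borel" by (rule borel_measurable_mono[OF proj_mono])
  then have "(\<lambda>x. x - proj x) \<in> borel_measurable borel" by measurable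
  then show ?thesis by (simp add: proj_def)
qed

lemma abs_sdist_le: "\<bar>sdist x\<bar> \<le> node 0"
proof (cases x rule: gap_cases)
  case (3 n)
  then have "\<bar>sdist x\<bar> \<le> half n" using abs_sdist_gap[of n x] by simp
  also have "\<dots> \<le> node n" using node_pos[of n] node_pos[of "Suc n"] by (simp add: half_def)
  also have "\<dots> \<le> node 0" by (rule node_antimono) simp
  finally show ?thesis .
qed (use node_pos[of 0] in \<open>auto simp: sdist_outside\<close>)

lemma abs_sdist_cont: "continuous_on UNIV (\<lambda>x. \<bar>sdist x\<bar>)"
  by (rule lipschitz_on_continuous_on[of 1], rule lipschitz_onI) (use abs_sdist_lip in \<open>auto simp: dist_real_def\<close>)

definition sol :: "real \<Rightarrow> real \<Rightarrow> real \<Rightarrow> real" where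
  "sol s x t = sgn (sdist x) * (\<bar>sdist x\<bar> / (1 + t)) powr s"

text \<open>(1 + t) times the convex conjugate of \<open>f\<close> at the speed sdist x / (1 + t),
  the Legendre form on which the Young arguments rest.\<close>

definition solpot :: "real \<Rightarrow> real \<Rightarrow> real \<Rightarrow> real" where
  "solpot s x t = (1 + t) * (\<bar>sdist x\<bar> / (1 + t)) powr (1 + s) / (1 + s)"

section \<open>The solution as the derivative of its potential\<close>

lemma sol_measurable: "(\<lambda>x. sol s x t) \<in> borel_measurable borel"
  unfolding sol_def by measurable

lemma sol_bound: "0 \<le> s \<Longrightarrow> 0 \<le> t \<Longrightarrow> \<bar>sol s x t\<bar> \<le> node 0 powr s"
proof -
  assume s: "0 \<le> s" and t: "0 \<le> t"
  have "\<bar>sdist x\<bar> / (1 + t) \<le> node 0 / 1"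
    using abs_sdist_le[of x] t by (intro frac_le) auto
  then have "(\<bar>sdist x\<bar> / (1 + t)) powr s \<le> node 0 powr s" using s t by (intro powr_mono2) auto
  then show ?thesis by (simp add: sol_def abs_mult abs_sgn_eq)
qed

lemma solpot_cont:
  assumes "0 \<le> s" "0 \<le> t"
  shows "continuous_on UNIV (\<lambda>x. solpot s x t)"
  unfolding solpot_def using assms
  by (intro continuous_intros continuous_on_powr' abs_sdist_cont) auto

lemma powr_has_derivative:
  fixes a :: real
  assumes "0 < (x - a) * \<sigma>" "\<sigma> = 1 \<or> \<sigma> = - 1" "0 < c"
  shows "((\<lambda>x. ((x - a) * \<sigma> / c) powr r) has_real_derivative r * \<sigma> * ((x - a) * \<sigma> / c) powr (r - 1) / c) (at x)"
  using assms by (auto intro!: derivative_eq_intros simp: powr_diff field_simps)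

text \<open>On each half gap the potential is a shifted power. Excluded are 0, where the gaps
  accumulate, and the nodes and midpoints, where the branch changes.\<close>

lemma solpot_has_derivative:
  assumes s: "0 < s" and t: "0 \<le> t" and x: "x \<noteq> 0" "x \<notin> range node" "x \<notin> range mid"
  shows "((\<lambda>x. solpot s x t) has_real_derivative sol s x t) (at x)"
proof (cases x rule: gap_cases)
  case 1
  then have "x < 0" using x by simp
  have "((\<lambda>x. 0) has_real_derivative 0) (at x)" by simp
  then have "((\<lambda>x. solpot s x t) has_real_derivative 0) (at x)"
    by (rule has_field_derivative_transform_within_open[where S = "{..<0}"])
       (use \<open>x < 0\<close> in \<open>auto simp: solpot_def sdist_outside\<close>)
  then show ?thesis using \<open>x < 0\<close> by (simp add: sol_def sdist_outside)
next
  case 2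
  then have "node 0 < x" using x by (metis order_le_less rangeI)
  have "((\<lambda>x. 0) has_real_derivative 0) (at x)" by simp
  then have "((\<lambda>x. solpot s x t) has_real_derivative 0) (at x)"
    by (rule has_field_derivative_transform_within_open[where S = "{node 0<..}"])
       (use \<open>node 0 < x\<close> in \<open>auto simp: solpot_def sdist_outside\<close>)
  then show ?thesis using \<open>node 0 < x\<close> by (simp add: sol_def sdist_outside)
next
  case (3 n)
  then have n: "node (Suc n) < x" "x < node n" "x \<noteq> mid n" using x by (auto simp: order_le_less)
  show ?thesis
  proof (cases "x < mid n")
    case True
    have sd: "sdist y = y - node (Suc n)" if "y \<in> {node (Suc n)<..<mid n}" for y
      using that by (intro sdist_left) auto
    have "((\<lambda>y. (1 + t) * ((y - node (Suc n)) * 1 / (1 + t)) powr (1 + s) / (1 + s)) has_real_derivative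
        (1 + t) * ((1 + s) * 1 * ((x - node (Suc n)) * 1 / (1 + t)) powr ((1 + s) - 1) / (1 + t)) / (1 + s)) (at x)"
      using n t by (intro DERIV_cdivide DERIV_cmult powr_has_derivative) auto
    also have "(1 + t) * ((1 + s) * 1 * ((x - node (Suc n)) * 1 / (1 + t)) powr ((1 + s) - 1) / (1 + t)) / (1 + s) = sol s x t"
      using n True sd[of x] s t by (simp add: sol_def)
    finally show ?thesis
      by (rule has_field_derivative_transform_within_open[where S = "{node (Suc n)<..<mid n}"])
         (use n True sd in \<open>auto simp: solpot_def\<close>)
  next
    case False
    then have m: "mid n < x" using n by simp
    have sd: "sdist y = y - node n" if "y \<in> {mid n<..<node n}" for y
      using that by (intro sdist_right) auto
    have "((\<lambda>y. (1 + t) * ((y - node n) * -1 / (1 + t)) powr (1 + s) / (1 + s)) has_real_derivative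
        (1 + t) * ((1 + s) * -1 * ((x - node n) * -1 / (1 + t)) powr ((1 + s) - 1) / (1 + t)) / (1 + s)) (at x)"
      using n t by (intro DERIV_cdivide DERIV_cmult powr_has_derivative) auto
    also have "(1 + t) * ((1 + s) * -1 * ((x - node n) * -1 / (1 + t)) powr ((1 + s) - 1) / (1 + t)) / (1 + s) = sol s x t"
      using n m sd[of x] s t by (simp add: sol_def, simp add: divide_simps algebra_simps)
    finally show ?thesis
      by (rule has_field_derivative_transform_within_open[where S = "{mid n<..<node n}"])
         (use n m sd in \<open>auto simp: solpot_def\<close>)
  qed
qed

text \<open>Nodes and midpoints accumulate only at 0, so away from 0 the fundamental theorem with
  finitely many exceptions applies.\<close>

lemma finite_special: "0 < a \<Longrightarrow> finite {x \<in> {a..b}. x \<in> range node \<or> x \<in> range mid}"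
proof -
  assume "0 < a"
  then obtain N where N: "node N < a" using node_below by blast
  have "{x \<in> {a..b}. x \<in> range node \<or> x \<in> range mid} \<subseteq> node ` {..N} \<union> mid ` {..N}"
  proof
    fix x assume "x \<in> {x \<in> {a..b}. x \<in> range node \<or> x \<in> range mid}"
    then have "a \<le> x" and "(\<exists>m. x = node m) \<or> (\<exists>m. x = mid m)" by auto
    then show "x \<in> node ` {..N} \<union> mid ` {..N}"
    proof (elim disjE exE)
      fix m assume "x = node m"
      then have "m \<le> N" using \<open>a \<le> x\<close> N node_antimono[of N m] by (cases "m \<le> N") auto
      then show ?thesis using \<open>x = node m\<close> by auto
    next
      fix m assume "x = mid m"
      then have "m \<le> N" using \<open>a \<le> x\<close> N node_antimono[of N m] mid_bounds[of m] by (cases "m \<le> N") auto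
      then show ?thesis using \<open>x = mid m\<close> by auto
    qed
  qed
  then show ?thesis by (rule finite_subset) auto
qed

lemma sol_has_integral_pos:
  assumes "0 < s" "0 \<le> t" "0 < a" "a \<le> b"
  shows "((\<lambda>x. sol s x t) has_integral (solpot s b t - solpot s a t)) {a..b}"
proof (rule fundamental_theorem_of_calculus_strong[OF finite_special[OF assms(3), of b] assms(4)])
  show "((\<lambda>x. solpot s x t) has_vector_derivative sol s x t) (at x)"
    if "x \<in> {a..b} - {x \<in> {a..b}. x \<in> range node \<or> x \<in> range mid}" for x
    using that assms solpot_has_derivative[of s t x] by (auto simp: has_real_derivative_iff_has_vector_derivative)
  show "continuous_on {a..b} (\<lambda>x. solpot s x t)"
    using solpot_cont[of s t] assms by (auto intro: continuous_on_subset)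
qed

lemma sol_set_integrable:
  assumes "0 \<le> s" "0 \<le> t"
  shows "set_integrable lborel {a..b} (\<lambda>x. sol s x t)"
  unfolding set_integrable_def
proof (rule Bochner_Integration.integrable_bound)
  show "integrable lborel (\<lambda>x. node 0 powr s * indicat_real {a..b} x)"
    by (intro integrable_mult_right integrable_real_indicator) (auto simp: emeasure_lborel_Icc_eq)
  show "(\<lambda>x. indicat_real {a..b} x *\<^sub>R sol s x t) \<in> borel_measurable lborel"
    using sol_measurable by simp
  show "AE x in lborel. norm (indicat_real {a..b} x *\<^sub>R sol s x t) \<le> norm (node 0 powr s * indicat_real {a..b} x)"
    using sol_bound[OF assms] by (intro AE_I2) (simp add: indicator_def)
qed

text \<open>Infinitely many exceptional points lie near 0. The formula is first taken on [x, b] with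
  x > 0 and then carried to x = 0 by continuity of both sides; left of 0 everything
  vanishes.\<close>

lemma sol_integral:
  assumes s: "0 < s" and t: "0 \<le> t" and ab: "a \<le> b"
  shows "(LBINT x:{a..b}. sol s x t) = solpot s b t - solpot s a t"
proof -
  let ?u = "\<lambda>x. sol s x t" and ?H = "\<lambda>x. solpot s x t"
  have int: "?u integrable_on {a..b}" for a b
    using set_borel_integral_eq_integral(1)[OF sol_set_integrable] s t by simp
  have z: "?u x = 0" "?H x = 0" if "x \<le> 0" for x
    using that s by (simp_all add: sol_def solpot_def sdist_outside)
  have pos: "integral {0..b} ?u = ?H b" if b: "0 < b" for b
  proof -
    have "continuous_on {0..b} (\<lambda>x. integral {x..b} ?u)" by (rule indefinite_integral_continuous_1'[OF int])
    then have "((\<lambda>x. integral {x..b} ?u) \<longlongrightarrow> integral {0..b} ?u) (at 0 within {0..b})"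
      using b by (auto simp: continuous_on_def)
    moreover have "((\<lambda>x. ?H b - ?H x) \<longlongrightarrow> ?H b - ?H 0) (at 0 within {0..b})"
      using solpot_cont[of s t] s t continuous_on_subset[of UNIV ?H "{0..b}"] b
      by (intro tendsto_diff) (auto simp: continuous_on_def)
    then have "((\<lambda>x. integral {x..b} ?u) \<longlongrightarrow> ?H b - ?H 0) (at 0 within {0..b})"
    proof (rule Lim_transform_eventually)
      show "eventually (\<lambda>x. ?H b - ?H x = integral {x..b} ?u) (at 0 within {0..b})"
        unfolding eventually_at
        by (rule exI[of _ 1]) (auto simp: integral_unique[OF sol_has_integral_pos[OF s t]])
    qed
    moreover have "at 0 within {0..b} \<noteq> bot"
      using b by (simp add: at_within_Icc_at_right trivial_limit_at_right_real)
    ultimately have "integral {0..b} ?u = ?H b - ?H 0" by (rule tendsto_unique[rotated 1, OF _ _])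
    then show ?thesis using z(2)[of 0] by simp
  qed
  have "integral {a..b} ?u = ?H b - ?H a"
  proof -
    consider "b \<le> 0" | "0 < a" | "a \<le> 0" "0 < b" by linarith
    then show ?thesis
    proof cases
      case 1
      have "integral {a..b} ?u = integral {a..b} (\<lambda>x. 0)" by (rule integral_cong) (use 1 z in auto)
      then show ?thesis using 1 z(2)[of a] z(2)[of b] ab by simp
    next
      case 2
      then show ?thesis using sol_has_integral_pos[OF s t 2 ab] by (simp add: integral_unique)
    next
      case 3
      have "integral {a..0} ?u = integral {a..0} (\<lambda>x. 0)" by (rule integral_cong) (use z in auto)
      moreover have "integral {a..0} ?u + integral {0..b} ?u = integral {a..b} ?u"
        by (rule Henstock_Kurzweil_Integration.integral_combine[OF _ _ int]) (use 3 in auto)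
      ultimately show ?thesis using pos[OF 3(2)] z(2)[OF 3(1)] by simp
    qed
  qed
  then show ?thesis using set_borel_integral_eq_integral(2)[OF sol_set_integrable] s t by simp
qed

section \<open>Uniqueness of the explicit solution\<close>

locale power_flux =
  fixes p s :: real and f :: "real \<Rightarrow> real"
  assumes p: "p \<ge> 1" and s_def: "s = 1 / p" and f_def: "f = (\<lambda>u. \<bar>u\<bar> powr (p + 1) / (p + 1))"
begin

section \<open>The power flux and its convex conjugate\<close>

lemma s_pos: "0 < s" and s_le: "s \<le> 1" and ps: "p * s = 1" "s * p = 1"
  using p by (auto simp: s_def)

lemma conj_exp: "(p + 1) * s = 1 + s" "1 / (1 + s) = p / (p + 1)"
  using p by (auto simp: s_def field_simps)

lemma f_even: "f (- x) = f x"
  by (simp add: f_def)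

lemma f_zero: "f 0 = 0"
  by (simp add: f_def)

lemma f_cont: "continuous_on UNIV f"
  unfolding f_def using p by (intro continuous_intros continuous_on_powr') auto

lemma f_mono: "0 \<le> x \<Longrightarrow> x \<le> y \<Longrightarrow> f x \<le> f y"
  unfolding f_def using p by (intro divide_right_mono powr_mono2) auto

text \<open>p + 1 and 1 + s are conjugate exponents, so the right side is the convex conjugate of
  \<open>f\<close>; \<open>young_eq\<close> is the case of equality.\<close>

lemma young: "\<kappa> * v - f v \<le> \<bar>\<kappa>\<bar> powr (1 + s) / (1 + s)"
proof -
  have "\<bar>v\<bar> * \<bar>\<kappa>\<bar> \<le> \<bar>v\<bar> powr (p + 1) / (p + 1) + \<bar>\<kappa>\<bar> powr (1 + s) / (1 + s)"
  proof (rule Youngs_inequality)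
    show "1 / (p + 1) + 1 / (1 + s) = 1" using p unfolding conj_exp(2) by (simp add: field_simps)
  qed (use p s_pos in auto)
  moreover have "\<kappa> * v \<le> \<bar>v\<bar> * \<bar>\<kappa>\<bar>" by (metis abs_ge_self abs_mult mult.commute)
  ultimately show ?thesis by (simp add: f_def)
qed

lemma young_eq:
  assumes "0 \<le> c"
  shows "c powr s * c - f (c powr s) = c powr (1 + s) / (1 + s)"
proof (cases "c = 0")
  case False
  then have c: "0 < c" using assms by simp
  have "f (c powr s) = c powr (1 + s) / (p + 1)"
    using conj_exp(1) by (simp add: f_def powr_powr mult.commute)
  moreover have "c powr s * c = c powr (1 + s)" using c by (simp add: powr_add)
  ultimately have "c powr s * c - f (c powr s) = c powr (1 + s) * (1 - 1 / (p + 1))"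
    by (simp add: right_diff_distrib)
  also have "1 - 1 / (p + 1) = 1 / (1 + s)" unfolding conj_exp(2) using p by (simp add: field_simps)
  finally show ?thesis by simp
qed (simp add: f_zero)

text \<open>Young's inequality with slope y^p, sharp at y, is the tangent inequality f y - f x \<le>
  y^p (y - x). For nonnegative arguments up to K the slope is at most K^p, and evenness gives the
  rest.\<close>

lemma f_lip: "\<exists>\<Lambda>\<ge>0. \<forall>x y. \<bar>x\<bar> \<le> K \<longrightarrow> \<bar>y\<bar> \<le> K \<longrightarrow> \<bar>f x - f y\<bar> \<le> \<Lambda> * \<bar>x - y\<bar>"
proof (rule exI[of _ "\<bar>K\<bar> powr p"], intro conjI allI impI)
  have *: "f y - f x \<le> \<bar>K\<bar> powr p * (y - x)" if "0 \<le> x" "x \<le> y" "y \<le> K" for x y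
  proof -
    have y: "(y powr p) powr s = y" using that p ps by (simp add: powr_powr)
    have "y powr p * x - f x \<le> (y powr p) powr (1 + s) / (1 + s)" using young[of "y powr p" x] by simp
    also have "\<dots> = y * y powr p - f y" using young_eq[of "y powr p"] unfolding y by simp
    finally have "f y - f x \<le> y powr p * (y - x)" by (simp add: algebra_simps)
    also have "\<dots> \<le> \<bar>K\<bar> powr p * (y - x)" using that p by (intro mult_right_mono powr_mono2) auto
    finally show ?thesis .
  qed
  fix x y assume xy: "\<bar>x\<bar> \<le> K" "\<bar>y\<bar> \<le> K"
  have fa: "f \<bar>z\<bar> = f z" for z by (simp add: f_def)
  have "\<bar>f \<bar>x\<bar> - f \<bar>y\<bar>\<bar> \<le> \<bar>K\<bar> powr p * \<bar>\<bar>x\<bar> - \<bar>y\<bar>\<bar>"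
  proof (cases "\<bar>x\<bar> \<le> \<bar>y\<bar>")
    case True
    then show ?thesis using *[of "\<bar>x\<bar>" "\<bar>y\<bar>"] f_mono[of "\<bar>x\<bar>" "\<bar>y\<bar>"] xy by simp
  next
    case False
    then show ?thesis using *[of "\<bar>y\<bar>" "\<bar>x\<bar>"] f_mono[of "\<bar>y\<bar>" "\<bar>x\<bar>"] xy by simp
  qed
  also have "\<dots> \<le> \<bar>K\<bar> powr p * \<bar>x - y\<bar>" by (intro mult_left_mono) auto
  finally show "\<bar>f x - f y\<bar> \<le> \<bar>K\<bar> powr p * \<bar>x - y\<bar>" unfolding fa .
qed auto

lemma solpot_eq: "0 \<le> t \<Longrightarrow> solpot s x t = (1 + t) * (\<bar>sdist x / (1 + t)\<bar> powr (1 + s) / (1 + s))"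
  by (simp add: solpot_def)

text \<open>\<kappa> is the characteristic speed at (x, t). Its line starts at proj x + \<kappa>,
  whose distance to the complement of the gaps is at most |\<kappa>|, so the initial potential there
  is at most c, and (1 + t) c is exactly \<open>solpot\<close> at (x, t).\<close>

lemma upper_data:
  assumes t: "0 \<le> t"
  shows "\<exists>\<kappa> c. (\<forall>v. \<kappa> * v - f v \<le> c) \<and> solpot s (x - \<kappa> * t) 0 + c * t \<le> solpot s x t"
proof -
  define \<kappa> where "\<kappa> = sdist x / (1 + t)"
  define c where "c = \<bar>\<kappa>\<bar> powr (1 + s) / (1 + s)"
  have 1: "\<kappa> * v - f v \<le> c" for v unfolding c_def by (rule young)
  have nz: "1 + t \<noteq> 0" using t by linarith
  have "\<kappa> * (1 + t) = sdist x"
    unfolding \<kappa>_def times_divide_eq_left by (rule nonzero_mult_div_cancel_right[OF nz])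
  then have "\<kappa> + \<kappa> * t = sdist x" by (simp only: distrib_left mult_1_right)
  then have "x - \<kappa> * t = proj x + \<kappa>" unfolding proj_def by linarith
  then have "\<bar>sdist (x - \<kappa> * t)\<bar> \<le> \<bar>\<kappa>\<bar>"
    using abs_sdist_lip[of "proj x + \<kappa>" "proj x"] by (simp add: sdist_proj)
  then have "solpot s (x - \<kappa> * t) 0 \<le> c"
    unfolding solpot_def c_def using s_pos by (auto intro!: divide_right_mono powr_mono2)
  moreover have "solpot s x t = (1 + t) * c" unfolding solpot_eq[OF t] c_def \<kappa>_def ..
  ultimately have "solpot s (x - \<kappa> * t) 0 + c * t \<le> solpot s x t" by (simp add: algebra_simps)
  with 1 show ?thesis by blast
qed

text \<open>k = |u(x, t)| attains the maximum in the Legendre formula k |sdist x| - (1 + t) f k.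
  \<open>D\<close> is the tent of the gap of x, lowered to a smooth function with slope below 1:
  lying below the tent it respects the initial potential by Young, and at x it loses at most \<eta>,
  which costs k \<eta>.\<close>

lemma lower_data:
  assumes t: "0 \<le> t" and h: "0 < h"
  shows "\<exists>k D D'. 0 \<le> k \<and> k \<le> node 0 powr s \<and> (\<forall>y. (D has_real_derivative D' y) (at y))
        \<and> continuous_on UNIV D' \<and> (\<forall>y. \<bar>D' y\<bar> \<le> 1) \<and> (\<forall>y. k * D y - f k \<le> solpot s y 0)
        \<and> solpot s x t - h \<le> k * D x - (1 + t) * f k"
proof (cases "sdist x = 0")
  case True
  then have "solpot s x t = 0" using s_pos by (simp add: solpot_def)
  moreover have "0 \<le> solpot s y 0" for y using s_pos by (simp add: solpot_def)
  ultimately show ?thesis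
    using h by (intro exI[of _ 0] exI[of _ "\<lambda>_. 0"]) (auto simp: f_zero)
next
  case False
  then obtain n where n: "node (Suc n) < x" "x \<le> node n"
    using gap_cases[of x] sdist_outside by metis
  define c where "c = \<bar>sdist x\<bar> / (1 + t)"
  define k where "k = c powr s"
  have c: "0 \<le> c" "c \<le> node 0" using t abs_sdist_le[of x] frac_le[of "node 0" "\<bar>sdist x\<bar>" 1 "1 + t"] node_pos[of 0] by (auto simp: c_def)
  have k: "0 \<le> k" "k \<le> node 0 powr s" using c s_pos by (auto simp: k_def intro: powr_mono2)
  \<comment> \<open>The summand 1 avoids division by a vanishing k and gives k \<eta> \<le>
    h.\<close>
  define \<eta> where "\<eta> = h / (k + 1)"
  have \<eta>: "0 < \<eta>" "k * \<eta> \<le> h" using h k by (auto simp: \<eta>_def field_simps)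
  define D where "D y = half n - sqrt ((y - mid n)\<^sup>2 + \<eta>\<^sup>2)" for y
  define D' where "D' y = - ((y - mid n) / sqrt ((y - mid n)\<^sup>2 + \<eta>\<^sup>2))" for y
  have pos: "0 < (y - mid n)\<^sup>2 + \<eta>\<^sup>2" for y using \<eta> by (simp add: add_nonneg_pos)
  have sq: "\<bar>y - mid n\<bar> \<le> sqrt ((y - mid n)\<^sup>2 + \<eta>\<^sup>2)" for y by (rule real_le_rsqrt) simp
  have "(D has_real_derivative D' y) (at y)" for y
  proof -
    have q: "((\<lambda>y. (y - mid n)\<^sup>2 + \<eta>\<^sup>2) has_real_derivative 2 * (y - mid n)) (at y)"
      by (auto intro!: derivative_eq_intros)
    have r: "((\<lambda>y. sqrt ((y - mid n)\<^sup>2 + \<eta>\<^sup>2)) has_real_derivative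
        inverse (sqrt ((y - mid n)\<^sup>2 + \<eta>\<^sup>2)) / 2 * (2 * (y - mid n))) (at y)"
      by (rule DERIV_chain'[OF q DERIV_real_sqrt[OF pos[of y]]])
    have gen: "0 - inverse S / 2 * (2 * a) = - (a / S)" for S a :: real by (cases "S = 0") (auto simp: field_simps)
    have "D = (\<lambda>y. half n - sqrt ((y - mid n)\<^sup>2 + \<eta>\<^sup>2))" by (simp add: fun_eq_iff D_def)
    then show ?thesis
      using DERIV_diff[OF DERIV_const[of "half n"] r] unfolding gen D'_def by (simp only:)
  qed
  moreover have "continuous_on UNIV D'"
    unfolding D'_def by (intro continuous_intros) (use \<eta> in \<open>auto simp: sum_power2_eq_zero_iff\<close>)
  moreover have "\<bar>D' y\<bar> \<le> 1" for y
    unfolding D'_def using sq[of y] pos[of y] by (simp add: divide_le_eq)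
  moreover have "k * D y - f k \<le> solpot s y 0" for y
  proof -
    have "D y \<le> \<bar>sdist y\<bar>" using sq[of y] tent_le_sdist[of n y] unfolding D_def by linarith
    then have "k * D y - f k \<le> \<bar>sdist y\<bar> * k - f k" using k(1) by (simp add: mult_left_mono mult.commute)
    also have "\<dots> \<le> \<bar>\<bar>sdist y\<bar>\<bar> powr (1 + s) / (1 + s)" by (rule young)
    finally show ?thesis by (simp add: solpot_def)
  qed
  moreover have "solpot s x t - h \<le> k * D x - (1 + t) * f k"
  proof -
    have "sqrt ((x - mid n)\<^sup>2 + \<eta>\<^sup>2) \<le> \<bar>x - mid n\<bar> + \<bar>\<eta>\<bar>"
      by (rule sqrt_sum_squares_le_sum_abs)
    then have "\<bar>sdist x\<bar> - \<eta> \<le> D x" using abs_sdist_gap[of n x] n \<eta>(1) unfolding D_def by simp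
    then have 1: "k * (\<bar>sdist x\<bar> - \<eta>) \<le> k * D x" using k(1) by (rule mult_left_mono)
    have "solpot s x t = (1 + t) * (k * c - f k)"
      using young_eq[OF c(1)] t by (simp add: solpot_eq k_def c_def)
    also have "\<dots> = k * \<bar>sdist x\<bar> - (1 + t) * f k"
      using t by (simp add: c_def right_diff_distrib)
    finally show ?thesis using 1 \<eta>(2) by (simp add: right_diff_distrib)
  qed
  ultimately show ?thesis using k by blast
qed

lemma sol_lebesgue_measurable: "(\<lambda>x. sol s x t) \<in> borel_measurable lebesgue"
  using sol_measurable by (auto intro: measurable_completion)

lemma sol_lebesgue_integral:
  assumes "0 \<le> t" "a \<le> b"
  shows "(LINT x:{a..b}|lebesgue. sol s x t) = solpot s b t - solpot s a t"
proof -
  have "(LINT x:{a..b}|lebesgue. sol s x t) = (LBINT x:{a..b}. sol s x t)"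
    unfolding set_lebesgue_integral_def using sol_measurable by (intro integral_completion) simp
  then show ?thesis using sol_integral[OF s_pos assms] by simp
qed

lemma entropy_solution_sol_integral:
  assumes "entropy_solution f (\<lambda>x. sol s x 0) v" "0 \<le> t" "a \<le> b"
  shows "(LINT x:{a..b}|lebesgue. v x t) = solpot s b t - solpot s a t"
  by (rule entropy_solution_integral[where G = "\<lambda>x. solpot s x 0" and U = "\<lambda>x. solpot s x t", OF assms(1)
        sol_lebesgue_measurable f_cont f_even f_mono f_lip assms(2) sol_lebesgue_integral _
        upper_data[OF assms(2)] lower_data[OF assms(2)] assms(3)])
     (simp_all add: solpot_def sdist_outside)

end

text \<open>\<open>ennreal\<close> cuts off at 0, so the two densities are the positive and the
  negative part of \<open>H\<close>. Both measures are finite on right half-lines and agree there,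
  hence they coincide.\<close>

lemma integrable_half_lines_zero_imp_AE:
  fixes H :: "real \<Rightarrow> real"
  assumes H: "integrable lborel H" and z: "\<And>x. (LBINT y:{x<..}. H y) = 0"
  shows "AE x in lborel. H x = 0"
proof -
  have Hm[measurable]: "H \<in> borel_measurable borel" using borel_measurable_integrable[OF H] by simp
  let ?M = "density lborel (\<lambda>x. ennreal (H x))" and ?N = "density lborel (\<lambda>x. ennreal (- H x))"
  have fin: "(\<integral>\<^sup>+y. ennreal (\<sigma> * H y) * indicator {x<..} y \<partial>lborel) < \<infinity>" if "\<sigma> = 1 \<or> \<sigma> = -1" for \<sigma> x
  proof -
    have "(\<integral>\<^sup>+y. ennreal (\<sigma> * H y) * indicator {x<..} y \<partial>lborel) \<le> (\<integral>\<^sup>+y. ennreal (norm (H y)) \<partial>lborel)"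
      using that by (intro nn_integral_mono) (auto simp: indicator_def intro: ennreal_leI)
    then show ?thesis using H by (auto simp: integrable_iff_bounded)
  qed
  have eq: "(\<integral>\<^sup>+y. ennreal (H y) * indicator {x<..} y \<partial>lborel) = (\<integral>\<^sup>+y. ennreal (- H y) * indicator {x<..} y \<partial>lborel)" for x
  proof -
    have i: "integrable lborel (\<lambda>y. indicator {x<..} y *\<^sub>R H y)" by (rule integrable_mult_indicator[OF _ H]) simp
    have e: "(\<integral>\<^sup>+y. ennreal (\<sigma> * (indicator {x<..} y *\<^sub>R H y)) \<partial>lborel) = (\<integral>\<^sup>+y. ennreal (\<sigma> * H y) * indicator {x<..} y \<partial>lborel)" for \<sigma>
      by (rule nn_integral_cong) (auto simp: indicator_def)
    have "enn2real (\<integral>\<^sup>+y. ennreal (H y) * indicator {x<..} y \<partial>lborel)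
        = enn2real (\<integral>\<^sup>+y. ennreal (- H y) * indicator {x<..} y \<partial>lborel)"
      using z[of x] real_lebesgue_integral_def[OF i] e[of 1] e[of "-1"] by (simp add: set_lebesgue_integral_def)
    then show ?thesis 
      using ennreal_enn2real[of "\<integral>\<^sup>+y. ennreal (H y) * indicator {x<..} y \<partial>lborel"]
        ennreal_enn2real[of "\<integral>\<^sup>+y. ennreal (- H y) * indicator {x<..} y \<partial>lborel"]
        fin[of 1 x] fin[of "-1" x] by simp
  qed
  have "?M = ?N"
  proof (rule measure_eqI_lessThan)
    show "emeasure ?M {x<..} < \<infinity>" for x using fin[of 1 x] by (simp add: emeasure_density)
    show "emeasure ?M {x<..} = emeasure ?N {x<..}" for x using eq[of x] by (simp add: emeasure_density)
  qed simp_all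
  then have "AE x in lborel. ennreal (H x) = ennreal (- H x)"
    by (subst (asm) sigma_finite_measure.density_unique_iff[OF sigma_finite_lborel]) simp_all
  then show ?thesis
  proof eventually_elim
    case (elim x)
    then show ?case by (cases "H x" "0 :: real" rule: linorder_cases) (auto simp: ennreal_neg)
  qed
qed

text \<open>Localise to [-R, R] and pass to a Borel version; half-line integrals of the truncation
  are interval integrals of \<open>h\<close>, up to one point.\<close>

lemma L1_loc_zero_integrals_imp_AE:
  fixes h :: "real \<Rightarrow> real"
  assumes loc: "\<And>R. set_integrable lebesgue {-R..R} h" and z: "\<And>a b. a \<le> b \<Longrightarrow> (LINT x:{a..b}|lebesgue. h x) = 0"
  shows "AE x in lebesgue. h x = 0"
proof -
  have R: "AE x in lebesgue. x \<in> {-R..R} \<longrightarrow> h x = 0" for R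
  proof -
    let ?h = "\<lambda>x. indicator {-R..R} x *\<^sub>R h x"
    have i: "integrable lebesgue ?h" using loc[of R] by (simp add: set_integrable_def)
    from completion_ex_borel_measurable_real[OF borel_measurable_integrable[OF i]]
    obtain H where H: "H \<in> borel_measurable lborel" and ae: "AE x in lborel. ?h x = H x" by blast
    have ae': "AE x in lebesgue. ?h x = H x" using ae by (simp add: AE_completion_iff)
    have Hl: "H \<in> borel_measurable lebesgue" using H by (auto intro: measurable_completion)
    have "integrable lebesgue H"
      by (rule integrable_cong_AE_imp[OF i Hl]) (use ae' in eventually_elim, simp)
    then have "integrable lborel H" using H by (simp add: integrable_completion)
    moreover have "(LBINT y:{x<..}. H y) = 0" for x
    proof -
      have "(LBINT y:{x<..}. H y) = (LINT y:{x<..}|lebesgue. H y)"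
        unfolding set_lebesgue_integral_def using H by (intro integral_completion[symmetric]) simp
      also have "\<dots> = (LINT y:{x<..}|lebesgue. ?h y)"
        unfolding set_lebesgue_integral_def
      proof (rule integral_cong_AE)
        have ind: "indicat_real {x<..} \<in> borel_measurable lebesgue" by (rule measurable_completion) simp
        show "(\<lambda>y. indicat_real {x<..} y *\<^sub>R H y) \<in> borel_measurable lebesgue"
          unfolding real_scaleR_def by (rule borel_measurable_times[OF ind Hl])
        show "(\<lambda>y. indicat_real {x<..} y *\<^sub>R ?h y) \<in> borel_measurable lebesgue"
          using borel_measurable_times[OF ind borel_measurable_integrable[OF i]] by simp
        show "AE y in lebesgue. indicat_real {x<..} y *\<^sub>R H y = indicat_real {x<..} y *\<^sub>R ?h y"
          using ae' by eventually_elim simp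
      qed
      also have "\<dots> = (LINT y:{max x (-R)..R}|lebesgue. h y)"
        unfolding set_lebesgue_integral_def
      proof (rule integral_cong_AE)
        have ind: "indicat_real {x<..} \<in> borel_measurable lebesgue" by (rule measurable_completion) simp
        show m1: "(\<lambda>y. indicat_real {x<..} y *\<^sub>R ?h y) \<in> borel_measurable lebesgue"
          using borel_measurable_times[OF ind borel_measurable_integrable[OF i]] by simp
        have ind2: "indicat_real {max x (-R)..R} \<in> borel_measurable lebesgue" by (rule measurable_completion) simp
        have "(\<lambda>y. indicat_real {max x (-R)..R} y *\<^sub>R h y) = (\<lambda>y. indicat_real {max x (-R)..R} y * ?h y)"
          by (auto simp: fun_eq_iff indicator_def)
        then show "(\<lambda>y. indicat_real {max x (-R)..R} y *\<^sub>R h y) \<in> borel_measurable lebesgue"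
          using borel_measurable_times[OF ind2 borel_measurable_integrable[OF i]] by simp
        have "AE y in lborel. y \<noteq> x" by (rule AE_lborel_singleton)
        then have "AE y in lebesgue. y \<noteq> x" by (simp add: AE_completion_iff)
        then show "AE y in lebesgue. indicat_real {x<..} y *\<^sub>R ?h y = indicat_real {max x (-R)..R} y *\<^sub>R h y"
          by eventually_elim (auto simp: indicator_def)
      qed
      also have "\<dots> = 0"
        using z[of "max x (-R)" R] by (cases "max x (-R) \<le> R") (auto simp: set_lebesgue_integral_def)
      finally show ?thesis .
    qed
    ultimately have "AE x in lborel. H x = 0" by (rule integrable_half_lines_zero_imp_AE)
    then have "AE x in lebesgue. H x = 0" by (simp add: AE_completion_iff)
    then show ?thesis using ae' by eventually_elim auto
  qed
  have "AE x in lebesgue. \<forall>n::nat. x \<in> {- real n..real n} \<longrightarrow> h x = 0"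
    unfolding AE_all_countable by (intro allI R)
  then show ?thesis
  proof eventually_elim
    case (elim x)
    obtain n :: nat where "\<bar>x\<bar> \<le> real n" using real_arch_simple by blast
    then show ?case using elim by (auto simp: abs_le_iff)
  qed
qed

context power_flux
begin

text \<open>Both functions have the increment of \<open>solpot\<close> as integral over every
  bounded interval.\<close>

lemma entropy_solution_unique:
  assumes v: "entropy_solution f (\<lambda>x. sol s x 0) v" and t: "0 \<le> t"
  shows "AE x in lebesgue. v x t = sol s x t"
proof -
  have iv: "set_integrable lebesgue {a..b} (\<lambda>x. v x t)" for a b
    using v t by (auto simp: entropy_solution_def continuous_L1_loc_def L1_loc_def)
  have isol: "set_integrable lebesgue {a..b} (\<lambda>x. sol s x t)" for a b
    using sol_set_integrable[of s t a b] s_pos t sol_measurable by (simp add: set_integrable_def integrable_completion)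
  have "AE x in lebesgue. v x t - sol s x t = 0"
  proof (rule L1_loc_zero_integrals_imp_AE)
    show "set_integrable lebesgue {-R..R} (\<lambda>x. v x t - sol s x t)" for R
      by (rule set_integral_diff(1)[OF iv isol])
    show "(LINT x:{a..b}|lebesgue. v x t - sol s x t) = 0" if "a \<le> b" for a b
      using set_integral_diff(2)[OF iv isol] entropy_solution_sol_integral[OF v t that] sol_lebesgue_integral[OF t that]
      by simp
  qed
  then show ?thesis by eventually_elim simp
qed

end

section \<open>Fractional variation\<close>

lemma powr_superadditive:
  fixes \<alpha> \<beta> p :: real
  assumes "1 \<le> p" "0 \<le> \<alpha>" "0 \<le> \<beta>"
  shows "\<alpha> powr p + \<beta> powr p \<le> (\<alpha> + \<beta>) powr p"
proof (cases "\<alpha> = 0 \<or> \<beta> = 0")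
  case False
  then have ab: "0 < \<alpha>" "0 < \<beta>" using assms by auto
  have split: "x powr p = x * x powr (p - 1)" if "0 < x" for x using that by (simp add: powr_diff)
  have "\<alpha> powr (p - 1) \<le> (\<alpha> + \<beta>) powr (p - 1)" "\<beta> powr (p - 1) \<le> (\<alpha> + \<beta>) powr (p - 1)"
    using assms by (auto intro!: powr_mono2)
  then have "\<alpha> * \<alpha> powr (p - 1) + \<beta> * \<beta> powr (p - 1) \<le> \<alpha> * (\<alpha> + \<beta>) powr (p - 1) + \<beta> * (\<alpha> + \<beta>) powr (p - 1)"
    using ab by (intro add_mono mult_left_mono) auto
  then show ?thesis using ab split by (simp add: distrib_right)
qed (use assms in auto)

text \<open>The signed root of order p is Hoelder of exponent s. For equal signs superadditivity of
  the power p gives constant 1; for opposite signs each root is at most m^s with m the larger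
  modulus, which brings in 2^p.\<close>

lemma signed_root_diff:
  fixes a b p s :: real
  assumes p: "1 \<le> p" and ps: "s * p = 1"
  shows "\<bar>sgn a * \<bar>a\<bar> powr s - sgn b * \<bar>b\<bar> powr s\<bar> powr p \<le> 2 powr p * \<bar>a - b\<bar>"
proof -
  have s: "0 < s" using p ps by (metis less_le_trans zero_less_mult_pos2 zero_less_one)
  have inv: "(x powr s) powr p = x" if "0 \<le> x" for x using that ps by (simp add: powr_powr)
  have two: "1 \<le> 2 powr p" using p ge_one_powr_ge_zero[of 2 p] by simp
  have same: "(x powr s - y powr s) powr p \<le> 2 powr p * (x - y)" if "0 \<le> y" "y \<le> x" for x y :: real
  proof -
    have "y powr s \<le> x powr s" using that s by (intro powr_mono2) auto
    then have "(x powr s - y powr s) powr p + (y powr s) powr p \<le> ((x powr s - y powr s) + y powr s) powr p"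
      by (intro powr_superadditive p) auto
    then have "(x powr s - y powr s) powr p \<le> 1 * (x - y)" using inv[of x] inv[of y] that by simp
    also have "\<dots> \<le> 2 powr p * (x - y)" using two that by (intro mult_right_mono) auto
    finally show ?thesis .
  qed
  have opp: "(x powr s + y powr s) powr p \<le> 2 powr p * (x + y)" if "0 \<le> y" "0 \<le> x" for x y :: real
  proof -
    define m where "m = max x y"
    have "x powr s \<le> m powr s" "y powr s \<le> m powr s" using that s by (auto simp: m_def intro!: powr_mono2)
    then have "(x powr s + y powr s) powr p \<le> (2 * m powr s) powr p"
      using p by (intro powr_mono2) auto
    also have "\<dots> = 2 powr p * m" using inv[of m] that by (simp add: powr_mult m_def)
    also have "\<dots> \<le> 2 powr p * (x + y)" using that by (intro mult_left_mono) (auto simp: m_def)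
    finally show ?thesis .
  qed
  have sg: "sgn x * \<bar>x\<bar> powr s = (if 0 \<le> x then x powr s else - ((- x) powr s))" for x
    by (auto simp: sgn_if)
  consider "0 \<le> b" "b \<le> a" | "0 \<le> a" "a \<le> b" | "a < 0" "a \<le> b" "b < 0" | "b < 0" "b \<le> a" "a < 0" | "0 \<le> a" "b < 0" | "a < 0" "0 \<le> b"
    by linarith
  then show ?thesis
  proof cases
    case 1
    then have "b powr s \<le> a powr s" using s by (intro powr_mono2) auto
    then show ?thesis using same[of b a] 1 unfolding sg by simp
  next
    case 2
    then have "a powr s \<le> b powr s" using s by (intro powr_mono2) auto
    then show ?thesis using same[of a b] 2 unfolding sg by simp
  next
    case 3
    then have "(- b) powr s \<le> (- a) powr s" using s by (intro powr_mono2) auto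
    then show ?thesis using same[of "- b" "- a"] 3 unfolding sg by simp
  next
    case 4
    then have "(- a) powr s \<le> (- b) powr s" using s by (intro powr_mono2) auto
    then show ?thesis using same[of "- a" "- b"] 4 unfolding sg by simp
  next
    case 5
    then show ?thesis using opp[of "- b" a] unfolding sg by simp
  next
    case 6
    have "0 \<le> (- a) powr s" "0 \<le> b powr s" by simp_all
    then have "\<bar>- ((- a) powr s) - b powr s\<bar> = b powr s + (- a) powr s" by linarith
    then show ?thesis using opp[of "- a" b] 6 unfolding sg by simp
  qed
qed

text \<open>The identity and \<open>proj\<close> are monotone but unbounded. They coincide off
  [0, node 0], so clipping both to that interval leaves their difference unchanged and bounds their
  variation.\<close>

definition clip :: "real \<Rightarrow> real" where
  "clip x = max 0 (min x (node 0))"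

lemma sdist_clip: "sdist x = clip x - clip (proj x)"
proof (cases x rule: gap_cases)
  case (3 n)
  have "node n \<le> node 0" "node (Suc n) \<le> node 0" by (auto intro: node_antimono)
  then have "0 \<le> x" "x \<le> node 0" "0 \<le> proj x" "proj x \<le> node 0"
    using 3 proj_gap(1)[OF 3] node_pos[of n] node_pos[of "Suc n"] by auto
  then show ?thesis by (simp add: clip_def) (simp add: proj_def)
qed (simp_all add: proj_def sdist_outside)

text \<open>By \<open>signed_root_diff\<close> each term is at most 2^p times an increment of
  \<open>sdist\<close>, which is bounded by the increments of two monotone functions with range in
  [0, node 0]; these telescope to at most 2 node 0.\<close>

lemma TV_sol_le:
  assumes p: "1 \<le> p" and s: "s = 1 / p" and t: "0 \<le> t"
  shows "TV s (\<lambda>x. sol s x t) \<le> ennreal (2 powr p * (2 * node 0))"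
  unfolding TV_def
proof (rule SUP_least, clarify)
  fix n :: nat and x :: "nat \<Rightarrow> real"
  assume n: "2 \<le> n" and x: "strict_mono_on {1..n} x"
  have ps: "s * p = 1" using p s by simp
  define c where "c i = clip (x i)" for i
  define c' where "c' i = clip (proj (x i))" for i
  have clip_mono: "clip a \<le> clip b" if "a \<le> b" for a b using that by (auto simp: clip_def)
  have step: "\<bar>sol s (x i) t - sol s (x (i - 1)) t\<bar> powr (1 / s) \<le> 2 powr p * ((c i - c (i - 1)) + (c' i - c' (i - 1)))"
    if i: "i \<in> {2..n}" for i
  proof -
    have "x (i - 1) < x i" by (rule strict_mono_onD[OF x]) (use i in auto)
    then have m: "c (i - 1) \<le> c i" "c' (i - 1) \<le> c' i"
      unfolding c_def c'_def by (auto intro!: clip_mono monoD[OF proj_mono])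
    have so: "sol s y t = sgn (sdist y / (1 + t)) * \<bar>sdist y / (1 + t)\<bar> powr s" for y
      using t by (simp add: sol_def sgn_divide)
    have "\<bar>sol s (x i) t - sol s (x (i - 1)) t\<bar> powr p
        \<le> 2 powr p * \<bar>sdist (x i) / (1 + t) - sdist (x (i - 1)) / (1 + t)\<bar>"
      unfolding so by (rule signed_root_diff[OF p ps])
    also have "\<dots> \<le> 2 powr p * \<bar>sdist (x i) - sdist (x (i - 1))\<bar>"
    proof (rule mult_left_mono)
      have "\<bar>sdist (x i) / (1 + t) - sdist (x (i - 1)) / (1 + t)\<bar> = \<bar>sdist (x i) - sdist (x (i - 1))\<bar> / (1 + t)"
        using t by (simp add: diff_divide_distrib[symmetric])
      also have "\<dots> \<le> \<bar>sdist (x i) - sdist (x (i - 1))\<bar> / 1" using t by (intro divide_left_mono) auto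
      finally show "\<bar>sdist (x i) / (1 + t) - sdist (x (i - 1)) / (1 + t)\<bar> \<le> \<bar>sdist (x i) - sdist (x (i - 1))\<bar>" by simp
    qed simp
    also have "\<dots> \<le> 2 powr p * ((c i - c (i - 1)) + (c' i - c' (i - 1)))"
      using m unfolding sdist_clip[of "x i"] sdist_clip[of "x (i - 1)"] c_def c'_def
      by (intro mult_left_mono) auto
    finally show ?thesis using s p by simp
  qed
  have tel: "(\<Sum>i = 2..n. h i - h (i - 1)) = h n - h 1" for h :: "nat \<Rightarrow> real"
    using sum_telescope''[of 1 n h] n by (simp add: numeral_2_eq_2)
  have cb: "0 \<le> clip y" "clip y \<le> node 0" for y using node_pos[of 0] by (auto simp: clip_def)
  have "(\<Sum>i = 2..n. ennreal (\<bar>sol s (x i) t - sol s (x (i - 1)) t\<bar> powr (1 / s)))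
      = ennreal (\<Sum>i = 2..n. \<bar>sol s (x i) t - sol s (x (i - 1)) t\<bar> powr (1 / s))"
    by (rule sum_ennreal) simp
  also have "\<dots> \<le> ennreal (\<Sum>i = 2..n. 2 powr p * ((c i - c (i - 1)) + (c' i - c' (i - 1))))"
    by (intro ennreal_leI sum_mono step)
  also have "(\<Sum>i = 2..n. 2 powr p * ((c i - c (i - 1)) + (c' i - c' (i - 1)))) = 2 powr p * ((c n - c 1) + (c' n - c' 1))"
    by (simp only: sum_distrib_left[symmetric] sum.distrib tel)
  also have "ennreal \<dots> \<le> ennreal (2 powr p * (2 * node 0))"
    using cb[of "x n"] cb[of "x 1"] cb[of "proj (x n)"] cb[of "proj (x 1)"] unfolding c_def c'_def
    by (intro ennreal_leI mult_left_mono) auto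
  finally show "(\<Sum>i = 2..n. ennreal (\<bar>sol s (x i) t - sol s (x (i - 1)) t\<bar> powr (1 / s)))
      \<le> ennreal (2 powr p * (2 * node 0))" .
qed

text \<open>A set of full measure meets every open interval: this locates sample points at which an
  arbitrary representative takes the values of the solution.\<close>

lemma AE_lebesgue_exists_in_interval:
  assumes ae: "AE x in lebesgue. P x" and ab: "(a::real) < b"
  obtains x where "a < x" "x < b" "P x"
proof -
  have "AE x in lborel. P x" using ae by (simp add: AE_completion_iff)
  then have "\<not> (\<forall>x\<in>{a<..<b}. \<not> P x)"
  proof (rule contrapos_pn)
    assume "\<forall>x\<in>{a<..<b}. \<not> P x"
    show "\<not> (AE x in lborel. P x)"
    proof
      assume "AE x in lborel. P x"
      from AE_E[OF this] obtain N where N: "{x \<in> space lborel. \<not> P x} \<subseteq> N" "emeasure lborel N = 0" "N \<in> sets lborel" by blast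
      have "{a<..<b} \<subseteq> N" using N(1) \<open>\<forall>x\<in>{a<..<b}. \<not> P x\<close> by auto
      then have "emeasure lborel {a<..<b} \<le> emeasure lborel N" using N(3) by (rule emeasure_mono)
      then show False using N(2) ab by simp
    qed
  qed
  then show ?thesis using that by auto
qed

text \<open>\<open>half n\<close> is of order 1 / (n (ln n)^2). A power \<theta> < 1 of it
  eventually exceeds 1 / n, the logarithm being negligible, and the harmonic series
  diverges.\<close>

lemma half_powr_not_summable:
  assumes \<theta>: "0 < \<theta>" "\<theta> < 1" and c: "0 < c"
  shows "\<not> summable (\<lambda>n. (half n / c) powr \<theta>)"
proof
  assume sm: "summable (\<lambda>n. (half n / c) powr \<theta>)"
  have "eventually (\<lambda>n. 1 / real n \<le> (half n / c) powr \<theta>) at_top"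
    unfolding half_def node_def using \<theta> c by real_asymp
  then have "eventually (\<lambda>n. norm (1 / real n) \<le> (half n / c) powr \<theta>) at_top"
    by eventually_elim simp
  then have "summable (\<lambda>n. 1 / real n)" using sm by (rule summable_comparison_test_ev)
  then show False using not_summable_harmonic[where 'a = real] by (simp add: inverse_eq_divide)
qed

text \<open>In every gap the solution jumps at the midpoint by an amount comparable to (half n)^s,
  at all times. The exponent 1 / \<sigma> turns this into (half n)^(s / \<sigma>) with s / \<sigma>
  < 1, whose sum diverges.\<close>

lemma TV_infinite:
  assumes s: "0 < s" "s < \<sigma>" and t: "0 \<le> t" and ae: "AE x in lebesgue. w x = sol s x t"
  shows "TV \<sigma> w = \<infinity>"
proof (rule ccontr)
  assume "TV \<sigma> w \<noteq> \<infinity>"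
  then obtain B where B: "0 \<le> B" "TV \<sigma> w = ennreal B" by (cases "TV \<sigma> w" rule: ennreal_cases) auto
  define \<theta> where "\<theta> = s / \<sigma>"
  have \<theta>: "0 < \<theta>" "\<theta> < 1" using s by (auto simp: \<theta>_def)
  define b where "b n = (half n / (2 * (1 + t))) powr \<theta>" for n
  have pts: "\<exists>l r. node (Suc n) < l \<and> l < r \<and> r < node n \<and> b n \<le> \<bar>w r - w l\<bar> powr (1 / \<sigma>)" for n
  proof -
    have hp: "0 < half n" by (rule half_pos)
    \<comment> \<open>Points within a quarter of the gap from the midpoint keep distance at least
      half n / 2 from the nodes.\<close>
    obtain l where l: "mid n - half n / 2 < l" "l < mid n" "w l = sol s l t"
      using AE_lebesgue_exists_in_interval[OF ae, of "mid n - half n / 2" "mid n"] hp by auto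
    obtain r where r: "mid n < r" "r < mid n + half n / 2" "w r = sol s r t"
      using AE_lebesgue_exists_in_interval[OF ae, of "mid n" "mid n + half n / 2"] hp by auto
    have ln: "node (Suc n) < l" "r < node n" using l r hp mid_half[of n] by auto
    have sl: "sdist l = l - node (Suc n)" using sdist_left[of n l] l ln by simp
    have sr: "sdist r = r - node n" using sdist_right[of n r] r ln by simp
    let ?c = "(half n / (2 * (1 + t))) powr s"
    have wl: "?c \<le> w l"
    proof -
      have "half n / (2 * (1 + t)) \<le> \<bar>sdist l\<bar> / (1 + t)"
      proof -
        have "half n / 2 \<le> \<bar>sdist l\<bar>" unfolding sl using l(1) mid_half[of n] by linarith
        then have "half n / 2 / (1 + t) \<le> \<bar>sdist l\<bar> / (1 + t)" using t by (intro divide_right_mono) auto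
        then show ?thesis by simp
      qed
      then have "?c \<le> (\<bar>sdist l\<bar> / (1 + t)) powr s" using s hp t by (intro powr_mono2) auto
      also have "\<dots> = w l" unfolding l(3) sol_def using sl ln by simp
      finally show ?thesis .
    qed
    have wr: "w r \<le> - ?c"
    proof -
      have "half n / (2 * (1 + t)) \<le> \<bar>sdist r\<bar> / (1 + t)"
      proof -
        have "half n / 2 \<le> \<bar>sdist r\<bar>" unfolding sr using r(2) mid_half[of n] by linarith
        then have "half n / 2 / (1 + t) \<le> \<bar>sdist r\<bar> / (1 + t)" using t by (intro divide_right_mono) auto
        then show ?thesis by simp
      qed
      then have "?c \<le> (\<bar>sdist r\<bar> / (1 + t)) powr s" using s hp t by (intro powr_mono2) auto
      also have "\<dots> = - w r" unfolding r(3) sol_def using sr ln by simp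
      finally show ?thesis by simp
    qed
    have "0 \<le> ?c" by simp
    then have "?c \<le> \<bar>w r - w l\<bar>" using wl wr by linarith
    then have "?c powr (1 / \<sigma>) \<le> \<bar>w r - w l\<bar> powr (1 / \<sigma>)" using s by (intro powr_mono2) auto
    then have "b n \<le> \<bar>w r - w l\<bar> powr (1 / \<sigma>)" by (simp add: b_def \<theta>_def powr_powr)
    then show ?thesis using ln l(2) r(1) by (intro exI[of _ l] exI[of _ r]) auto
  qed
  then obtain l r where lr: "\<And>n. node (Suc n) < l n" "\<And>n. l n < r n" "\<And>n. r n < node n"
    "\<And>n. b n \<le> \<bar>w (r n) - w (l n)\<bar> powr (1 / \<sigma>)" by metis
  have b0: "0 \<le> b n" for n by (simp add: b_def)
  have partial: "sum b {..<N} \<le> B" if N: "1 \<le> N" for N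
  proof -
    \<comment> \<open>Since gaps are numbered from right to left, i = 2 k - 1 and i = 2 k are sent
      to the gap N - k, which makes the sample increasing; odd indices take the left point.\<close>
    define x where "x i = (if even i then r (N - (i + 1) div 2) else l (N - (i + 1) div 2))" for i
    have xl: "l (N - (i + 1) div 2) \<le> x i" "x i \<le> r (N - (i + 1) div 2)" for i
      using lr(2)[of "N - (i + 1) div 2"] by (auto simp: x_def)
    have mono: "strict_mono_on {1..2 * N} x"
    proof (rule strict_mono_onI)
      fix i j assume ij: "i \<in> {1..2 * N}" "j \<in> {1..2 * N}" "i < j"
      show "x i < x j"
      proof (cases "(i + 1) div 2 = (j + 1) div 2")
        case True
        then have "odd i" "even j" using ij(3) by presburger+
        then show ?thesis using lr(2) True by (simp add: x_def)
      next
        case False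
        then have k: "(i + 1) div 2 < (j + 1) div 2" using ij(3) by presburger
        have "(j + 1) div 2 \<le> N" using ij(2) by auto
        then have "Suc (N - (j + 1) div 2) \<le> N - (i + 1) div 2" using k by linarith
        then have "node (N - (i + 1) div 2) \<le> node (Suc (N - (j + 1) div 2))" by (rule node_antimono)
        then show ?thesis
          using xl(2)[of i] xl(1)[of j] lr(3)[of "N - (i + 1) div 2"] lr(1)[of "N - (j + 1) div 2"] by linarith
      qed
    qed
    have "sum b {..<N} = (\<Sum>k\<in>{1..N}. b (N - k))"
      by (rule sum.reindex_bij_witness[of _ "\<lambda>k. N - k" "\<lambda>n. N - n"]) auto
    also have "\<dots> \<le> (\<Sum>k\<in>{1..N}. \<bar>w (x (2 * k)) - w (x (2 * k - 1))\<bar> powr (1 / \<sigma>))"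
    proof (rule sum_mono)
      fix k assume k: "k \<in> {1..N}"
      have "x (2 * k) = r (N - k)" by (simp add: x_def)
      moreover have "x (2 * k - 1) = l (N - k)"
      proof -
        have "odd (2 * k - 1)" "(2 * k - 1 + 1) div 2 = k" using k by auto
        then show ?thesis by (simp only: x_def if_False)
      qed
      ultimately show "b (N - k) \<le> \<bar>w (x (2 * k)) - w (x (2 * k - 1))\<bar> powr (1 / \<sigma>)" using lr(4) by simp
    qed
    also have "\<dots> = (\<Sum>i\<in>(\<lambda>k. 2 * k) ` {1..N}. \<bar>w (x i) - w (x (i - 1))\<bar> powr (1 / \<sigma>))"
      by (subst sum.reindex) (auto simp: inj_on_def)
    \<comment> \<open>Even indices are those whose increment crosses a midpoint; the remaining terms
      are nonnegative.\<close>
    also have "\<dots> \<le> (\<Sum>i = 2..2 * N. \<bar>w (x i) - w (x (i - 1))\<bar> powr (1 / \<sigma>))"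
      by (rule sum_mono2) auto
    finally have le: "sum b {..<N} \<le> (\<Sum>i = 2..2 * N. \<bar>w (x i) - w (x (i - 1))\<bar> powr (1 / \<sigma>))" .
    have "(\<Sum>i = 2..2 * N. ennreal (\<bar>w (x i) - w (x (i - 1))\<bar> powr (1 / \<sigma>))) \<le> TV \<sigma> w"
      unfolding TV_def by (rule SUP_upper2[of "(2 * N, x)"]) (use N mono in auto)
    then have "ennreal (\<Sum>i = 2..2 * N. \<bar>w (x i) - w (x (i - 1))\<bar> powr (1 / \<sigma>)) \<le> ennreal B"
      unfolding B(2) by (simp add: sum_ennreal)
    then show ?thesis using le B(1) by simp
  qed
  have "summable b"
  proof (rule summableI_nonneg_bounded[OF b0])
    show "sum b {..<n} \<le> B" for n using partial[of n] B(1) by (cases n) auto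
  qed
  then show False using half_powr_not_summable[OF \<theta>, of "2 * (1 + t)"] t by (simp add: b_def[abs_def])
qed

section \<open>Existence\<close>

lemma DERIV_sgn:
  assumes "(u has_real_derivative u') (at x)" "u x \<noteq> k"
  shows "((\<lambda>x. sgn (u x - k)) has_real_derivative 0) (at x)"
proof -
  have "(sgn has_real_derivative 0) (at y)" if "y \<noteq> 0" for y :: real
  proof (cases "0 < y")
    case True
    have "((\<lambda>x::real. 1) has_real_derivative 0) (at y)" by simp
    then show ?thesis
      by (rule has_field_derivative_transform_within_open[where S = "{0<..}"]) (use True in auto)
  next
    case False
    have "((\<lambda>x::real. -1) has_real_derivative 0) (at y)" by simp
    then show ?thesis
      by (rule has_field_derivative_transform_within_open[where S = "{..<0}"]) (use False that in auto)
  qed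
  moreover have "((\<lambda>x. u x - k) has_real_derivative u') (at x)"
    using assms(1) by (auto intro!: derivative_eq_intros)
  ultimately show ?thesis using DERIV_chain'[of "\<lambda>x. u x - k" u' x UNIV sgn 0] assms(2) by simp
qed

lemma DERIV_abs_diff:
  assumes "(u has_real_derivative u') (at x)" "u x \<noteq> k"
  shows "((\<lambda>x. \<bar>u x - k\<bar>) has_real_derivative sgn (u x - k) * u') (at x)"
proof -
  have "((\<lambda>x. u x - k) has_real_derivative u') (at x)"
    using assms(1) by (auto intro!: derivative_eq_intros)
  from DERIV_mult[OF DERIV_sgn[OF assms] this]
  show ?thesis by (simp add: sgn_mult_self_eq abs_sgn[symmetric] mult.commute)
qed

context power_flux
begin

definition kflux :: "real \<Rightarrow> real \<Rightarrow> real" where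
  "kflux k v = sgn (v - k) * (f v - f k)"

lemma kflux_eq: "kflux k v = f (max v k) - f (min v k)"
  by (auto simp: kflux_def sgn_if max_def min_def)

lemma kflux_cont: "continuous_on UNIV (kflux k)"
  unfolding kflux_eq[abs_def] by (intro continuous_intros continuous_on_compose2[OF f_cont]) auto

lemma f_mono_abs: "\<bar>x\<bar> \<le> \<bar>y\<bar> \<Longrightarrow> f x \<le> f y"
  using f_mono[of "\<bar>x\<bar>" "\<bar>y\<bar>"] by (simp add: f_def)

text \<open>Since \<open>f\<close> grows with the modulus, the Kruzhkov flux is no larger at -a than
  at a. This is the entropy condition for a shock at rest that drops from a to -a.\<close>

lemma kflux_jump: "0 \<le> a \<Longrightarrow> kflux k (- a) \<le> kflux k a"
proof -
  assume "0 \<le> a"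
  then have "f (max (- a) k) \<le> f (max a k)" "f (min a k) \<le> f (min (- a) k)"
    by (auto intro!: f_mono_abs simp: max_def min_def)
  then show ?thesis unfolding kflux_eq by linarith
qed

text \<open>One branch of the solution at a fixed time: \<open>\<sigma> = 1\<close> to the right of \<open>c\<close>, \<open>\<sigma> = -1\<close> to its left.\<close>
lemma branch_integral:
  fixes \<phi> \<phi>' :: "real \<Rightarrow> real" and c t \<sigma> k :: real
  defines "u \<equiv> \<lambda>x. \<sigma> * ((x - c) * \<sigma> / (1 + t)) powr s"
  assumes ab: "\<alpha> \<le> \<beta>" and \<sigma>: "\<sigma> = 1 \<or> \<sigma> = - 1" and t: "0 \<le> t"
    and side: "\<And>x. x \<in> {\<alpha><..<\<beta>} \<Longrightarrow> 0 < (x - c) * \<sigma>" "0 \<le> (\<alpha> - c) * \<sigma>" "0 \<le> (\<beta> - c) * \<sigma>"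
    and \<phi>: "\<And>x. (\<phi> has_real_derivative \<phi>' x) (at x)"
  shows "((\<lambda>x. kflux k (u x) * \<phi>' x + s * sgn (u x - k) * u x / (1 + t) * \<phi> x) has_integral
      (kflux k (u \<beta>) * \<phi> \<beta> - kflux k (u \<alpha>) * \<phi> \<alpha>)) {\<alpha>..\<beta>}"
proof -
  have side': "0 \<le> (x - c) * \<sigma>" if "x \<in> {\<alpha>..\<beta>}" for x
    using side that by (cases "x = \<alpha> \<or> x = \<beta>") (auto simp: less_imp_le)
  let ?Z = "{x \<in> {\<alpha>..\<beta>}. u x = k}"
  \<comment> \<open>On one branch \<open>u\<close> is injective, so u = k holds at one point at most
    and sgn (u - k) is locally constant elsewhere.\<close>
  have inj: "x = y" if "x \<in> ?Z" "y \<in> ?Z" for x y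
  proof -
    have "((x - c) * \<sigma> / (1 + t)) powr s = ((y - c) * \<sigma> / (1 + t)) powr s"
      using that \<sigma> by (auto simp: u_def)
    then have "(((x - c) * \<sigma> / (1 + t)) powr s) powr p = (((y - c) * \<sigma> / (1 + t)) powr s) powr p" by simp
    moreover have "0 \<le> (x - c) * \<sigma> / (1 + t)" "0 \<le> (y - c) * \<sigma> / (1 + t)" using side' that t by auto
    moreover have "(z powr s) powr p = z" if "0 \<le> z" for z using that by (simp add: powr_powr ps)
    ultimately have "(x - c) * \<sigma> / (1 + t) = (y - c) * \<sigma> / (1 + t)" by simp
    then show ?thesis using \<sigma> t by auto
  qed
  have "finite ?Z"
  proof (cases "?Z = {}")
    case False
    then obtain z where "z \<in> ?Z" by blast
    then have "?Z \<subseteq> {z}" using inj by blast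
    then show ?thesis using finite_subset by blast
  next
    case True
    then show ?thesis by (simp only: finite.emptyI)
  qed
  then show ?thesis
  proof (rule fundamental_theorem_of_calculus_interior_strong)
    show "\<alpha> \<le> \<beta>" by (rule ab)
    have cu: "continuous_on {\<alpha>..\<beta>} u"
      unfolding u_def using side' s_pos t by (intro continuous_intros continuous_on_powr') auto
    have c\<phi>: "continuous_on {\<alpha>..\<beta>} \<phi>"
      by (rule DERIV_continuous_on[OF has_field_derivative_at_within[OF \<phi>]])
    show "continuous_on {\<alpha>..\<beta>} (\<lambda>x. kflux k (u x) * \<phi> x)"
      by (intro continuous_on_mult c\<phi> continuous_on_compose2[OF kflux_cont cu]) auto
    fix x assume x: "x \<in> {\<alpha><..<\<beta>} - ?Z"
    then have pos: "0 < (x - c) * \<sigma>" and neq: "u x \<noteq> k" using side(1) by auto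
    have du: "(u has_real_derivative \<sigma> * (s * \<sigma> * ((x - c) * \<sigma> / (1 + t)) powr (s - 1) / (1 + t))) (at x)"
      unfolding u_def using t by (intro DERIV_cmult powr_has_derivative pos \<sigma>) auto
    have fu: "f (u y) = ((y - c) * \<sigma> / (1 + t)) powr (1 + s) / (p + 1)" if "y \<in> {\<alpha><..<\<beta>}" for y
      using side(1)[OF that] \<sigma> t conj_exp(1)
      by (auto simp: f_def u_def abs_mult powr_powr mult.commute)
    have "((\<lambda>y. ((y - c) * \<sigma> / (1 + t)) powr (1 + s) / (p + 1)) has_real_derivative
        (1 + s) * \<sigma> * ((x - c) * \<sigma> / (1 + t)) powr ((1 + s) - 1) / (1 + t) / (p + 1)) (at x)"
      using t by (intro DERIV_cdivide powr_has_derivative pos \<sigma>) auto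
    also have "(1 + s) * \<sigma> * ((x - c) * \<sigma> / (1 + t)) powr ((1 + s) - 1) / (1 + t) / (p + 1) = s * u x / (1 + t)"
    proof -
      have "(1 + s) / (p + 1) = s" using p conj_exp(1) by (simp add: field_simps)
      have "(1 + s) * \<sigma> * ((x - c) * \<sigma> / (1 + t)) powr ((1 + s) - 1) / (1 + t) / (p + 1) = (1 + s) / (p + 1) * u x / (1 + t)"
        by (simp add: u_def mult.commute mult.left_commute)
      then show ?thesis using \<open>(1 + s) / (p + 1) = s\<close> by simp
    qed
    finally have "((\<lambda>y. f (u y)) has_real_derivative s * u x / (1 + t)) (at x)"
      by (rule has_field_derivative_transform_within_open[where S = "{\<alpha><..<\<beta>}"]) (use x fu in auto)
    then have "((\<lambda>y. f (u y) - f k) has_real_derivative s * u x / (1 + t)) (at x)"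
      by (auto intro!: derivative_eq_intros)
    from DERIV_mult[OF DERIV_mult[OF DERIV_sgn[OF du neq] this] \<phi>]
    have "((\<lambda>x. kflux k (u x) * \<phi> x) has_real_derivative
        (0 * (f (u x) - f k) + s * u x / (1 + t) * sgn (u x - k)) * \<phi> x + \<phi>' x * (sgn (u x - k) * (f (u x) - f k))) (at x)"
      unfolding kflux_def .
    moreover have "(0 * (f (u x) - f k) + s * u x / (1 + t) * sgn (u x - k)) * \<phi> x + \<phi>' x * (sgn (u x - k) * (f (u x) - f k))
        = kflux k (u x) * \<phi>' x + s * sgn (u x - k) * u x / (1 + t) * \<phi> x"
      by (simp add: kflux_def)
    ultimately show "((\<lambda>x. kflux k (u x) * \<phi> x) has_vector_derivative
        kflux k (u x) * \<phi>' x + s * sgn (u x - k) * u x / (1 + t) * \<phi> x) (at x)"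
      by (simp add: has_real_derivative_iff_has_vector_derivative)
  qed
qed

text \<open>The coefficient of \<phi> is the space derivative of the Kruzhkov flux on the smooth
  pieces, which equals minus the time derivative of |u - k|. Adding and subtracting this term splits
  the entropy integral into a space part, treated for fixed t, and a time part, treated for fixed
  x.\<close>

abbreviation dens :: "real \<Rightarrow> real \<Rightarrow> (real \<Rightarrow> real) \<Rightarrow> (real \<Rightarrow> real) \<Rightarrow> real \<Rightarrow> real" where
  "dens k t \<phi> \<phi>' x \<equiv> kflux k (sol s x t) * \<phi>' x + s * sgn (sol s x t - k) * sol s x t / (1 + t) * \<phi> x"

text \<open>Both branches integrate exactly. At the nodes \<open>u\<close> is 0, whence the factor
  \<open>kflux k 0\<close>; the two boundary terms at the midpoint combine to the jump of the flux
  there, which has the good sign.\<close>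

lemma gap_integral_ge:
  assumes t: "0 \<le> t" and \<phi>: "\<And>x. (\<phi> has_real_derivative \<phi>' x) (at x)" and \<phi>0: "\<And>x. 0 \<le> \<phi> x"
    and int: "dens k t \<phi> \<phi>' integrable_on {node (Suc n)..node n}"
  shows "kflux k 0 * (\<phi> (node n) - \<phi> (node (Suc n))) \<le> integral {node (Suc n)..node n} (dens k t \<phi> \<phi>')"
proof -
  let ?c = "node (Suc n)" and ?d = "node n" and ?m = "mid n"
  let ?a = "(half n / (1 + t)) powr s"
  note mb = mid_bounds[of n]
  let ?l = "\<lambda>x. 1 * ((x - ?c) * 1 / (1 + t)) powr s" and ?r = "\<lambda>x. -1 * ((x - ?d) * -1 / (1 + t)) powr s"
  have L: "((\<lambda>x. kflux k (?l x) * \<phi>' x + s * sgn (?l x - k) * ?l x / (1 + t) * \<phi> x) has_integral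
      (kflux k (?l ?m) * \<phi> ?m - kflux k (?l ?c) * \<phi> ?c)) {?c..?m}"
    by (rule branch_integral) (use mb t \<phi> in auto)
  have R: "((\<lambda>x. kflux k (?r x) * \<phi>' x + s * sgn (?r x - k) * ?r x / (1 + t) * \<phi> x) has_integral
      (kflux k (?r ?d) * \<phi> ?d - kflux k (?r ?m) * \<phi> ?m)) {?m..?d}"
    by (rule branch_integral) (use mb t \<phi> in auto)
  have sl: "sol s x t = ?l x" if "x \<in> {?c..?m}" for x
    using that sdist_left[of n x] s_pos by (auto simp: sol_def sgn_if)
  \<comment> \<open>At the midpoint itself \<open>sol\<close> takes the left branch; one point does
    not affect the integral.\<close>
  have sr: "sol s x t = ?r x" if "x \<in> {?m..?d} - {?m}" for x
    using that sdist_right[of n x] s_pos by (auto simp: sol_def sgn_if)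
  have "(dens k t \<phi> \<phi>' has_integral (kflux k (?l ?m) * \<phi> ?m - kflux k (?l ?c) * \<phi> ?c)) {?c..?m}"
    by (rule has_integral_eq[OF _ L]) (simp only: sl)
  then have IL: "integral {?c..?m} (dens k t \<phi> \<phi>') = kflux k ?a * \<phi> ?m - kflux k 0 * \<phi> ?c"
    using mid_half(1)[of n] s_pos by (simp add: integral_unique mid_def half_def field_simps)
  have "(dens k t \<phi> \<phi>' has_integral (kflux k (?r ?d) * \<phi> ?d - kflux k (?r ?m) * \<phi> ?m)) {?m..?d}"
    by (rule has_integral_spike_finite[of "{?m}", OF _ _ R]) (simp_all only: sr finite.intros)
  then have IR: "integral {?m..?d} (dens k t \<phi> \<phi>') = kflux k 0 * \<phi> ?d - kflux k (- ?a) * \<phi> ?m"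
    using mid_half(2)[of n] s_pos by (simp add: integral_unique mid_def half_def field_simps)
  have "integral {?c..?m} (dens k t \<phi> \<phi>') + integral {?m..?d} (dens k t \<phi> \<phi>') = integral {?c..?d} (dens k t \<phi> \<phi>')"
    by (rule Henstock_Kurzweil_Integration.integral_combine[OF _ _ int]) (use mb in auto)
  moreover have "kflux k (- ?a) * \<phi> ?m \<le> kflux k ?a * \<phi> ?m"
    by (rule mult_right_mono[OF kflux_jump \<phi>0]) simp
  ultimately show ?thesis using IL IR by (simp add: right_diff_distrib)
qed

text \<open>The gap bounds telescope because consecutive gaps share the factor
  \<open>kflux k 0\<close> at their common node. All gaps are exhausted by letting N tend to
  infinity, with continuity at 0. Outside the gaps \<open>u\<close> vanishes and the same factor
  appears, so the total lower bound is \<open>kflux k 0\<close> times \<phi> R - \<phi>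
  (-R).\<close>

lemma space_integral_nonneg:
  assumes t: "0 \<le> t" and \<phi>: "\<And>x. (\<phi> has_real_derivative \<phi>' x) (at x)" and \<phi>0: "\<And>x. 0 \<le> \<phi> x"
    and int: "\<And>a b. dens k t \<phi> \<phi>' integrable_on {a..b}"
    and R: "node 0 \<le> R" and z: "\<phi> R = 0" "\<phi> (- R) = 0"
  shows "0 \<le> integral {-R..R} (dens k t \<phi> \<phi>')"
proof -
  let ?q = "dens k t \<phi> \<phi>'"
  have R0: "0 < R" using R node_pos[of 0] by linarith
  have tele: "kflux k 0 * (\<phi> (node 0) - \<phi> (node N)) \<le> integral {node N..node 0} ?q" for N
  proof (induction N)
    case 0
    then show ?case by simp
  next
    case (Suc N)
    have "integral {node (Suc N)..node N} ?q + integral {node N..node 0} ?q = integral {node (Suc N)..node 0} ?q"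
      by (rule Henstock_Kurzweil_Integration.integral_combine[OF _ _ int])
         (use node_Suc_less[of N] node_antimono[of 0 N] in auto)
    then show ?case using Suc gap_integral_ge[OF t \<phi> \<phi>0 int, of N] by (simp add: right_diff_distrib)
  qed
  have c\<phi>: "continuous_on UNIV \<phi>"
    by (rule DERIV_continuous_on[OF has_field_derivative_at_within[OF \<phi>]])
  have l1: "(\<lambda>N. integral {node N..node 0} ?q) \<longlonglongrightarrow> integral {0..node 0} ?q"
  proof -
    have "continuous_on {0..node 0} (\<lambda>x. integral {x..node 0} ?q)"
      by (rule indefinite_integral_continuous_1'[OF int])
    then show ?thesis
      by (rule continuous_on_tendsto_compose[OF _ node_tendsto])
         (use node_pos node_antimono[of 0] in \<open>auto simp: less_imp_le\<close>)
  qed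
  have l2: "(\<lambda>N. kflux k 0 * (\<phi> (node 0) - \<phi> (node N))) \<longlonglongrightarrow> kflux k 0 * (\<phi> (node 0) - \<phi> 0)"
    by (intro tendsto_intros continuous_on_tendsto_compose[OF c\<phi> node_tendsto]) auto
  have mid_part: "kflux k 0 * (\<phi> (node 0) - \<phi> 0) \<le> integral {0..node 0} ?q"
    by (rule LIMSEQ_le[OF l2 l1]) (use tele in auto)
  have outer: "integral {a..b} ?q = kflux k 0 * (\<phi> b - \<phi> a)" if "a \<le> b" "b \<le> 0 \<or> node 0 \<le> a" for a b
  proof -
    have sd: "sol s x t = 0" if "x \<in> {a..b}" for x
      using that \<open>b \<le> 0 \<or> node 0 \<le> a\<close> by (auto simp: sol_def sdist_outside)
    have "((\<lambda>x. kflux k 0 * \<phi>' x) has_integral (kflux k 0 * \<phi> b - kflux k 0 * \<phi> a)) {a..b}"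
      by (rule fundamental_theorem_of_calculus[OF \<open>a \<le> b\<close>])
         (use DERIV_cmult[OF \<phi>, of "kflux k 0"] in
          \<open>auto simp: has_real_derivative_iff_has_vector_derivative intro: has_vector_derivative_at_within\<close>)
    then have "(?q has_integral (kflux k 0 * \<phi> b - kflux k 0 * \<phi> a)) {a..b}"
      by (rule has_integral_eq[rotated]) (simp add: sd)
    then show ?thesis by (simp add: integral_unique right_diff_distrib)
  qed
  have c1: "integral {-R..0} ?q + integral {0..R} ?q = integral {-R..R} ?q"
    by (rule Henstock_Kurzweil_Integration.integral_combine[OF _ _ int]) (use R0 in auto)
  have c2: "integral {0..node 0} ?q + integral {node 0..R} ?q = integral {0..R} ?q"
    by (rule Henstock_Kurzweil_Integration.integral_combine[OF _ _ int]) (use R node_pos[of 0] in auto)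
  show ?thesis
    using c1 c2 mid_part outer[of "-R" 0] outer[of "node 0" R] R R0 z by (simp add: right_diff_distrib)
qed

text \<open>For fixed x the integrand is the time derivative of |u - k| \<phi>, since u_t = - s u /
  (1 + t). Where sdist x \<noteq> 0 the solution is injective in t and meets k at most once; where
  sdist x = 0 it is constant, possibly equal to k, and is treated separately.\<close>

lemma time_integral_zero:
  assumes T: "0 \<le> T" and \<phi>: "\<And>t. (\<phi> has_real_derivative \<phi>' t) (at t)" and z: "\<phi> 0 = 0" "\<phi> T = 0"
  shows "((\<lambda>t. \<bar>sol s x t - k\<bar> * \<phi>' t - s * sgn (sol s x t - k) * sol s x t / (1 + t) * \<phi> t) has_integral 0) {0..T}"
proof (cases "sdist x = 0")
  case True
  then have "((\<lambda>t. \<bar>sol s x t - k\<bar> * \<phi>' t - s * sgn (sol s x t - k) * sol s x t / (1 + t) * \<phi> t)) = (\<lambda>t. \<bar>k\<bar> * \<phi>' t)"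
    by (simp add: sol_def)
  moreover have "((\<lambda>t. \<bar>k\<bar> * \<phi>' t) has_integral (\<bar>k\<bar> * \<phi> T - \<bar>k\<bar> * \<phi> 0)) {0..T}"
    by (rule fundamental_theorem_of_calculus[OF T])
       (use DERIV_cmult[OF \<phi>, of "\<bar>k\<bar>"] in
          \<open>auto simp: has_real_derivative_iff_has_vector_derivative intro: has_vector_derivative_at_within\<close>)
  ultimately show ?thesis using z by simp
next
  case False
  let ?a = "\<bar>sdist x\<bar>"
  have a: "0 < ?a" using False by simp
  let ?Z = "{t \<in> {0..T}. sol s x t = k}"
  have inj: "t = t'" if "t \<in> ?Z" "t' \<in> ?Z" for t t'
  proof -
    have "(?a / (1 + t)) powr s = (?a / (1 + t')) powr s"
      using that False by (auto simp: sol_def sgn_if split: if_splits)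
    then have "((?a / (1 + t)) powr s) powr p = ((?a / (1 + t')) powr s) powr p" by simp
    then have "?a / (1 + t) = ?a / (1 + t')" using that by (simp add: powr_powr ps)
    then show ?thesis using a that by (simp add: frac_eq_eq)
  qed
  have "finite ?Z"
  proof (cases "?Z = {}")
    case False
    then obtain z where "z \<in> ?Z" by blast
    then have "?Z \<subseteq> {z}" using inj by blast
    then show ?thesis using finite_subset by blast
  next
    case True
    then show ?thesis by (simp only: finite.emptyI)
  qed
  then have "((\<lambda>t. \<bar>sol s x t - k\<bar> * \<phi>' t - s * sgn (sol s x t - k) * sol s x t / (1 + t) * \<phi> t) has_integral
      (\<bar>sol s x T - k\<bar> * \<phi> T - \<bar>sol s x 0 - k\<bar> * \<phi> 0)) {0..T}"
  proof (rule fundamental_theorem_of_calculus_strong[OF _ T])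
    have cu: "continuous_on {0..T} (sol s x)"
      unfolding sol_def using s_pos by (intro continuous_intros continuous_on_powr') auto
    have "continuous_on {0..T} \<phi>"
      by (rule DERIV_continuous_on[OF has_field_derivative_at_within[OF \<phi>]])
    then show "continuous_on {0..T} (\<lambda>t. \<bar>sol s x t - k\<bar> * \<phi> t)"
      by (intro continuous_intros cu)
    fix t assume t: "t \<in> {0..T} - ?Z"
    then have neq: "sol s x t \<noteq> k" and t0: "0 \<le> t" by auto
    have "((\<lambda>t. ?a / (1 + t)) has_real_derivative - ?a / (1 + t)\<^sup>2) (at t)"
      using t0 by (auto intro!: derivative_eq_intros simp: power2_eq_square)
    moreover have "((\<lambda>y. y powr s) has_real_derivative s * (?a / (1 + t)) powr (s - 1)) (at (?a / (1 + t)))"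
      by (rule has_real_derivative_powr) (use a t0 in auto)
    ultimately have "((\<lambda>t. (?a / (1 + t)) powr s) has_real_derivative s * (?a / (1 + t)) powr (s - 1) * (- ?a / (1 + t)\<^sup>2)) (at t)"
      by (rule DERIV_chain')
    from DERIV_cmult[OF this, of "sgn (sdist x)"]
    have "((\<lambda>t. sol s x t) has_real_derivative sgn (sdist x) * (s * (?a / (1 + t)) powr (s - 1) * (- ?a / (1 + t)\<^sup>2))) (at t)"
      unfolding sol_def .
    also have "sgn (sdist x) * (s * (?a / (1 + t)) powr (s - 1) * (- ?a / (1 + t)\<^sup>2)) = - (s * sol s x t / (1 + t))"
    proof -
      have "(?a / (1 + t)) powr s = (?a / (1 + t)) powr (s - 1) * (?a / (1 + t))"
        using a t0 by (simp add: powr_diff)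
      then show ?thesis by (simp add: sol_def power2_eq_square)
    qed
    finally have du: "((\<lambda>t. sol s x t) has_real_derivative - (s * sol s x t / (1 + t))) (at t)" .
    from DERIV_mult[OF DERIV_abs_diff[OF du neq] \<phi>]
    have "((\<lambda>t. \<bar>sol s x t - k\<bar> * \<phi> t) has_real_derivative
        \<bar>sol s x t - k\<bar> * \<phi>' t - s * sgn (sol s x t - k) * sol s x t / (1 + t) * \<phi> t) (at t)"
      by (rule DERIV_cong) (simp add: algebra_simps)
    then show "((\<lambda>t. \<bar>sol s x t - k\<bar> * \<phi> t) has_vector_derivative
        \<bar>sol s x t - k\<bar> * \<phi>' t - s * sgn (sol s x t - k) * sol s x t / (1 + t) * \<phi> t) (at t)"
      by (simp add: has_real_derivative_iff_has_vector_derivative)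
  qed
  then show ?thesis using z by simp
qed

end

text \<open>The free bound \<open>r\<close> lets the box be chosen wide enough to contain all gaps.
  The box is open and the support lies inside it, so \<phi> and its partial derivatives also vanish
  on the edges where boundary terms are evaluated.\<close>

lemma test_function_partials:
  assumes "test_function \<phi>"
  obtains \<phi>x \<phi>t R B where
    "\<And>x t. ((\<lambda>y. \<phi> (y, t)) has_real_derivative \<phi>x (x, t)) (at x)"
    "\<And>x t. ((\<lambda>\<tau>. \<phi> (x, \<tau>)) has_real_derivative \<phi>t (x, t)) (at t)"
    "continuous_on UNIV \<phi>" "continuous_on UNIV \<phi>x" "continuous_on UNIV \<phi>t"
    "r \<le> R" "0 < R"
    "\<And>z. z \<notin> {-R<..<R} \<times> {0<..<R} \<Longrightarrow> \<phi> z = 0 \<and> \<phi>x z = 0 \<and> \<phi>t z = 0"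
    "\<And>z. \<bar>\<phi> z\<bar> \<le> B \<and> \<bar>\<phi>x z\<bar> \<le> B \<and> \<bar>\<phi>t z\<bar> \<le> B"
proof -
  define \<phi>x where "\<phi>x z = frechet_derivative \<phi> (at z) (1, 0)" for z
  define \<phi>t where "\<phi>t z = frechet_derivative \<phi> (at z) (0, 1)" for z
  have "C_k (Suc 0) \<phi>" and cs: "compact (tsupport \<phi>)" and sub: "tsupport \<phi> \<subseteq> UNIV \<times> {0<..}"
    using assms unfolding test_function_def by blast+
  then have df: "\<phi> differentiable (at z)" and cx: "continuous_on UNIV \<phi>x" and ct: "continuous_on UNIV \<phi>t" for z
    unfolding \<phi>x_def \<phi>t_def by (simp_all del: split_paired_All)
  have hd: "(\<phi> has_derivative frechet_derivative \<phi> (at z)) (at z)" for z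
    using df frechet_derivative_works by blast
  have c\<phi>: "continuous_on UNIV \<phi>"
    using hd has_derivative_continuous continuous_at_imp_continuous_on by blast
  have dx: "((\<lambda>y. \<phi> (y, t)) has_real_derivative \<phi>x (x, t)) (at x)" for x t
  proof -
    have "((\<lambda>y. (y, t)) has_derivative (\<lambda>h. (h, 0))) (at x)" by (auto intro!: derivative_eq_intros)
    from has_derivative_compose[OF this hd]
    have "((\<lambda>y. \<phi> (y, t)) has_derivative (\<lambda>h. frechet_derivative \<phi> (at (x, t)) (h, 0))) (at x)" .
    moreover have "frechet_derivative \<phi> (at (x, t)) (h, 0) = \<phi>x (x, t) * h" for h
      using linear_scale[OF linear_frechet_derivative[OF df[of "(x, t)"]], of h "(1, 0)"] by (simp add: \<phi>x_def)
    ultimately show ?thesis by (simp add: has_field_derivative_def)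
  qed
  have dt: "((\<lambda>\<tau>. \<phi> (x, \<tau>)) has_real_derivative \<phi>t (x, t)) (at t)" for x t
  proof -
    have "((\<lambda>\<tau>. (x, \<tau>)) has_derivative (\<lambda>h. (0, h))) (at t)" by (auto intro!: derivative_eq_intros)
    from has_derivative_compose[OF this hd]
    have "((\<lambda>\<tau>. \<phi> (x, \<tau>)) has_derivative (\<lambda>h. frechet_derivative \<phi> (at (x, t)) (0, h))) (at t)" .
    moreover have "frechet_derivative \<phi> (at (x, t)) (0, h) = \<phi>t (x, t) * h" for h
      using linear_scale[OF linear_frechet_derivative[OF df[of "(x, t)"]], of h "(0, 1)"] by (simp add: \<phi>t_def)
    ultimately show ?thesis by (simp add: has_field_derivative_def)
  qed
  have zero: "\<phi> z = 0 \<and> \<phi>x z = 0 \<and> \<phi>t z = 0" if z: "z \<notin> tsupport \<phi>" for z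
  proof -
    have out: "\<phi> y = 0" if "y \<in> - tsupport \<phi>" for y
      using that closure_subset[of "{z. \<phi> z \<noteq> 0}"] by (auto simp: tsupport_def)
    have "open (- tsupport \<phi>)" by (simp add: tsupport_def open_Compl)
    moreover have "((\<lambda>y. 0) has_derivative (\<lambda>v. 0)) (at z)" by simp
    ultimately have "(\<phi> has_derivative (\<lambda>v. 0)) (at z)"
      using z out by (auto intro: has_derivative_transform_within_open[of "\<lambda>y. 0" _ z UNIV "- tsupport \<phi>"])
    then have "frechet_derivative \<phi> (at z) = (\<lambda>v. 0)" using frechet_derivative_at by metis
    then show ?thesis using out z by (simp add: \<phi>x_def \<phi>t_def)
  qed
  obtain b where b: "\<And>z. z \<in> tsupport \<phi> \<Longrightarrow> norm z \<le> b"
    using compact_imp_bounded[OF cs] by (auto simp: bounded_iff)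
  define R where "R = max (max b r) 0 + 1"
  have box: "z \<in> {-R<..<R} \<times> {0<..<R}" if "z \<in> tsupport \<phi>" for z
  proof -
    have "\<bar>fst z\<bar> \<le> b" "\<bar>snd z\<bar> \<le> b" using b[OF that] norm_fst_le[of "fst z" "snd z"] norm_snd_le[of "snd z" "fst z"] by auto
    moreover have "0 < snd z" using sub that by auto
    ultimately show ?thesis by (cases z) (auto simp: R_def)
  qed
  have bdd: "\<exists>B. \<forall>z. \<bar>g z\<bar> \<le> B" if g: "continuous_on UNIV g" "\<And>z. z \<notin> tsupport \<phi> \<Longrightarrow> g z = 0" for g :: "real \<times> real \<Rightarrow> real"
  proof -
    have "compact (g ` tsupport \<phi>)" using cs g(1) by (intro compact_continuous_image) (auto intro: continuous_on_subset)
    then obtain B where B: "\<And>z. z \<in> tsupport \<phi> \<Longrightarrow> \<bar>g z\<bar> \<le> B"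
      using compact_imp_bounded[THEN bounded_iff[THEN iffD1]] by (metis image_eqI real_norm_def)
    have "\<bar>g z\<bar> \<le> max B 0" for z
      using B[of z] g(2)[of z] by (cases "z \<in> tsupport \<phi>") auto
    then show ?thesis by blast
  qed
  obtain B1 where B1: "\<And>z. \<bar>\<phi> z\<bar> \<le> B1" using bdd[OF c\<phi>] zero by blast
  obtain B2 where B2: "\<And>z. \<bar>\<phi>x z\<bar> \<le> B2" using bdd[OF cx] zero by blast
  obtain B3 where B3: "\<And>z. \<bar>\<phi>t z\<bar> \<le> B3" using bdd[OF ct] zero by blast
  show ?thesis
  proof (rule that[of \<phi>x \<phi>t R "max B1 (max B2 B3)"])
    show "\<phi> z = 0 \<and> \<phi>x z = 0 \<and> \<phi>t z = 0" if "z \<notin> {-R<..<R} \<times> {0<..<R}" for z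
      using zero box that by blast
    show "\<bar>\<phi> z\<bar> \<le> max B1 (max B2 B3) \<and> \<bar>\<phi>x z\<bar> \<le> max B1 (max B2 B3) \<and> \<bar>\<phi>t z\<bar> \<le> max B1 (max B2 B3)" for z
      using B1[of z] B2[of z] B3[of z] by linarith
  qed (use dx dt c\<phi> cx ct in \<open>auto simp: R_def\<close>)
qed

section \<open>Entropy inequality for the explicit solution\<close>

lemma box_integrable:
  fixes h :: "real \<times> real \<Rightarrow> real"
  assumes h: "h \<in> borel_measurable borel" and b: "\<And>x t. 0 \<le> t \<Longrightarrow> \<bar>h (x, t)\<bar> \<le> C"
  shows "integrable lborel (\<lambda>z. indicator ({-R..R} \<times> {0..R}) z * h z)"
proof (rule Bochner_Integration.integrable_bound[OF integrable_indicator_box[of C "-R" R 0 R]])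
  have "{-R..R} \<times> {0..R} \<in> sets borel" by (intro borel_closed closed_Times) auto
  then show "(\<lambda>z. indicator ({-R..R} \<times> {0..R}) z * h z) \<in> borel_measurable lborel" using h by simp
  have "norm (indicator ({-R..R} \<times> {0..R}) z * h z) \<le> norm (C * indicat_real ({-R..R} \<times> {0..R}) z)" for z
    using b[of "snd z" "fst z"] by (cases z) (auto simp: indicator_def)
  then show "AE z in lborel. norm (indicator ({-R..R} \<times> {0..R}) z * h z) \<le> norm (C * indicat_real ({-R..R} \<times> {0..R}) z)"
    by simp
qed

lemma bounded_set_integrable:
  fixes g :: "real \<Rightarrow> real"
  assumes g: "g \<in> borel_measurable borel" and b: "\<And>x. x \<in> {a..b} \<Longrightarrow> \<bar>g x\<bar> \<le> C"
  shows "set_integrable lborel {a..b} g"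
  unfolding set_integrable_def
proof (rule Bochner_Integration.integrable_bound)
  show "integrable lborel (\<lambda>x. C * indicat_real {a..b} x)"
    by (intro integrable_mult_right integrable_real_indicator) (auto simp: emeasure_lborel_Icc_eq)
  show "(\<lambda>x. indicat_real {a..b} x *\<^sub>R g x) \<in> borel_measurable lborel" using g by simp
  have "norm (indicat_real {a..b} x *\<^sub>R g x) \<le> norm (C * indicat_real {a..b} x)" for x
    using b[of x] by (auto simp: indicator_def)
  then show "AE x in lborel. norm (indicat_real {a..b} x *\<^sub>R g x) \<le> norm (C * indicat_real {a..b} x)" by simp
qed

context power_flux
begin

lemma sol2_measurable: "(\<lambda>z. sol s (fst z) (snd z)) \<in> borel_measurable borel"
proof -
  have fm: "(\<lambda>z::real \<times> real. fst z) \<in> borel_measurable borel"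
    and [measurable]: "(\<lambda>z::real \<times> real. snd z) \<in> borel_measurable borel"
    by (intro borel_measurable_continuous_onI continuous_intros)+
  have [measurable]: "(\<lambda>z::real \<times> real. sdist (fst z)) \<in> borel_measurable borel"
    by (rule measurable_compose[OF fm sdist_measurable])
  show ?thesis unfolding sol_def by measurable
qed

text \<open>Fubini in opposite orders: \<open>hA\<close> is integrated first in time, giving 0 for
  every x, and \<open>hB\<close> first in space, giving a nonnegative value for every t.\<close>

lemma sol_entropy_inequality: "entropy_inequality f (sol s) k"
  unfolding entropy_inequality_def
proof (intro allI impI, elim conjE)
  fix \<phi> assume test: "test_function \<phi>" and \<phi>0: "\<forall>z. 0 \<le> \<phi> z"
  obtain \<phi>x \<phi>t R B where dx: "\<And>x t. ((\<lambda>y. \<phi> (y, t)) has_real_derivative \<phi>x (x, t)) (at x)"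
    and dt: "\<And>x t. ((\<lambda>\<tau>. \<phi> (x, \<tau>)) has_real_derivative \<phi>t (x, t)) (at t)"
    and cont: "continuous_on UNIV \<phi>" "continuous_on UNIV \<phi>x" "continuous_on UNIV \<phi>t"
    and R: "node 0 \<le> R" "0 < R"
    and out: "\<And>z. z \<notin> {-R<..<R} \<times> {0<..<R} \<Longrightarrow> \<phi> z = 0 \<and> \<phi>x z = 0 \<and> \<phi>t z = 0"
    and B: "\<And>z. \<bar>\<phi> z\<bar> \<le> B \<and> \<bar>\<phi>x z\<bar> \<le> B \<and> \<bar>\<phi>t z\<bar> \<le> B"
    using test_function_partials[OF test, of "node 0"] by blast
  let ?S = "{-R..R} \<times> {0..R}"
  define u where "u z = sol s (fst z) (snd z)" for z
  \<comment> \<open>The common term that is subtracted in the time part \<open>hA\<close> and added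
    in the space part \<open>hB\<close>.\<close>
  define G where "G z = s * sgn (u z - k) * u z / (1 + snd z) * \<phi> z" for z
  define hA where "hA z = \<bar>u z - k\<bar> * \<phi>t z - G z" for z
  define hB where "hB z = kflux k (u z) * \<phi>x z + G z" for z
  have um[measurable]: "u \<in> borel_measurable borel" unfolding u_def by (rule sol2_measurable)
  have sm[measurable]: "(\<lambda>z::real \<times> real. snd z) \<in> borel_measurable borel"
    by (intro borel_measurable_continuous_onI continuous_intros)
  have pm[measurable]: "\<phi> \<in> borel_measurable borel" "\<phi>x \<in> borel_measurable borel" "\<phi>t \<in> borel_measurable borel"
    using cont by (auto intro: borel_measurable_continuous_onI)
  have km[measurable]: "(\<lambda>z. kflux k (u z)) \<in> borel_measurable borel"
    by (rule measurable_compose[OF um borel_measurable_continuous_onI[OF kflux_cont]])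
  have Gm[measurable]: "G \<in> borel_measurable borel" unfolding G_def by measurable
  have hAm: "hA \<in> borel_measurable borel" unfolding hA_def by measurable
  have hBm: "hB \<in> borel_measurable borel" unfolding hB_def by measurable
  define U where "U = node 0 powr s"
  have U0: "0 \<le> U" by (simp add: U_def)
  have B0: "0 \<le> B" using B[of undefined] by (meson abs_ge_zero order_trans)
  have ub: "\<bar>u (x, t)\<bar> \<le> U" if "0 \<le> t" for x t
    unfolding u_def U_def using sol_bound[of s t x] s_pos that by simp
  have Gb: "\<bar>G (x, t)\<bar> \<le> s * 1 * U / 1 * B" if t: "0 \<le> t" for x t
    unfolding G_def abs_mult abs_divide
    using ub[OF t, of x] B[of "(x, t)"] s_pos t U0 B0
    by (intro mult_mono frac_le) (auto simp: abs_sgn_eq)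
  have hAb: "\<bar>hA (x, t)\<bar> \<le> (U + \<bar>k\<bar>) * B + s * 1 * U / 1 * B" if t: "0 \<le> t" for x t
  proof -
    have "\<bar>\<bar>u (x, t) - k\<bar> * \<phi>t (x, t)\<bar> \<le> (U + \<bar>k\<bar>) * B"
      unfolding abs_mult using ub[OF t, of x] B[of "(x, t)"] by (intro mult_mono) auto
    then show ?thesis using Gb[OF t, of x] unfolding hA_def by linarith
  qed
  have hBb: "\<bar>hB (x, t)\<bar> \<le> (\<bar>f U\<bar> + 3 * \<bar>f k\<bar>) * B + s * 1 * U / 1 * B" if t: "0 \<le> t" for x t
  proof -
    have "\<bar>kflux k (u (x, t))\<bar> \<le> \<bar>f (u (x, t)) - f k\<bar>" by (simp add: kflux_def abs_mult abs_sgn_eq)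
    moreover have "f (u (x, t)) \<le> f U" by (rule f_mono_abs) (use ub[OF t, of x] U0 in auto)
    moreover have "0 \<le> f (u (x, t))" using p by (simp add: f_def)
    ultimately have "\<bar>kflux k (u (x, t))\<bar> \<le> \<bar>f U\<bar> + 3 * \<bar>f k\<bar>" by linarith
    then have "\<bar>kflux k (u (x, t)) * \<phi>x (x, t)\<bar> \<le> (\<bar>f U\<bar> + 3 * \<bar>f k\<bar>) * B"
      unfolding abs_mult using B[of "(x, t)"] by (intro mult_mono) auto
    then show ?thesis using Gb[OF t, of x] unfolding hB_def by linarith
  qed
  note iA = box_integrable[OF hAm hAb, of R] and iB = box_integrable[OF hBm hBb, of R]
  have pair: "(\<lambda>t::real. (x::real, t)) \<in> borel_measurable borel" "(\<lambda>x::real. (x, t::real)) \<in> borel_measurable borel" for x t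
    by (intro borel_measurable_continuous_onI continuous_intros)+
  have intA: "(LBINT z. indicator ?S z * hA z) = 0"
  proof -
    have "(LBINT z. indicator ?S z * hA z) = (LBINT x. LBINT t. indicator ?S (x, t) * hA (x, t))"
      using lborel_pair.integral_fst'[of "\<lambda>z. indicator ?S z * hA z"] iA by (simp add: lborel_prod)
    also have "\<dots> = integral\<^sup>L lborel (\<lambda>x::real. 0::real)"
    proof (rule Bochner_Integration.integral_cong[OF refl])
      fix x :: real
      have m: "(\<lambda>t. hA (x, t)) \<in> borel_measurable borel" by (rule measurable_compose[OF pair(1) hAm])
      have si: "set_integrable lborel {0..R} (\<lambda>t. hA (x, t))"
        by (rule bounded_set_integrable[OF m]) (use hAb in auto)
      have "(LBINT t. indicator ?S (x, t) * hA (x, t)) = indicator {-R..R} x * (LBINT t:{0..R}. hA (x, t))"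
        unfolding set_lebesgue_integral_def by (simp add: indicator_times mult.assoc)
      also have "(LBINT t:{0..R}. hA (x, t)) = integral {0..R} (\<lambda>t. hA (x, t))"
        by (rule set_borel_integral_eq_integral(2)[OF si])
      also have "\<dots> = 0"
      proof (rule integral_unique)
        have "((\<lambda>t. \<bar>sol s x t - k\<bar> * \<phi>t (x, t) - s * sgn (sol s x t - k) * sol s x t / (1 + t) * \<phi> (x, t)) has_integral 0) {0..R}"
          by (rule time_integral_zero[OF _ dt]) (use R out in auto)
        then show "((\<lambda>t. hA (x, t)) has_integral 0) {0..R}" by (simp add: hA_def G_def u_def)
      qed
      finally show "(LBINT t. indicator ?S (x, t) * hA (x, t)) = 0" by simp
    qed
    finally show ?thesis by simp
  qed
  have intB: "0 \<le> (LBINT z. indicator ?S z * hB z)"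
  proof -
    have "(LBINT z. indicator ?S z * hB z) = (LBINT t. LBINT x. indicator ?S (x, t) * hB (x, t))"
      using lborel_pair.integral_snd[of "\<lambda>x t. indicator ?S (x, t) * hB (x, t)"] iB
      by (simp add: lborel_prod case_prod_beta')
    also have "0 \<le> \<dots>"
    proof (rule Bochner_Integration.integral_nonneg)
      fix t :: real
      have m: "(\<lambda>x. hB (x, t)) \<in> borel_measurable borel" by (rule measurable_compose[OF pair(2) hBm])
      show "0 \<le> (LBINT x. indicator ?S (x, t) * hB (x, t))"
      proof (cases "t \<in> {0..R}")
        case True
        then have t: "0 \<le> t" by simp
        have si: "set_integrable lborel {a..b} (\<lambda>x. hB (x, t))" for a b
          by (rule bounded_set_integrable[OF m]) (use hBb t in auto)
        have "(LBINT x. indicator ?S (x, t) * hB (x, t)) = (LBINT x:{-R..R}. hB (x, t))"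
          unfolding set_lebesgue_integral_def using True by (simp add: indicator_times)
        also have "\<dots> = integral {-R..R} (\<lambda>x. hB (x, t))"
          by (rule set_borel_integral_eq_integral(2)[OF si])
        also have "0 \<le> \<dots>"
        proof -
          have eq: "(\<lambda>x. hB (x, t)) = dens k t (\<lambda>x. \<phi> (x, t)) (\<lambda>x. \<phi>x (x, t))"
            by (simp add: fun_eq_iff hB_def G_def u_def)
          show ?thesis
            unfolding eq
            by (rule space_integral_nonneg[OF t dx])
               (use \<phi>0 R out set_borel_integral_eq_integral(1)[OF si] in \<open>auto simp: eq\<close>)
        qed
        finally show ?thesis .
      next
        case False
        then show ?thesis by (simp add: indicator_times)
      qed
    qed
    finally show ?thesis .
  qed
  have pt: "indicator (UNIV \<times> {0<..}) z *\<^sub>R (case z of (x, t) \<Rightarrow> \<bar>sol s x t - k\<bar> * deriv (\<lambda>\<tau>. \<phi> (x, \<tau>)) t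
          + sgn (sol s x t - k) * (f (sol s x t) - f k) * deriv (\<lambda>y. \<phi> (y, t)) x)
        = indicator ?S z * hA z + indicator ?S z * hB z" for z :: "real \<times> real"
  proof -
    obtain x t where z: "z = (x, t)" by (cases z)
    have d: "deriv (\<lambda>\<tau>. \<phi> (x, \<tau>)) t = \<phi>t (x, t)" "deriv (\<lambda>y. \<phi> (y, t)) x = \<phi>x (x, t)"
      using dt dx by (auto intro: DERIV_imp_deriv)
    show ?thesis
    proof (cases "z \<in> {-R<..<R} \<times> {0<..<R}")
      case True
      then show ?thesis by (simp add: z d hA_def hB_def u_def kflux_def indicator_def)
    next
      case False
      then show ?thesis using out[OF False] by (simp add: z d hA_def hB_def G_def)
    qed
  qed
  have m: "(\<lambda>z. indicator ?S z * hA z + indicator ?S z * hB z) \<in> borel_measurable lborel"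
    by (intro borel_measurable_add borel_measurable_integrable[OF iA] borel_measurable_integrable[OF iB])
  have "(LINT (x, t):(UNIV \<times> {0<..})|lebesgue. \<bar>sol s x t - k\<bar> * deriv (\<lambda>\<tau>. \<phi> (x, \<tau>)) t
               + sgn (sol s x t - k) * (f (sol s x t) - f k) * deriv (\<lambda>y. \<phi> (y, t)) x)
      = (LINT z|lebesgue. indicator ?S z * hA z + indicator ?S z * hB z)"
    unfolding set_lebesgue_integral_def pt ..
  also have "\<dots> = (LBINT z. indicator ?S z * hA z + indicator ?S z * hB z)"
    by (rule integral_completion[OF m])
  also have "\<dots> = (LBINT z. indicator ?S z * hA z) + (LBINT z. indicator ?S z * hB z)"
    by (rule Bochner_Integration.integral_add[OF iA iB])
  finally show "0 \<le> (LINT (x, t):(UNIV \<times> {0<..})|lebesgue. \<bar>sol s x t - k\<bar> * deriv (\<lambda>\<tau>. \<phi> (x, \<tau>)) t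
               + sgn (sol s x t - k) * (f (sol s x t) - f k) * deriv (\<lambda>y. \<phi> (y, t)) x)"
    using intA intB by simp
qed

section \<open>Local integrability and continuity in time\<close>

lemma sol_L1_loc:
  assumes t: "0 \<le> t" and K: "compact K"
  shows "set_integrable lebesgue K (\<lambda>x. sol s x t)"
proof -
  obtain b where b: "\<And>x. x \<in> K \<Longrightarrow> \<bar>x\<bar> \<le> b"
    using compact_imp_bounded[OF K] by (auto simp: bounded_iff)
  have "set_integrable lebesgue {-b..b} (\<lambda>x. sol s x t)"
    using sol_set_integrable[of s t "-b" b] s_pos t sol_measurable by (simp add: set_integrable_def integrable_completion)
  then show ?thesis
  proof (rule set_integrable_subset)
    show "K \<in> sets lebesgue" using K by (intro sets_completionI_sets) (simp add: borel_compact)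
    show "K \<subseteq> {-b..b}"
    proof
      fix x assume "x \<in> K"
      then show "x \<in> {-b..b}" using b[of x] by auto
    qed
  qed
qed

lemma sol_entropy_solution: "entropy_solution f (\<lambda>x. sol s x 0) (sol s)"
  unfolding entropy_solution_def
proof (intro conjI allI)
  let ?S = "(UNIV :: real set) \<times> {0::real..}"
  show "L_infty (lebesgue_on ?S) (\<lambda>(x, t). sol s x t)"
    unfolding L_infty_def
  proof (intro conjI exI)
    have "(\<lambda>(x, t). sol s x t) \<in> borel_measurable lebesgue"
      using sol2_measurable by (auto simp: case_prod_beta' intro: measurable_completion)
    then show "(\<lambda>(x, t). sol s x t) \<in> borel_measurable (lebesgue_on ?S)" by (rule measurable_restrict_space1)
    show "AE z in lebesgue_on ?S. \<bar>case z of (x, t) \<Rightarrow> sol s x t\<bar> \<le> node 0 powr s"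
      using sol_bound[of s] s_pos by (intro AE_I2) (auto simp: space_restrict_space)
  qed
  show "continuous_L1_loc (sol s)"
    unfolding continuous_L1_loc_def L1_loc_def
  proof (intro conjI allI impI)
    show "set_integrable lebesgue K (\<lambda>x. sol s x t)" if "0 \<le> t" "compact K" for t K
      using that by (rule sol_L1_loc)
    fix t0 :: real and K :: "real set" assume t0: "0 \<le> t0" and K: "compact K"
    \<comment> \<open>Time and space separate, so continuity in time reduces to that of the scalar
      factor (1 + t) powr (-s).\<close>
    have sep: "sol s x t = (1 + t) powr (- s) * sol s x 0" if "0 \<le> t" for x t
      using that powr_divide[of "\<bar>sdist x\<bar>" "1 + t" s] by (simp add: sol_def powr_minus_divide)
    have eq: "\<bar>(1 + t) powr (- s) - (1 + t0) powr (- s)\<bar> * (LINT x:K|lebesgue. \<bar>sol s x 0\<bar>)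
        = (LINT x:K|lebesgue. \<bar>sol s x t - sol s x t0\<bar>)" if "0 \<le> t" for t
    proof -
      have "\<bar>sol s x t - sol s x t0\<bar> = \<bar>(1 + t) powr (- s) - (1 + t0) powr (- s)\<bar> * \<bar>sol s x 0\<bar>" for x
        unfolding sep[OF that] sep[OF t0] by (simp add: abs_mult[symmetric] left_diff_distrib)
      then show ?thesis by simp
    qed
    have "((\<lambda>t. \<bar>(1 + t) powr (- s) - (1 + t0) powr (- s)\<bar> * (LINT x:K|lebesgue. \<bar>sol s x 0\<bar>)) \<longlongrightarrow>
        \<bar>(1 + t0) powr (- s) - (1 + t0) powr (- s)\<bar> * (LINT x:K|lebesgue. \<bar>sol s x 0\<bar>)) (at t0 within {0..})"
      using t0 by (intro tendsto_intros) auto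
    then have "((\<lambda>t. \<bar>(1 + t) powr (- s) - (1 + t0) powr (- s)\<bar> * (LINT x:K|lebesgue. \<bar>sol s x 0\<bar>)) \<longlongrightarrow> 0) (at t0 within {0..})"
      by simp
    then show "((\<lambda>t. LINT x:K|lebesgue. \<bar>sol s x t - sol s x t0\<bar>) \<longlongrightarrow> 0) (at t0 within {0..})"
      by (rule Lim_transform_eventually) (auto simp: eventually_at eq intro: exI[of _ 1])
  qed
  show "AE x in lebesgue. sol s x 0 = sol s x 0" by simp
  show "entropy_inequality f (sol s) k" for k by (rule sol_entropy_inequality)
qed

end

theorem theorem3p1:
  fixes p s :: real and f :: "real \<Rightarrow> real"
  assumes "p \<ge> 1"
    and "s = 1 / p"
    and "f = (\<lambda>u. \<bar>u\<bar> powr (p + 1) / (p + 1))"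
  shows "\<exists>u\<^sub>0 :: real \<Rightarrow> real.
           L_infty lebesgue u\<^sub>0 \<and> compact (tsupport u\<^sub>0) \<and>
           (\<exists>u. entropy_solution f u\<^sub>0 u) \<and>
           (\<forall>u. entropy_solution f u\<^sub>0 u \<longrightarrow>
              (\<forall>t>0. \<forall>\<epsilon>>0. TV_ae s (\<lambda>x. u x t) < \<infinity> \<and> TV_ae (s + \<epsilon>) (\<lambda>x. u x t) = \<infinity>))"
proof -
  interpret power_flux p s f by unfold_locales (use assms in auto)
  let ?u0 = "\<lambda>x. sol s x 0"
  show ?thesis
  proof (intro exI[of _ ?u0] conjI allI impI)
    show "L_infty lebesgue ?u0"
      unfolding L_infty_def using sol_lebesgue_measurable sol_bound[of s 0] s_pos
      by (auto intro!: exI[of _ "node 0 powr s"])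
    show "compact (tsupport ?u0)"
    proof -
      have "tsupport ?u0 \<subseteq> {0..node 0}"
        unfolding tsupport_def
        by (rule closure_minimal) (auto simp: sol_def sdist_def not_le split: if_splits)
      then show ?thesis
        by (metis closed_closure compact_Icc compact_Int_closed inf.absorb_iff2 tsupport_def)
    qed
    show "\<exists>u. entropy_solution f ?u0 u" using sol_entropy_solution by blast
    fix u and t \<epsilon> :: real assume u: "entropy_solution f ?u0 u" and t: "0 < t" and \<epsilon>: "0 < \<epsilon>"
    \<comment> \<open>Whatever entropy solution is given, uniqueness identifies it with
      \<open>sol\<close> at each time, so both claims pass to the explicit formula.\<close>
    have ae: "AE x in lebesgue. u x t = sol s x t"
      using entropy_solution_unique[OF u] t by simp
    have "TV_ae s (\<lambda>x. u x t) \<le> TV s (\<lambda>x. sol s x t)"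
      unfolding TV_ae_def
    proof (rule INF_lower, clarify)
      show "AE x in lebesgue. sol s x t = u x t" using ae by eventually_elim simp
    qed
    also have "\<dots> \<le> ennreal (2 powr p * (2 * node 0))"
      using t by (intro TV_sol_le p s_def) simp
    also have "\<dots> < \<infinity>" by simp
    finally show "TV_ae s (\<lambda>x. u x t) < \<infinity>" .
    \<comment> \<open>Every representative agrees with \<open>sol\<close> almost everywhere, so the
      infimum in \<open>TV_ae\<close> runs over values all equal to infinity; the index set contains
      the given solution itself, which rules out an infimum over the empty set.\<close>
    have "TV (s + \<epsilon>) w = \<infinity>" if "AE x in lebesgue. w x = u x t" for w
    proof (rule TV_infinite)
      show "AE x in lebesgue. w x = sol s x t" using that ae by eventually_elim simp
    qed (use s_pos \<epsilon> t in auto)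
    then have "(INF w\<in>{w. AE x in lebesgue. w x = u x t}. TV (s + \<epsilon>) w) = (INF w\<in>{w. AE x in lebesgue. w x = u x t}. \<infinity>)"
      by (intro INF_cong) auto
    also have "\<dots> = \<infinity>"
      by (rule INF_const) (auto intro!: exI[of _ "\<lambda>x. u x t"])
    finally show "TV_ae (s + \<epsilon>) (\<lambda>x. u x t) = \<infinity>" unfolding TV_ae_def .
  qed
qed

end
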